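(* Let $n\ge2$. The algebra $C_{U_S}(B)$ has a unique (up to isomorphism) one-dimensional module $V_{-\frac12}$, and it is defined by the map (for all $i,j,k,l\in\{2,\dots,n\}$ with $i\neq j$): $$A_{\epsilon_k+\epsilon_1}\mapsto-\tfrac12,\quad A_{\epsilon_k+\epsilon_l}\mapsto\tfrac14-\tfrac{\delta_{lk}}2,\quad A_{-\epsilon_k-\epsilon_l}\mapsto-1,$$ $$A_{\epsilon_i-\epsilon_j}\mapsto-\tfrac12,\quad A_{\epsilon_k-\epsilon_1}\mapsto-\tfrac14,\quad A_{-\epsilon_k-\epsilon_1}\mapsto-\tfrac12-n,\quad A_{-2\epsilon_1}\mapsto-n^2+\tfrac14 .$$
   Context: Fix an integer $n\ge 2$ and let $J_n=\begin{pmatrix}0&I_n\\-I_n&0\end{pmatrix}$, $\mathfrak{sp}_{2n}=\{A\in\mathfrak{gl}_{2n}(\mathbb{C})\mid A^tJ_n+J_nA=0\}$ (here $I_n$ in $J_n$ is the identity matrix). With $e_{i,j}$ the matrix units of $\mathfrak{gl}_{2n}$, put $h_i=e_{i,i}-e_{n+i,n+i}$ ($1\le i\le n$); $X_{\epsilon_i-\epsilon_j}=e_{i,j}-e_{n+j,n+i}$ ($i\ne j$); $X_{\epsilon_i+\epsilon_j}=e_{i,n+j}+e_{j,n+i}$ and $X_{-\epsilon_i-\epsilon_j}=e_{n+j,i}+e_{n+i,j}$ for all $i,j$ (so $X_{\pm(\epsilon_i+\epsilon_j)}$ is symmetric in $i,j$, and $X_{2\epsilon_1}=2e_{1,n+1}$).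 $S=\{X_{2\epsilon_1}^{i_1}X_{\epsilon_1-\epsilon_2}^{i_2}\cdots X_{\epsilon_1-\epsilon_n}^{i_n}\mid i_1,\dots,i_n\in\mathbb{Z}_{\ge0}\}$ is an Ore subset of $U(\mathfrak{sp}_{2n})$; $U_S$ is the localization of $U(\mathfrak{sp}_{2n})$ at $S$. $B$ is the subalgebra of $U_S$ generated by $h_1,\dots,h_n,X_{\epsilon_1-\epsilon_2}^{\pm1},\dots,X_{\epsilon_1-\epsilon_n}^{\pm1},X_{2\epsilon_1}^{\pm1}$, and $C_{U_S}(B)=\{u\in U_S\mid[u,B]=0\}$. In the rest write $I_n=h_1+\cdots+h_n$. For $i,j,k,l\in\{2,\dots,n\}$ define the elements of $U_S$: $$A_{\epsilon_k+\epsilon_1}=X_{\epsilon_k+\epsilon_1}X_{\epsilon_1-\epsilon_k}X_{2\epsilon_1}^{-1}-h_k,$$ $$A_{\epsilon_k+\epsilon_l}=X_{\epsilon_k+\epsilon_l}X_{\epsilon_1-\epsilon_k}X_{\epsilon_1-\epsilon_l}X_{2\epsilon_1}^{-1}-X_{\epsilon_1+\epsilon_l}h_kX_{\epsilon_1-\epsilon_l}X_{2\epsilon_1}^{-1}-X_{\epsilon_1+\epsilon_k}h_lX_{\epsilon_1-\epsilon_k}X_{2\epsilon_1}^{-1}+h_l(h_k-\delta_{lk}),$$ $$A_{\epsilon_i-\epsilon_j}=X_{\epsilon_i-\epsilon_j}X_{\epsilon_1-\epsilon_i}X_{\epsilon_1-\epsilon_j}^{-1}-h_i\quad(i\ne j),$$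 $$A_{\epsilon_k-\epsilon_1}=X_{\epsilon_k-\epsilon_1}X_{\epsilon_1-\epsilon_k}+\sum_{j=2,\,j\neq k}^nX_{\epsilon_k-\epsilon_j}(h_j-1)X_{\epsilon_1-\epsilon_k}X_{\epsilon_1-\epsilon_j}^{-1}+h_k(h_k-1)-X_{\epsilon_k+\epsilon_1}(I_n+2)X_{\epsilon_1-\epsilon_k}X_{2\epsilon_1}^{-1},$$ $$A_{-2\epsilon_1}=X_{-2\epsilon_1}X_{2\epsilon_1}+\sum_{k=2}^n2X_{-\epsilon_1-\epsilon_k}h_kX_{\epsilon_1-\epsilon_k}^{-1}X_{2\epsilon_1}-\sum_{k=2}^nX_{-2\epsilon_k}h_kX_{\epsilon_1-\epsilon_k}^{-2}X_{2\epsilon_1}+\sum_{k,l=2}^nX_{-\epsilon_k-\epsilon_l}h_kh_lX_{\epsilon_1-\epsilon_k}^{-1}X_{\epsilon_1-\epsilon_l}^{-1}X_{2\epsilon_1}+(I_n+2n)I_n,$$ $$A_{-\epsilon_1-\epsilon_k}=X_{-\epsilon_1-\epsilon_k}X_{\epsilon_1-\epsilon_k}^{-1}X_{2\epsilon_1}+\sum_{l=2}^nX_{-\epsilon_k-\epsilon_l}h_lX_{\epsilon_1-\epsilon_k}^{-1}X_{\epsilon_1-\epsilon_l}^{-1}X_{2\epsilon_1}+I_n,$$ $$A_{-\epsilon_k-\epsilon_l}=X_{-\epsilon_k-\epsilon_l}X_{\epsilon_1-\epsilon_k}^{-1}X_{\epsilon_1-\epsilon_l}^{-1}X_{2\epsilon_1}.$$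 Also $A_{-\epsilon_k-\epsilon_1}$ means $A_{-\epsilon_1-\epsilon_k}$. These elements lie in $C_{U_S}(B)$ and generate it as an algebra. *)

theory Defs
  imports "HOL-Analysis.Analysis" "HOL-Library.Poly_Mapping"
begin

section \<open>Associative algebras over the complex numbers\<close>

class complex_algebra_1 = ring_1 +
  fixes scaleC :: "complex \<Rightarrow> 'a \<Rightarrow> 'a"
  assumes scaleC_add_right: "scaleC c (x + y) = scaleC c x + scaleC c y"
    and scaleC_add_left: "scaleC (c + d) x = scaleC c x + scaleC d x"
    and scaleC_scaleC: "scaleC c (scaleC d x) = scaleC (c * d) x"
    and scaleC_one: "scaleC 1 x = x"
    and mult_scaleC_left: "scaleC c x * y = scaleC c (x * y)"
    and mult_scaleC_right: "x * scaleC c y = scaleC c (x * y)"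

definition alg_hom :: "('a::complex_algebra_1 \<Rightarrow> 'b::complex_algebra_1) \<Rightarrow> bool" where
  "alg_hom f \<longleftrightarrow> f 1 = 1 \<and> (\<forall>x y. f (x + y) = f x + f y) \<and> (\<forall>x y. f (x * y) = f x * f y)
     \<and> (\<forall>c x. f (scaleC c x) = scaleC c (f x))"

definition subalgebra :: "'a::complex_algebra_1 set \<Rightarrow> bool" where
  "subalgebra B \<longleftrightarrow> 1 \<in> B \<and> (\<forall>x\<in>B. \<forall>y\<in>B. x + y \<in> B) \<and> (\<forall>x\<in>B. \<forall>y\<in>B. x * y \<in> B)
     \<and> (\<forall>c. \<forall>x\<in>B. scaleC c x \<in> B)"

definition centralizer :: "'a::ring_1 set \<Rightarrow> 'a set" where
  "centralizer B = {u. \<forall>b\<in>B. u * b - b * u = 0}"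

definition invertible_elt :: "'a::ring_1 \<Rightarrow> bool" where
  "invertible_elt x \<longleftrightarrow> (\<exists>y. x * y = 1 \<and> y * x = 1)"

text \<open>The two-sided inverse in a not necessarily commutative ring; only meaningful on
  invertible elements.\<close>
definition rinv :: "'a::ring_1 \<Rightarrow> 'a" where
  "rinv x = (THE y. x * y = 1 \<and> y * x = 1)"

text \<open>\<open>\<theta> : U \<rightarrow> Q\<close> is the (left) Ore localization of \<open>U\<close> at \<open>S\<close>: the elements of \<open>S\<close> become
  invertible, every element of \<open>Q\<close> is a fraction \<open>\<theta>(s)\<^sup>-\<^sup>1 \<theta>(u)\<close>, and the kernel of \<open>\<theta>\<close> is the
  \<open>S\<close>-torsion of \<open>U\<close>. These properties determine \<open>(Q, \<theta>)\<close> up to a unique isomorphism under \<open>U\<close>.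
  Where \<open>S\<close> is Ore on both sides, the left and the right localization agree.\<close>
definition is_localization ::
    "'u::complex_algebra_1 set \<Rightarrow> ('u \<Rightarrow> 'q::complex_algebra_1) \<Rightarrow> bool" where
  "is_localization S \<theta> \<longleftrightarrow> alg_hom \<theta>
     \<and> (\<forall>s\<in>S. invertible_elt (\<theta> s))
     \<and> (\<forall>q. \<exists>s\<in>S. \<exists>u. q = rinv (\<theta> s) * \<theta> u)
     \<and> (\<forall>u. \<theta> u = 0 \<longleftrightarrow> (\<exists>s\<in>S. s * u = 0))"


section \<open>Modules over a subalgebra\<close>

text \<open>A module over the subalgebra \<open>C\<close>: a complex vector space (a type \<open>'v\<close> with the scalar
  multiplication \<open>sc\<close>) with an action \<open>\<rho>\<close>, whose values outside \<open>C\<close> are irrelevant.\<close>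
definition alg_module :: "'a::complex_algebra_1 set \<Rightarrow> (complex \<Rightarrow> 'v::ab_group_add \<Rightarrow> 'v)
    \<Rightarrow> ('a \<Rightarrow> 'v \<Rightarrow> 'v) \<Rightarrow> bool" where
  "alg_module C sc \<rho> \<longleftrightarrow> vector_space sc
     \<and> (\<forall>a\<in>C. Vector_Spaces.linear sc sc (\<rho> a))
     \<and> (\<forall>v. \<rho> 1 v = v)
     \<and> (\<forall>a\<in>C. \<forall>b\<in>C. \<forall>v. \<rho> (a + b) v = \<rho> a v + \<rho> b v)
     \<and> (\<forall>a\<in>C. \<forall>b\<in>C. \<forall>v. \<rho> (a * b) v = \<rho> a (\<rho> b v))
     \<and> (\<forall>c. \<forall>a\<in>C. \<forall>v. \<rho> (scaleC c a) v = sc c (\<rho> a v))"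

definition one_dim_module :: "'a::complex_algebra_1 set \<Rightarrow> (complex \<Rightarrow> 'v::ab_group_add \<Rightarrow> 'v)
    \<Rightarrow> ('a \<Rightarrow> 'v \<Rightarrow> 'v) \<Rightarrow> bool" where
  "one_dim_module C sc \<rho> \<longleftrightarrow> alg_module C sc \<rho> \<and> vector_space.dim sc (UNIV :: 'v set) = 1"

definition module_isomorphic :: "'a set
    \<Rightarrow> (complex \<Rightarrow> 'v::ab_group_add \<Rightarrow> 'v) \<Rightarrow> ('a \<Rightarrow> 'v \<Rightarrow> 'v)
    \<Rightarrow> (complex \<Rightarrow> 'w::ab_group_add \<Rightarrow> 'w) \<Rightarrow> ('a \<Rightarrow> 'w \<Rightarrow> 'w) \<Rightarrow> bool" where
  "module_isomorphic C sc \<rho> sc' \<rho>' \<longleftrightarrow>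
     (\<exists>f. Vector_Spaces.linear sc sc' f \<and> bij f \<and> (\<forall>a\<in>C. \<forall>v. f (\<rho> a v) = \<rho>' a (f v)))"

text \<open>\<open>a\<close> is an element of \<open>C\<close> and is mapped to the scalar \<open>c\<close> by the module \<open>(sc, \<rho>)\<close>.\<close>
definition acts_by :: "'a set \<Rightarrow> (complex \<Rightarrow> 'v \<Rightarrow> 'v) \<Rightarrow> ('a \<Rightarrow> 'v \<Rightarrow> 'v) \<Rightarrow> 'a \<Rightarrow> complex \<Rightarrow> bool" where
  "acts_by C sc \<rho> a c \<longleftrightarrow> a \<in> C \<and> (\<forall>v. \<rho> a v = sc c v)"


section \<open>The symplectic Lie algebra\<close>

text \<open>The index set \<open>{1, ..., n}\<close> is a finite linearly ordered type \<open>'n\<close> with \<open>n = CARD('n)\<close>, so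
  that \<open>1\<close> is its least element. The rows and columns \<open>1, ..., 2n\<close> are indexed by \<open>'n + 'n\<close>:
  \<open>Inl i\<close> stands for \<open>i\<close> and \<open>Inr i\<close> for \<open>n + i\<close>.\<close>

type_synonym 'n mat2 = "complex ^ ('n + 'n) ^ ('n + 'n)"

definition Jmat :: "'n::finite mat2" where
  "Jmat = (\<chi> a b. case (a, b) of
       (Inl i, Inr j) \<Rightarrow> if i = j then 1 else 0
     | (Inr i, Inl j) \<Rightarrow> if i = j then - 1 else 0
     | _ \<Rightarrow> 0)"

definition unit_mat :: "'n::finite + 'n \<Rightarrow> 'n + 'n \<Rightarrow> 'n mat2" where
  "unit_mat i j = (\<chi> a b. if a = i \<and> b = j then 1 else 0)"

lemma unit_mat_nth: "unit_mat i j $ a $ b = of_bool (a = i) * of_bool (b = j)"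
  by (simp add: unit_mat_def)

definition sp_set :: "'n::finite mat2 set" where
  "sp_set = {A. transpose A ** Jmat + Jmat ** A = 0}"

lemma mat2_eq_iff: "A = B \<longleftrightarrow> (\<forall>i j. A $ Inl i $ Inl j = B $ Inl i $ Inl j
    \<and> A $ Inl i $ Inr j = B $ Inl i $ Inr j \<and> A $ Inr i $ Inl j = B $ Inr i $ Inl j
    \<and> A $ Inr i $ Inr j = B $ Inr i $ Inr j)" for A B :: "'n::finite mat2"
proof
  assume *: "\<forall>i j. A $ Inl i $ Inl j = B $ Inl i $ Inl j
    \<and> A $ Inl i $ Inr j = B $ Inl i $ Inr j \<and> A $ Inr i $ Inl j = B $ Inr i $ Inl j
    \<and> A $ Inr i $ Inr j = B $ Inr i $ Inr j"
  have "A $ a $ b = B $ a $ b" for a b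
    using * by (cases a; cases b) auto
  then show "A = B" by (simp add: vec_eq_iff)
qed auto

lemma sum_UNIV_sum: "sum f (UNIV :: ('n::finite + 'n) set) = (\<Sum>i\<in>UNIV. f (Inl i)) + (\<Sum>i\<in>UNIV. f (Inr i))"
  by (simp add: UNIV_Plus_UNIV[symmetric] sum.Plus del: UNIV_Plus_UNIV)

text \<open>The block form of the defining equation.\<close>
lemma sp_set_iff: "A \<in> sp_set \<longleftrightarrow> (\<forall>i j. A $ Inr i $ Inl j = A $ Inr j $ Inl i
    \<and> A $ Inl i $ Inr j = A $ Inl j $ Inr i \<and> A $ Inr i $ Inr j = - A $ Inl j $ Inl i)"
  for A :: "'n::finite mat2"
proof -
  have 1: "(transpose A ** Jmat) $ a $ Inl j = - A $ Inr j $ a"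
    "(transpose A ** Jmat) $ a $ Inr j = A $ Inl j $ a"
    "(Jmat ** A) $ Inl i $ b = A $ Inr i $ b"
    "(Jmat ** A) $ Inr i $ b = - A $ Inl i $ b" for a b i j
    by (simp_all add: matrix_matrix_mult_def transpose_def Jmat_def sum_UNIV_sum
        if_distrib if_distribR sum.delta sum.delta' cong: if_cong)
  have "A \<in> sp_set \<longleftrightarrow> (\<forall>i j. A $ Inr i $ Inl j - A $ Inr j $ Inl i = 0
    \<and> A $ Inr i $ Inr j + A $ Inl j $ Inl i = 0
    \<and> - (A $ Inr j $ Inr i + A $ Inl i $ Inl j) = 0
    \<and> A $ Inl j $ Inr i - A $ Inl i $ Inr j = 0)"
    unfolding sp_set_def mem_Collect_eq mat2_eq_iff by (simp add: 1 algebra_simps)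
  also have "\<dots> \<longleftrightarrow> (\<forall>i j. A $ Inr i $ Inl j = A $ Inr j $ Inl i
    \<and> A $ Inl i $ Inr j = A $ Inl j $ Inr i \<and> A $ Inr i $ Inr j = - A $ Inl j $ Inl i)"
    unfolding neg_equal_0_iff_equal add_eq_0_iff2 right_minus_eq by metis
  finally show ?thesis .
qed

typedef 'n sp = "sp_set :: 'n::finite mat2 set"
  by (rule exI[of _ 0]) (simp add: sp_set_iff)

setup_lifting type_definition_sp

lift_definition sp_add :: "'n::finite sp \<Rightarrow> 'n sp \<Rightarrow> 'n sp" is "(+)"
  by (auto simp: sp_set_iff)

lift_definition sp_scale :: "complex \<Rightarrow> 'n::finite sp \<Rightarrow> 'n sp" is
  "\<lambda>c A. \<chi> a b. c * A $ a $ b"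
  by (auto simp: sp_set_iff)

lift_definition sp_bracket :: "'n::finite sp \<Rightarrow> 'n sp \<Rightarrow> 'n sp" is "\<lambda>A B. A ** B - B ** A"
proof -
  fix A B :: "'n mat2"
  assume "A \<in> sp_set" "B \<in> sp_set"
  then show "A ** B - B ** A \<in> sp_set"
    unfolding sp_set_iff
    by (auto simp: matrix_matrix_mult_def sum_UNIV_sum sum_negf mult.commute algebra_simps)
qed

lift_definition sp_h :: "'n::finite \<Rightarrow> 'n sp" is
  "\<lambda>i. unit_mat (Inl i) (Inl i) - unit_mat (Inr i) (Inr i)"
  by (simp add: sp_set_iff unit_mat_nth mult.commute add.commute)

text \<open>\<open>X\<^bsub>\<epsilon>\<^sub>i - \<epsilon>\<^sub>j\<^esub>\<close>, to be used for \<open>i \<noteq> j\<close> only.\<close>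
lift_definition sp_diff :: "'n::finite \<Rightarrow> 'n \<Rightarrow> 'n sp" is
  "\<lambda>i j. unit_mat (Inl i) (Inl j) - unit_mat (Inr j) (Inr i)"
  by (simp add: sp_set_iff unit_mat_nth mult.commute add.commute)

text \<open>\<open>X\<^bsub>\<epsilon>\<^sub>i + \<epsilon>\<^sub>j\<^esub>\<close>\<close>
lift_definition sp_pos :: "'n::finite \<Rightarrow> 'n \<Rightarrow> 'n sp" is
  "\<lambda>i j. unit_mat (Inl i) (Inr j) + unit_mat (Inl j) (Inr i)"
  by (simp add: sp_set_iff unit_mat_nth mult.commute add.commute)

text \<open>\<open>X\<^bsub>- \<epsilon>\<^sub>i - \<epsilon>\<^sub>j\<^esub>\<close>\<close>
lift_definition sp_neg :: "'n::finite \<Rightarrow> 'n \<Rightarrow> 'n sp" is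
  "\<lambda>i j. unit_mat (Inr j) (Inl i) + unit_mat (Inr i) (Inl j)"
  by (simp add: sp_set_iff unit_mat_nth mult.commute add.commute)


section \<open>The universal enveloping algebra\<close>

datatype 'a fword = FWord (letters: "'a list")

instantiation fword :: (type) monoid_add
begin
definition "0 = FWord []"
definition "v + w = FWord (letters v @ letters w)"
instance
  by standard (auto simp: zero_fword_def plus_fword_def)
end

text \<open>The monoid algebra of the free monoid, that is, the free associative algebra on \<open>'a\<close>.\<close>
type_synonym 'a free_alg = "'a fword \<Rightarrow>\<^sub>0 complex"

definition fgen :: "'a \<Rightarrow> 'a free_alg" where
  "fgen x = Poly_Mapping.single (FWord [x]) 1"

definition fconst :: "complex \<Rightarrow> 'a free_alg" where
  "fconst c = Poly_Mapping.single 0 c"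

text \<open>The free algebra on the set \<open>sp\<close> modulo the first two families is the tensor algebra of the
  vector space \<open>sp\<close>; the third family imposes \<open>x y - y x = [x, y]\<close>.\<close>
definition env_rels :: "'n::finite sp free_alg set" where
  "env_rels = {fgen (sp_add x y) - (fgen x + fgen y) | x y. True}
     \<union> {fgen (sp_scale c x) - fconst c * fgen x | c x. True}
     \<union> {fgen x * fgen y - fgen y * fgen x - fgen (sp_bracket x y) | x y. True}"

inductive_set two_sided_ideal :: "'a::ring_1 set \<Rightarrow> 'a set" for R where
  ideal_gen: "r \<in> R \<Longrightarrow> r \<in> two_sided_ideal R"
| ideal_zero: "0 \<in> two_sided_ideal R"
| ideal_add: "x \<in> two_sided_ideal R \<Longrightarrow> y \<in> two_sided_ideal R \<Longrightarrow> x + y \<in> two_sided_ideal R"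
| ideal_left: "x \<in> two_sided_ideal R \<Longrightarrow> a * x \<in> two_sided_ideal R"
| ideal_right: "x \<in> two_sided_ideal R \<Longrightarrow> x * a \<in> two_sided_ideal R"

lemma ideal_uminus: "x \<in> two_sided_ideal R \<Longrightarrow> - x \<in> two_sided_ideal R"
  using ideal_left[of x R "- 1"] by simp

definition env_eq :: "'n::finite sp free_alg \<Rightarrow> 'n sp free_alg \<Rightarrow> bool" where
  "env_eq p q \<longleftrightarrow> p - q \<in> two_sided_ideal env_rels"

lemma env_eq_equivp: "equivp env_eq"
proof (rule equivpI)
  show "reflp env_eq"
    by (rule reflpI) (simp add: env_eq_def ideal_zero)
  show "symp env_eq"
    using ideal_uminus by (fastforce intro: sympI simp: env_eq_def)
  show "transp env_eq"
    using ideal_add by (fastforce intro: transpI simp: env_eq_def)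
qed

quotient_type 'n usp = "'n::finite sp free_alg" / env_eq
  by (rule env_eq_equivp)

lemma fword_add_eq_0_iff: "v + w = 0 \<longleftrightarrow> v = 0 \<and> w = 0" for v w :: "'a fword"
  by (cases v; cases w) (auto simp: zero_fword_def plus_fword_def)

lemma lookup_mult_0: "Poly_Mapping.lookup (p * q) 0 = Poly_Mapping.lookup p 0 * Poly_Mapping.lookup q 0"
  for p q :: "'a free_alg"
proof -
  have "Poly_Mapping.lookup (p * q) 0 =
      (\<Sum>l. Poly_Mapping.lookup p l * (\<Sum>r. Poly_Mapping.lookup q r when 0 = l + r))"
    by (simp add: lookup_mult)
  also have "(\<lambda>l. Poly_Mapping.lookup p l * (\<Sum>r. Poly_Mapping.lookup q r when 0 = l + r))
      = (\<lambda>l. Poly_Mapping.lookup p l * Poly_Mapping.lookup q 0 when l = 0)"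
  proof
    fix l :: "'a fword"
    show "Poly_Mapping.lookup p l * (\<Sum>r. Poly_Mapping.lookup q r when 0 = l + r)
      = (Poly_Mapping.lookup p l * Poly_Mapping.lookup q 0 when l = 0)"
    proof (cases "l = 0")
      case True
      then show ?thesis by (simp add: eq_commute[of 0])
    next
      case False
      then have "(0 = l + r) = False" for r
        using fword_add_eq_0_iff[of l r] by metis
      then show ?thesis using False by simp
    qed
  qed
  finally show ?thesis by simp
qed

lemma env_ideal_lookup_0: "p \<in> two_sided_ideal env_rels \<Longrightarrow> Poly_Mapping.lookup p 0 = 0"
proof (induction rule: two_sided_ideal.induct)
  case (ideal_gen r)
  have *: "Poly_Mapping.lookup (fgen x) 0 = 0" for x :: "'n sp"
    by (simp add: fgen_def lookup_single zero_fword_def)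
  show ?case
    using ideal_gen by (auto simp: env_rels_def lookup_minus lookup_add lookup_mult_0 *)
qed (auto simp: lookup_add lookup_mult_0)

instantiation usp :: (finite) complex_algebra_1
begin

lift_definition zero_usp :: "'a usp" is 0 .
lift_definition one_usp :: "'a usp" is 1 .
lift_definition plus_usp :: "'a usp \<Rightarrow> 'a usp \<Rightarrow> 'a usp" is "(+)"
  unfolding env_eq_def by (drule (1) ideal_add) (simp add: algebra_simps)
lift_definition uminus_usp :: "'a usp \<Rightarrow> 'a usp" is uminus
  unfolding env_eq_def by (drule ideal_uminus) simp
lift_definition minus_usp :: "'a usp \<Rightarrow> 'a usp \<Rightarrow> 'a usp" is "(-)"
proof -
  fix p p' q q' :: "'a sp free_alg"
  assume "env_eq p p'" "env_eq q q'"
  then have "(p - p') + - (q - q') \<in> two_sided_ideal env_rels"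
    unfolding env_eq_def by (intro ideal_add ideal_uminus)
  then show "env_eq (p - q) (p' - q')"
    by (simp add: env_eq_def algebra_simps)
qed
lift_definition times_usp :: "'a usp \<Rightarrow> 'a usp \<Rightarrow> 'a usp" is "(*)"
proof -
  fix p p' q q' :: "'a sp free_alg"
  assume "env_eq p p'" "env_eq q q'"
  then have "(p - p') * q + p' * (q - q') \<in> two_sided_ideal env_rels"
    unfolding env_eq_def by (intro ideal_add ideal_left ideal_right)
  then show "env_eq (p * q) (p' * q')"
    by (simp add: env_eq_def algebra_simps)
qed
lift_definition scaleC_usp :: "complex \<Rightarrow> 'a usp \<Rightarrow> 'a usp" is "\<lambda>c p. fconst c * p"
  unfolding env_eq_def by (metis ideal_left right_diff_distrib)

instance
proof
  have refl: "env_eq x x" for x :: "'a sp free_alg"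
    by (simp add: env_eq_def ideal_zero)
  have comm: "x * fconst c = fconst c * x" for c and x :: "'a sp free_alg"
  proof (induction x rule: update_induct)
    case (update f a b)
    then have "Poly_Mapping.update a b f = f + Poly_Mapping.single a b"
      by (intro poly_mapping_eqI) (auto simp: lookup_update lookup_add lookup_single in_keys_iff)
    then show ?case
      using update.IH by (simp add: fconst_def distrib_left distrib_right mult_single mult.commute)
  qed simp
  have const_add: "fconst (c + d) = fconst c + (fconst d :: 'a sp free_alg)" for c d
    by (simp add: fconst_def single_add)
  have const_mult: "fconst (c * d) = fconst c * (fconst d :: 'a sp free_alg)" for c d
    by (simp add: fconst_def mult_single)
  fix a b c :: "'a usp" and s t :: complex
  show "a + b + c = a + (b + c)" by transfer (simp add: add.assoc refl)
  show "a + b = b + a" by transfer (simp add: add.commute refl)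
  show "0 + a = a" by transfer (simp add: refl)
  show "- a + a = 0" by transfer (simp add: refl)
  show "a - b = a + - b" by transfer (simp add: refl)
  show "a * b * c = a * (b * c)" by transfer (simp add: mult.assoc refl)
  show "1 * a = a" by transfer (simp add: refl)
  show "a * 1 = a" by transfer (simp add: refl)
  show "(a + b) * c = a * c + b * c" by transfer (simp add: distrib_right refl)
  show "a * (b + c) = a * b + a * c" by transfer (simp add: distrib_left refl)
  show "(0 :: 'a usp) \<noteq> 1"
    by transfer (use env_ideal_lookup_0 in \<open>fastforce simp: env_eq_def lookup_minus lookup_one\<close>)
  show "scaleC s (a + b) = scaleC s a + scaleC s b"
    by transfer (simp add: distrib_left refl)
  show "scaleC (s + t) a = scaleC s a + scaleC t a"
    by transfer (simp add: const_add distrib_right refl)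
  show "scaleC s (scaleC t a) = scaleC (s * t) a"
    by transfer (simp add: const_mult mult.assoc refl)
  show "scaleC 1 a = a"
    by transfer (simp add: fconst_def refl)
  show "scaleC s a * b = scaleC s (a * b)"
    by transfer (simp add: mult.assoc refl)
  show "a * scaleC s b = scaleC s (a * b)"
    by transfer (metis comm mult.assoc refl)
qed

end

definition usp_inj :: "'n::finite sp \<Rightarrow> 'n usp" where
  "usp_inj x = abs_usp (fgen x)"


section \<open>The Ore set, the subalgebra \<open>B\<close> and its centralizer\<close>

definition ix1 :: "'n::{finite,linorder}" where
  "ix1 = Min UNIV"

text \<open>The index set \<open>{2, ..., n}\<close>.\<close>
definition ixs :: "'n::{finite,linorder} set" where
  "ixs = UNIV - {ix1}"

definition ore_set :: "'n::{finite,linorder} usp set" where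
  "ore_set = {usp_inj (sp_pos ix1 ix1) ^ m ix1
      * prod_list (map (\<lambda>k. usp_inj (sp_diff ix1 k) ^ m k) (sorted_list_of_set ixs))
    | m :: 'n \<Rightarrow> nat. True}"

text \<open>In the following, \<open>\<theta>\<close> is the localization map from the enveloping algebra \<open>U\<close> to \<open>U\<^sub>S\<close>.\<close>

abbreviation hh :: "('n::finite usp \<Rightarrow> 'q) \<Rightarrow> 'n \<Rightarrow> 'q" where
  "hh \<theta> i \<equiv> \<theta> (usp_inj (sp_h i))"
abbreviation Xdiff :: "('n::finite usp \<Rightarrow> 'q) \<Rightarrow> 'n \<Rightarrow> 'n \<Rightarrow> 'q" where
  "Xdiff \<theta> i j \<equiv> \<theta> (usp_inj (sp_diff i j))"
abbreviation Xpos :: "('n::finite usp \<Rightarrow> 'q) \<Rightarrow> 'n \<Rightarrow> 'n \<Rightarrow> 'q" where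
  "Xpos \<theta> i j \<equiv> \<theta> (usp_inj (sp_pos i j))"
abbreviation Xneg :: "('n::finite usp \<Rightarrow> 'q) \<Rightarrow> 'n \<Rightarrow> 'n \<Rightarrow> 'q" where
  "Xneg \<theta> i j \<equiv> \<theta> (usp_inj (sp_neg i j))"

definition B_alg :: "('n::{finite,linorder} usp \<Rightarrow> 'q::complex_algebra_1) \<Rightarrow> 'q set" where
  "B_alg \<theta> = subalgebra hull (range (hh \<theta>)
     \<union> Xdiff \<theta> ix1 ` ixs \<union> (\<lambda>k. rinv (Xdiff \<theta> ix1 k)) ` ixs
     \<union> {Xpos \<theta> ix1 ix1, rinv (Xpos \<theta> ix1 ix1)})"

definition C_alg :: "('n::{finite,linorder} usp \<Rightarrow> 'q::complex_algebra_1) \<Rightarrow> 'q set" where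
  "C_alg \<theta> = centralizer (B_alg \<theta>)"


section \<open>The elements \<open>A\<^sub>\<alpha>\<close>\<close>

definition hsum :: "('n::finite usp \<Rightarrow> 'q::ring_1) \<Rightarrow> 'q" where
  "hsum \<theta> = (\<Sum>i\<in>UNIV. hh \<theta> i)"

text \<open>\<open>A\<^bsub>\<epsilon>\<^sub>k + \<epsilon>\<^sub>1\<^esub>\<close>\<close>
definition A_pos1 :: "('n::{finite,linorder} usp \<Rightarrow> 'q::ring_1) \<Rightarrow> 'n \<Rightarrow> 'q" where
  "A_pos1 \<theta> k = Xpos \<theta> k ix1 * Xdiff \<theta> ix1 k * rinv (Xpos \<theta> ix1 ix1) - hh \<theta> k"

text \<open>\<open>A\<^bsub>\<epsilon>\<^sub>k + \<epsilon>\<^sub>l\<^esub>\<close>\<close>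
definition A_pos :: "('n::{finite,linorder} usp \<Rightarrow> 'q::ring_1) \<Rightarrow> 'n \<Rightarrow> 'n \<Rightarrow> 'q" where
  "A_pos \<theta> k l =
     Xpos \<theta> k l * Xdiff \<theta> ix1 k * Xdiff \<theta> ix1 l * rinv (Xpos \<theta> ix1 ix1)
     - Xpos \<theta> ix1 l * hh \<theta> k * Xdiff \<theta> ix1 l * rinv (Xpos \<theta> ix1 ix1)
     - Xpos \<theta> ix1 k * hh \<theta> l * Xdiff \<theta> ix1 k * rinv (Xpos \<theta> ix1 ix1)
     + hh \<theta> l * (hh \<theta> k - (if l = k then 1 else 0))"

text \<open>\<open>A\<^bsub>\<epsilon>\<^sub>i - \<epsilon>\<^sub>j\<^esub>\<close>\<close>
definition A_diff :: "('n::{finite,linorder} usp \<Rightarrow> 'q::ring_1) \<Rightarrow> 'n \<Rightarrow> 'n \<Rightarrow> 'q" where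
  "A_diff \<theta> i j = Xdiff \<theta> i j * Xdiff \<theta> ix1 i * rinv (Xdiff \<theta> ix1 j) - hh \<theta> i"

text \<open>\<open>A\<^bsub>\<epsilon>\<^sub>k - \<epsilon>\<^sub>1\<^esub>\<close>\<close>
definition A_diff1 :: "('n::{finite,linorder} usp \<Rightarrow> 'q::ring_1) \<Rightarrow> 'n \<Rightarrow> 'q" where
  "A_diff1 \<theta> k =
     Xdiff \<theta> k ix1 * Xdiff \<theta> ix1 k
     + (\<Sum>j\<in>ixs - {k}. Xdiff \<theta> k j * (hh \<theta> j - 1) * Xdiff \<theta> ix1 k * rinv (Xdiff \<theta> ix1 j))
     + hh \<theta> k * (hh \<theta> k - 1)
     - Xpos \<theta> k ix1 * (hsum \<theta> + 2) * Xdiff \<theta> ix1 k * rinv (Xpos \<theta> ix1 ix1)"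

text \<open>\<open>A\<^bsub>- 2 \<epsilon>\<^sub>1\<^esub>\<close>\<close>
definition A_neg11 :: "('n::{finite,linorder} usp \<Rightarrow> 'q::ring_1) \<Rightarrow> 'q" where
  "A_neg11 \<theta> =
     Xneg \<theta> ix1 ix1 * Xpos \<theta> ix1 ix1
     + (\<Sum>k\<in>ixs. 2 * Xneg \<theta> ix1 k * hh \<theta> k * rinv (Xdiff \<theta> ix1 k) * Xpos \<theta> ix1 ix1)
     - (\<Sum>k\<in>ixs. Xneg \<theta> k k * hh \<theta> k * (rinv (Xdiff \<theta> ix1 k))\<^sup>2 * Xpos \<theta> ix1 ix1)
     + (\<Sum>k\<in>ixs. \<Sum>l\<in>ixs. Xneg \<theta> k l * hh \<theta> k * hh \<theta> l
          * rinv (Xdiff \<theta> ix1 k) * rinv (Xdiff \<theta> ix1 l) * Xpos \<theta> ix1 ix1)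
     + (hsum \<theta> + 2 * of_nat (CARD('n))) * hsum \<theta>"

text \<open>\<open>A\<^bsub>- \<epsilon>\<^sub>1 - \<epsilon>\<^sub>k\<^esub> = A\<^bsub>- \<epsilon>\<^sub>k - \<epsilon>\<^sub>1\<^esub>\<close>\<close>
definition A_neg1 :: "('n::{finite,linorder} usp \<Rightarrow> 'q::ring_1) \<Rightarrow> 'n \<Rightarrow> 'q" where
  "A_neg1 \<theta> k =
     Xneg \<theta> ix1 k * rinv (Xdiff \<theta> ix1 k) * Xpos \<theta> ix1 ix1
     + (\<Sum>l\<in>ixs. Xneg \<theta> k l * hh \<theta> l
          * rinv (Xdiff \<theta> ix1 k) * rinv (Xdiff \<theta> ix1 l) * Xpos \<theta> ix1 ix1)
     + hsum \<theta>"

text \<open>\<open>A\<^bsub>- \<epsilon>\<^sub>k - \<epsilon>\<^sub>l\<^esub>\<close>\<close>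
definition A_neg :: "('n::{finite,linorder} usp \<Rightarrow> 'q::ring_1) \<Rightarrow> 'n \<Rightarrow> 'n \<Rightarrow> 'q" where
  "A_neg \<theta> k l =
     Xneg \<theta> k l * rinv (Xdiff \<theta> ix1 k) * rinv (Xdiff \<theta> ix1 l) * Xpos \<theta> ix1 ix1"

end

theory Submission
  imports Defs
begin

text \<open>The proof rests on one representation and one normal form.

\<^bold>\<open>Existence.\<close> In the Weyl algebra with generators \<open>x\<^sub>i, \<partial>\<^sub>i\<close> the quadratic elements form a copy of
\<open>sp\<^sub>2\<^sub>n\<close>: \<open>X\<^bsub>\<epsilon>\<^sub>i - \<epsilon>\<^sub>j\<^esub>\<close> becomes \<open>x\<^sub>i \<partial>\<^sub>j\<close>, \<open>X\<^bsub>\<epsilon>\<^sub>i + \<epsilon>\<^sub>j\<^esub>\<close> becomes \<open>x\<^sub>i x\<^sub>j\<close>, \<open>X\<^bsub>- \<epsilon>\<^sub>i - \<epsilon>\<^sub>j\<^esub>\<close> becomes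
\<open>- \<partial>\<^sub>i \<partial>\<^sub>j\<close> and \<open>h\<^sub>i\<close> becomes \<open>x\<^sub>i \<partial>\<^sub>i + 1/2\<close> (the oscillator representation). Let \<open>x\<^sub>i, \<partial>\<^sub>i\<close> act by
weighted shifts on the functions on \<open>\<int>\<^sup>n\<close>, in such a way that \<open>x\<^sub>1\<close> and \<open>\<partial>\<^sub>2, \<dots>, \<partial>\<^sub>n\<close> are invertible.
Then the Ore set acts invertibly, so the action extends to \<open>U\<^sub>S\<close> (\<open>localization_universal\<close>). The
joint eigenspaces of the \<open>h\<^sub>i\<close> are lines and the centralizer \<open>C\<close> of \<open>B\<close> preserves them; its action on
one of these lines is a character of \<open>C\<close> (\<open>character_exists\<close>).

\<^bold>\<open>Every character takes the oscillator values.\<close> The subalgebra \<open>B\<close> is generated by \<open>n\<close> mutually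
commuting pairs \<open>x, g\<close> with \<open>x\<close> invertible and \<open>x g = (g + 1) x\<close>. Such pairs split off: if \<open>K\<close> is
a subspace that commutes with all pairs, then the span of \<open>K\<close> times words in the pairs meets their
centralizer in \<open>K\<close> only (\<open>right_ext_centralizer\<close>). Each \<open>X\<^sub>\<alpha>\<close> is a weight zero element, its
``hat'', times a unit monomial of \<open>B\<close>, and the \<open>A\<^sub>\<alpha>\<close> are the hats corrected by polynomials in the
\<open>h\<^sub>i\<close>; hence the \<open>A\<^sub>\<alpha>\<close> and \<open>B\<close> generate \<open>U\<^sub>S\<close> (\<open>generated_by_A\<close>). So for the kernel \<open>K\<close> of a
character, \<open>J = K B\<close> is a two-sided ideal of \<open>U\<^sub>S\<close>, and it is proper because \<open>K\<close> does not contain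
\<open>1\<close>. Modulo \<open>J\<close> every hat is a polynomial in the commuting \<open>h\<^sub>i\<close>, and seven brackets of
\<open>sp\<^sub>2\<^sub>n\<close>, read modulo \<open>J\<close>, leave only the oscillator solution (\<open>oscillator_mod_J\<close>). The values of the
\<open>A\<^sub>\<alpha>\<close> follow by commutative algebra (\<open>A_values\<close>).

\<^bold>\<open>Uniqueness.\<close> The same splitting lemma, applied to the algebra generated by the \<open>A\<^sub>\<alpha>\<close> in place of
\<open>K\<close>, shows that this algebra is all of \<open>C\<close> (\<open>C_alg_generated\<close>). Two characters with the same values
on the \<open>A\<^sub>\<alpha>\<close> are therefore equal, and a one-dimensional module is determined by its character.\<close>

section \<open>Algebras over the complex numbers\<close>

interpretation scaleC: vector_space "scaleC :: complex \<Rightarrow> 'a \<Rightarrow> 'a::complex_algebra_1"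
  by unfold_locales (simp_all add: scaleC_add_left scaleC_add_right scaleC_scaleC scaleC_one)

lemma of_int_mult_conv_scaleC: "of_int m * x = scaleC (of_int m) (x :: 'a::complex_algebra_1)"
proof -
  have n: "of_nat k * x = scaleC (of_nat k) x" for k
    by (induction k) (simp_all add: algebra_simps scaleC_add_left scaleC_one)
  show ?thesis
    by (cases m rule: int_diff_cases)
       (simp add: n left_diff_distrib scaleC.scale_left_diff_distrib)
qed

lemma of_nat_mult_conv_scaleC: "of_nat m * x = scaleC (of_nat m) (x :: 'a::complex_algebra_1)"
  using of_int_mult_conv_scaleC[of "int m" x] by simp

definition csubspace :: "'a::complex_algebra_1 set \<Rightarrow> bool" where
  "csubspace P \<longleftrightarrow> 0 \<in> P \<and> (\<forall>x\<in>P. \<forall>y\<in>P. x + y \<in> P) \<and> (\<forall>c. \<forall>x\<in>P. scaleC c x \<in> P)"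

lemma csubspace_diff: "csubspace P \<Longrightarrow> x \<in> P \<Longrightarrow> y \<in> P \<Longrightarrow> x - y \<in> P"
  unfolding csubspace_def
  by (metis add_uminus_conv_diff scaleC.scale_minus_left scaleC_one)

lemma csubspace_sum: "csubspace P \<Longrightarrow> (\<And>i. i \<in> I \<Longrightarrow> f i \<in> P) \<Longrightarrow> sum f I \<in> P"
  by (induction I rule: infinite_finite_induct) (auto simp: csubspace_def)

lemma csubspace_of_nat: "csubspace P \<Longrightarrow> x \<in> P \<Longrightarrow> of_nat k * x \<in> P"
  by (simp add: of_nat_mult_conv_scaleC csubspace_def)

lemma subalgebra_csubspace: "subalgebra T \<Longrightarrow> csubspace T"
  unfolding subalgebra_def csubspace_def by (metis scaleC.scale_zero_left)

lemma subalgebra_commutant: "subalgebra {b. u * b = b * (u :: 'a::complex_algebra_1)}"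
  unfolding subalgebra_def
  by (auto simp: algebra_simps mult_scaleC_left mult_scaleC_right) (metis mult.assoc)

lemma centralizer_hull_iff:
  "u \<in> centralizer (subalgebra hull S) \<longleftrightarrow> (\<forall>b\<in>S. u * b = b * (u :: 'a::complex_algebra_1))"
proof
  assume "\<forall>b\<in>S. u * b = b * u"
  then have "subalgebra hull S \<subseteq> {b. u * b = b * u}"
    by (intro hull_minimal subalgebra_commutant) auto
  then show "u \<in> centralizer (subalgebra hull S)"
    by (auto simp: centralizer_def)
qed (auto simp: centralizer_def hull_inc)

lemma subalgebra_centralizer: "subalgebra (centralizer (B :: 'a::complex_algebra_1 set))"
  unfolding subalgebra_def centralizer_def
  by (auto simp: algebra_simps mult_scaleC_left mult_scaleC_right) (metis mult.assoc)

lemma rinv_eq: "x * y = 1 \<Longrightarrow> y * x = 1 \<Longrightarrow> rinv x = (y :: 'a::ring_1)"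
  unfolding rinv_def by (rule the_equality) (auto, metis mult.assoc mult.left_neutral mult.right_neutral)

lemma rinv_mult:
  assumes "invertible_elt (x :: 'a::ring_1)"
  shows "x * rinv x = 1" "rinv x * x = 1"
  using assms rinv_eq by (auto simp: invertible_elt_def)

lemma invertible_elt_mult: "invertible_elt x \<Longrightarrow> invertible_elt y \<Longrightarrow> invertible_elt (x * y :: 'a::ring_1)"
proof -
  assume a: "invertible_elt x" "invertible_elt y"
  have "x * y * (rinv y * rinv x) = x * (y * rinv y) * rinv x"
    "rinv y * rinv x * (x * y) = rinv y * (rinv x * x) * y"
    by (simp_all only: mult.assoc)
  then show ?thesis
    unfolding invertible_elt_def using rinv_mult[OF a(1)] rinv_mult[OF a(2)]
    by (metis mult.right_neutral)
qed

lemma invertible_elt_cancel_left: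
  "invertible_elt x \<Longrightarrow> x * y = x * z \<Longrightarrow> y = (z :: 'a::ring_1)"
  by (metis mult.assoc mult.left_neutral rinv_mult(2))

lemma commute_rinv:
  assumes "invertible_elt x" "x * y = y * (x :: 'a::ring_1)"
  shows "rinv x * y = y * rinv x"
proof -
  have "rinv x * y = rinv x * (y * (x * rinv x))" by (simp add: rinv_mult assms)
  also have "\<dots> = rinv x * (x * y) * rinv x" by (simp only: assms mult.assoc)
  also have "\<dots> = (rinv x * x) * y * rinv x" by (simp only: mult.assoc)
  also have "\<dots> = y * rinv x" by (simp add: rinv_mult assms)
  finally show ?thesis .
qed

section \<open>Splitting off pairs with \<open>x g = (g + 1) x\<close>\<close>

text \<open>The span of the products of an element of \<open>P\<close> with a word in \<open>G\<close>, for a subspace \<open>P\<close>. With the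
generators of \<open>B\<close> for \<open>G\<close> it is the right \<open>B\<close>-module \<open>P B\<close>. Words are built up on the right only,
so that an induction needs to move a commuting element past one generator at a time.\<close>

inductive_set right_ext :: "'a::complex_algebra_1 set \<Rightarrow> 'a set \<Rightarrow> 'a set" for G P where
  base: "p \<in> P \<Longrightarrow> p \<in> right_ext G P"
| add: "q \<in> right_ext G P \<Longrightarrow> r \<in> right_ext G P \<Longrightarrow> q + r \<in> right_ext G P"
| mult: "q \<in> right_ext G P \<Longrightarrow> g \<in> G \<Longrightarrow> q * g \<in> right_ext G P"

lemma csubspace_right_ext: "csubspace P \<Longrightarrow> csubspace (right_ext G P)"
proof -
  assume P: "csubspace P"
  have "scaleC c q \<in> right_ext G P" if "q \<in> right_ext G P" for c q
    using that
  proof induction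
    case (base p) then show ?case using P by (auto simp: csubspace_def intro: right_ext.base)
  next
    case (add q r) then show ?case by (simp add: scaleC_add_right right_ext.add)
  next
    case (mult q g) then show ?case
      using right_ext.mult by (fastforce simp: mult_scaleC_left[symmetric])
  qed
  then show ?thesis using P by (auto simp: csubspace_def intro: right_ext.intros)
qed

lemma right_ext_commute:
  assumes "q \<in> right_ext G P" "\<And>p. p \<in> P \<Longrightarrow> p * z = z * p" "\<And>g. g \<in> G \<Longrightarrow> g * z = z * g"
  shows "q * z = z * q"
  using assms(1)
proof induction
  case (mult q g) then show ?case by (metis assms(3) mult.assoc)
qed (auto simp: assms algebra_simps)

lemma right_ext_right_closed:
  assumes "q \<in> right_ext G P" "\<And>p. p \<in> P \<Longrightarrow> p * r \<in> right_ext G P" "\<And>g. g \<in> G \<Longrightarrow> g * r = r * g"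
  shows "q * r \<in> right_ext G P"
  using assms(1)
proof induction
  case (mult q g) then show ?case by (metis assms(3) mult.assoc right_ext.mult)
qed (auto simp: assms distrib_right intro: right_ext.add)

lemma right_ext_left_closed:
  assumes "q \<in> right_ext G P" "\<And>p. p \<in> P \<Longrightarrow> r * p \<in> right_ext G P"
  shows "r * q \<in> right_ext G P"
  using assms(1)
proof induction
  case (mult q g) then show ?case by (metis mult.assoc right_ext.mult)
qed (auto simp: assms distrib_left intro: right_ext.add)

text \<open>Two commuting families of generators can be adjoined one after the other. This reduces several
pairs to a single pair.\<close>
lemma right_ext_Un:
  assumes comm: "\<And>g h. g \<in> G \<Longrightarrow> h \<in> H \<Longrightarrow> g * h = h * g"
  shows "right_ext (G \<union> H) P \<subseteq> right_ext G (right_ext H P)"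
proof
  fix q assume "q \<in> right_ext (G \<union> H) P"
  then show "q \<in> right_ext G (right_ext H P)"
  proof induction
    case (mult q g)
    show ?case
    proof (cases "g \<in> G")
      case True
      then show ?thesis using mult.IH by (rule right_ext.mult[rotated])
    next
      case False
      then have "g \<in> H" using mult.hyps by auto
      then show ?thesis
        by (intro right_ext_right_closed[OF mult.IH]) (auto intro: right_ext.mult right_ext.base comm[symmetric] comm)
    qed
  qed (auto intro: right_ext.intros)
qed

text \<open>The falling factorials \<open>g (g - 1) \<cdots> (g - a + 1)\<close>. Conjugation by \<open>x\<close> replaces \<open>g\<close> by \<open>g + 1\<close>, and its
difference operator lowers falling factorials exactly as differentiation lowers powers; so they are
the basis of the polynomials in \<open>g\<close> in which the invariants can be read off.\<close>
fun falling :: "'a::ring_1 \<Rightarrow> nat \<Rightarrow> 'a" where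
  "falling g 0 = 1"
| "falling g (Suc a) = falling g a * (g - of_nat a)"

lemma falling_shift:
  assumes "x * g = (g + 1) * (x :: 'a::ring_1)"
  shows "x * falling g (Suc a) = (falling g (Suc a) + of_nat (Suc a) * falling g a) * x"
proof (induction a)
  case 0 then show ?case by (simp add: assms)
next
  case (Suc a)
  define F where "F = falling g (Suc a)"
  have F: "F = falling g a * (g - of_nat a)" by (simp add: F_def)
  have "x * falling g (Suc (Suc a)) = x * F * (g - of_nat (Suc a))" by (simp add: F_def mult.assoc)
  also have "x * F = (F + of_nat (Suc a) * falling g a) * x" unfolding F_def by (rule Suc.IH)
  also have "\<dots> * (g - of_nat (Suc a)) = (F + of_nat (Suc a) * falling g a) * (x * (g - of_nat (Suc a)))"
    by (simp only: mult.assoc)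
  also have "x * (g - of_nat (Suc a)) = (g - of_nat a) * x"
    using mult_of_nat_commute[of a x]
    by (simp add: right_diff_distrib left_diff_distrib distrib_left distrib_right assms)
  also have "(F + of_nat (Suc a) * falling g a) * ((g - of_nat a) * x)
      = (F * (g - of_nat a) + of_nat (Suc a) * F) * x"
    by (simp only: F mult.assoc distrib_right)
  also have "F * (g - of_nat a) + of_nat (Suc a) * F = F * (g - of_nat (Suc a)) + of_nat (Suc (Suc a)) * F"
    using mult_of_nat_commute[of a F] by (simp add: distrib_left distrib_right right_diff_distrib)
  also have "F * (g - of_nat (Suc a)) = falling g (Suc (Suc a))" by (simp add: F_def)
  finally show ?case by (simp only: F_def)
qed

lemma right_ext_falling:
  assumes P: "csubspace P" and q: "q \<in> right_ext {g} P"
  shows "\<exists>p d. range p \<subseteq> P \<and> q = (\<Sum>a\<le>d. p a * falling g a)"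
proof -
  have "\<exists>p d. range p \<subseteq> P \<and> (\<forall>a>d. p a = 0) \<and> q = (\<Sum>a\<le>d. p a * falling g a)"
    using q
  proof induction
    case (base p)
    then show ?case
      using P by (intro exI[of _ "\<lambda>a. if a = 0 then p else 0"] exI[of _ 0]) (auto simp: csubspace_def)
  next
    case (add q r)
    from add.IH obtain p d p' d' where p: "range p \<subseteq> P" "\<forall>a>d. p a = 0" "q = (\<Sum>a\<le>d. p a * falling g a)"
      and p': "range p' \<subseteq> P" "\<forall>a>d'. p' a = 0" "r = (\<Sum>a\<le>d'. p' a * falling g a)"
      by blast
    have "q = (\<Sum>a\<le>max d d'. p a * falling g a)" "r = (\<Sum>a\<le>max d d'. p' a * falling g a)"
      unfolding p(3) p'(3) using p(2) p'(2)
      by (auto intro!: sum.mono_neutral_left) (metis mult_zero_left not_le)+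
    then show ?case
      using p p' P
      by (intro exI[of _ "\<lambda>a. p a + p' a"] exI[of _ "max d d'"])
         (auto simp: csubspace_def distrib_right sum.distrib image_subset_iff)
  next
    case (mult q x)
    from mult.IH obtain p d where p: "range p \<subseteq> P" "\<forall>a>d. p a = 0" "q = (\<Sum>a\<le>d. p a * falling g a)"
      by blast
    define p' where "p' a = of_nat a * p a + (case a of 0 \<Rightarrow> 0 | Suc b \<Rightarrow> p b)" for a
    have "p a * falling g a * g = p a * falling g (Suc a) + of_nat a * p a * falling g a" for a
      using mult_of_nat_commute[of a "falling g a"]
      by (simp add: right_diff_distrib mult.assoc mult_of_nat_commute[of a "p a * falling g a"])
    then have "q * g = (\<Sum>a\<le>d. p a * falling g (Suc a)) + (\<Sum>a\<le>d. of_nat a * p a * falling g a)"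
      by (simp add: p(3) sum_distrib_right sum.distrib)
    also have "(\<Sum>a\<le>d. p a * falling g (Suc a))
        = (\<Sum>a\<le>Suc d. (case a of 0 \<Rightarrow> 0 | Suc b \<Rightarrow> p b) * falling g a)"
      by (simp only: sum.atMost_Suc_shift[of _ d]) (simp del: falling.simps(2))
    also have "(\<Sum>a\<le>d. of_nat a * p a * falling g a) = (\<Sum>a\<le>Suc d. of_nat a * p a * falling g a)"
      using p(2) by simp
    finally have "q * g = (\<Sum>a\<le>Suc d. p' a * falling g a)"
      by (simp only: p'_def distrib_right sum.distrib add.commute)
    moreover have "range p' \<subseteq> P"
    proof -
      have "p' a \<in> P" for a
      proof -
        have "of_nat a * p a \<in> P" using p(1) csubspace_of_nat[OF P] by blast
        moreover have "(case a of 0 \<Rightarrow> 0 | Suc b \<Rightarrow> p b) \<in> P"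
          using p(1) P by (auto simp: csubspace_def split: nat.split)
        ultimately show ?thesis using P by (simp add: p'_def csubspace_def)
      qed
      then show ?thesis by blast
    qed
    moreover have "\<forall>a>Suc d. p' a = 0"
      using p(2) by (auto simp: p'_def split: nat.split)
    ultimately show ?case using mult.hyps by blast
  qed
  then show ?thesis by blast
qed

lemma falling_difference:
  assumes x: "x * g = (g + 1) * (x :: 'a::complex_algebra_1)"
    and p: "\<And>a. x * p a = p a * x"
  shows "x * (\<Sum>a\<le>Suc d. p a * falling g a) - (\<Sum>a\<le>Suc d. p a * falling g a) * x
    = (\<Sum>a\<le>d. of_nat (Suc a) * p (Suc a) * falling g a) * x"
proof -
  have "x * (p a * falling g a) = p a * (x * falling g a)" for a
    by (metis p mult.assoc)
  moreover have "p (Suc a) * (x * falling g (Suc a)) - p (Suc a) * falling g (Suc a) * x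
      = of_nat (Suc a) * p (Suc a) * falling g a * x" for a
    using mult_of_nat_commute[of "Suc a" "p (Suc a)"]
    by (simp only: falling_shift[OF x]) (simp add: distrib_left distrib_right mult.assoc[symmetric] del: falling.simps(2) of_nat_Suc)
  ultimately show ?thesis
    unfolding sum.atMost_Suc_shift[of _ d] sum_distrib_left sum_distrib_right
      sum_subtractf[symmetric] distrib_left distrib_right
    by (simp add: p sum_subtractf[symmetric] sum_distrib_left sum_distrib_right del: falling.simps(2) of_nat_Suc)
qed

text \<open>The coefficients commute with \<open>x\<close>, so the difference operator acts on the falling factorials alone
and strips off one degree at a time; characteristic zero keeps the factors \<open>a + 1\<close> invertible.\<close>
lemma falling_independent:
  assumes x: "x * g = (g + 1) * (x :: 'a::complex_algebra_1)" and inv: "x * y = 1"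
    and p: "\<And>a. x * p a = p a * x"
    and zero: "(\<Sum>a\<le>d. p a * falling g a) = 0"
    and "a \<le> d"
  shows "p a = 0"
  using p zero \<open>a \<le> d\<close>
proof (induction d arbitrary: p a)
  case (Suc d)
  have "(\<Sum>a\<le>d. of_nat (Suc a) * p (Suc a) * falling g a) * x * y = 0"
    using falling_difference[OF x, of p d] Suc.prems(1,2) by simp
  then have "(\<Sum>a\<le>d. of_nat (Suc a) * p (Suc a) * falling g a) = 0"
    by (simp only: mult.assoc inv mult_1_right)
  moreover have "x * (of_nat (Suc a) * p (Suc a)) = of_nat (Suc a) * p (Suc a) * x" for a
    using Suc.prems(1) mult_of_nat_commute by (metis mult.assoc)
  ultimately have "of_nat (Suc b) * p (Suc b) = 0" if "b \<le> d" for b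
    using Suc.IH[of "\<lambda>a. of_nat (Suc a) * p (Suc a)" b] that by blast
  then have *: "p (Suc b) = 0" if "b \<le> d" for b
    using that unfolding of_nat_mult_conv_scaleC by (auto simp del: of_nat_Suc)
  moreover have "p 0 = 0"
    using Suc.prems(2) unfolding sum.atMost_Suc_shift by (simp add: *)
  ultimately show ?case using Suc.prems(3) by (cases a) auto
qed simp

text \<open>A polynomial in \<open>g\<close> that is fixed under \<open>g \<mapsto> g + 1\<close> is constant: its difference vanishes, hence so
do all its coefficients except the first.\<close>
lemma right_ext_shift_invariant:
  assumes P: "csubspace P" and x: "x * g = (g + 1) * (x :: 'a::complex_algebra_1)"
    and inv: "x * y = 1" and px: "\<And>p. p \<in> P \<Longrightarrow> p * x = x * p"
    and q: "q \<in> right_ext {g} P" "q * x = x * q"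
  shows "q \<in> P"
proof -
  obtain p d where p: "range p \<subseteq> P" "q = (\<Sum>a\<le>d. p a * falling g a)"
    using right_ext_falling[OF P q(1)] by blast
  have pa: "x * p a = p a * x" for a using px p(1) by (metis rangeI subsetD)
  show ?thesis
  proof (cases d)
    case 0
    then show ?thesis using p by auto
  next
    case (Suc e)
    have "(\<Sum>a\<le>e. of_nat (Suc a) * p (Suc a) * falling g a) * x * y = 0"
      using falling_difference[OF x, of p e] pa q(2) p(2) Suc by simp
    then have 1: "(\<Sum>a\<le>e. of_nat (Suc a) * p (Suc a) * falling g a) = 0"
      by (simp only: mult.assoc inv mult_1_right)
    have 2: "x * (of_nat (Suc a) * p (Suc a)) = of_nat (Suc a) * p (Suc a) * x" for a
      using pa mult_of_nat_commute by (metis mult.assoc)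
    have "p (Suc b) = 0" if "b \<le> e" for b
      using falling_independent[OF x inv, of "\<lambda>a. of_nat (Suc a) * p (Suc a)", OF 2 1 that]
      unfolding of_nat_mult_conv_scaleC by (auto simp del: of_nat_Suc)
    then have "q = p 0"
      unfolding p(2) Suc sum.atMost_Suc_shift by simp
    then show ?thesis using p by auto
  qed
qed

text \<open>Eigenvectors of \<open>v \<mapsto> v g - g v\<close> for distinct integers are independent. This separates the powers of
\<open>x\<close>, whose eigenvalues are their exponents.\<close>
lemma eigen_independent:
  assumes "finite M" "\<And>m. m \<in> M \<Longrightarrow> v m * g - g * v m = of_int m * (v m :: 'a::complex_algebra_1)"
    and "(\<Sum>m\<in>M. v m) = 0" "m \<in> M"
  shows "v m = 0"
  using assms
proof (induction M arbitrary: v m rule: finite_induct)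
  case (insert k M)
  have e: "v i * g - g * v i = scaleC (of_int i) (v i)" if "i \<in> insert k M" for i
    using insert.prems(1)[OF that] by (simp only: of_int_mult_conv_scaleC)
  define u where "u i = scaleC (of_int (i - k)) (v i)" for i
  have "u i = 0" if "i \<in> M" for i
  proof (rule insert.IH[OF _ _ that])
    show "u i * g - g * u i = of_int i * u i" if "i \<in> M" for i
      using e[of i] that
      by (simp add: u_def of_int_mult_conv_scaleC mult_scaleC_left mult_scaleC_right
            scaleC_scaleC mult.commute scaleC.scale_right_diff_distrib[symmetric] del: of_int_diff)
    have "(\<Sum>i\<in>insert k M. v i) * g - g * (\<Sum>i\<in>insert k M. v i)
        = (\<Sum>i\<in>insert k M. scaleC (of_int i) (v i))"
      unfolding sum_distrib_left sum_distrib_right sum_subtractf[symmetric]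
      using e by (rule sum.cong[OF refl])
    then have "(\<Sum>i\<in>insert k M. scaleC (of_int i) (v i)) = 0"
      by (simp only: insert.prems(2)) simp
    moreover have "(\<Sum>i\<in>insert k M. scaleC (of_int k) (v i)) = 0"
      by (simp only: scaleC.scale_sum_right[symmetric] insert.prems(2)) simp
    ultimately have "(\<Sum>i\<in>insert k M. u i) = 0"
      by (simp only: u_def of_int_diff scaleC.scale_left_diff_distrib sum_subtractf) simp
    then show "(\<Sum>i\<in>M. u i) = 0"
      using insert.hyps by (simp add: u_def)
  qed
  then have *: "v i = 0" if "i \<in> M" for i
    using that insert.hyps by (auto simp: u_def)
  then have "v k = 0" using insert.prems(2) insert.hyps by simp
  then show ?case using * insert.prems(3) by auto
qed simp

text \<open>Integer powers of \<open>x\<close>, with \<open>y\<close> its inverse, given explicitly since the ring need not be a division ring.\<close>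
definition zpower :: "'a::ring_1 \<Rightarrow> 'a \<Rightarrow> int \<Rightarrow> 'a" where
  "zpower x y m = (if m \<ge> 0 then x ^ nat m else y ^ nat (- m))"

lemma zpower_0: "zpower x y 0 = 1"
  by (simp add: zpower_def)

lemma zpower_mult:
  assumes "x * y = 1" "y * x = (1 :: 'a::ring_1)"
  shows "zpower x y m * x = zpower x y (m + 1)"
proof (cases "m \<ge> 0")
  case True
  then have "nat (m + 1) = Suc (nat m)" by simp
  then show ?thesis using True by (simp add: zpower_def power_commutes)
next
  case False
  define k where "k = nat (- m - 1)"
  have "m = - int (Suc k)" using False by (simp add: k_def)
  then show ?thesis
    using assms by (auto simp: zpower_def power_Suc2 mult.assoc nat_add_distrib simp del: power_Suc)
qed

lemma zpower_mult_inverse: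
  assumes "x * y = 1" "y * x = (1 :: 'a::ring_1)"
  shows "zpower x y m * y = zpower x y (m - 1)"
  using zpower_mult[OF assms, of "m - 1"] assms
  by (metis diff_add_cancel mult.assoc mult.right_neutral)

lemma zpower_shift:
  assumes "x * y = 1" "y * x = (1 :: 'a::ring_1)" "x * g = (g + 1) * x"
  shows "zpower x y m * g = (g + of_int m) * zpower x y m"
proof (induction m rule: int_induct[where k = 0])
  case (step1 i)
  have "zpower x y (i + 1) * g = zpower x y i * (x * g)"
    by (simp add: zpower_mult[OF assms(1,2), symmetric] mult.assoc)
  also have "\<dots> = (zpower x y i * g) * x + zpower x y i * x"
    by (simp add: assms(3) distrib_left distrib_right mult.assoc)
  also have "\<dots> = (g + of_int (i + 1)) * zpower x y (i + 1)"
    by (simp add: step1 distrib_right distrib_left mult.assoc zpower_mult[OF assms(1,2)])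
  finally show ?case .
next
  case (step2 i)
  have y: "y * g = (g - 1) * y"
  proof -
    have "y * g = y * (g + 1) * (x * y) - y" by (simp add: assms distrib_left)
    also have "\<dots> = y * ((g + 1) * x) * y - y" by (simp only: mult.assoc)
    also have "\<dots> = (y * x) * g * y - y" by (simp only: assms(3)[symmetric] mult.assoc)
    finally show ?thesis by (simp add: assms left_diff_distrib)
  qed
  have "zpower x y (i - 1) * g = zpower x y i * (y * g)"
    by (simp add: zpower_mult_inverse[OF assms(1,2), symmetric] mult.assoc)
  also have "\<dots> = (zpower x y i * g) * y - zpower x y i * y"
    by (simp add: y right_diff_distrib left_diff_distrib mult.assoc)
  also have "\<dots> = (g + of_int (i - 1)) * zpower x y (i - 1)"
    by (simp add: step2 distrib_right left_diff_distrib mult.assoc zpower_mult_inverse[OF assms(1,2)])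
  finally show ?case .
qed (simp add: zpower_0)

text \<open>Laurent normal form: powers of \<open>x\<close> collect on the right, at the price of integer multiples of the
coefficients, which stay polynomials in \<open>g\<close>.\<close>
lemma right_ext_weights:
  assumes P: "csubspace P" and inv: "x * y = 1" "y * x = 1" and x: "x * g = (g + 1) * (x :: 'a::complex_algebra_1)"
    and q: "q \<in> right_ext {g, x, y} P"
  shows "\<exists>f M. finite M \<and> range f \<subseteq> right_ext {g} P \<and> (\<forall>m. m \<notin> M \<longrightarrow> f m = 0)
    \<and> q = (\<Sum>m\<in>M. f m * zpower x y m)"
  using q
proof induction
  let ?D = "right_ext {g} P"
  have D: "csubspace ?D" by (rule csubspace_right_ext[OF P])
  {
    case (base p)
    then show ?case
      using P by (intro exI[of _ "\<lambda>m. if m = 0 then p else 0"] exI[of _ "{0}"])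
        (auto simp: csubspace_def zpower_0 intro: right_ext.base)
  next
    case (add q r)
    from add.IH obtain f M f' M' where f: "finite M" "range f \<subseteq> ?D" "\<forall>m. m \<notin> M \<longrightarrow> f m = 0" "q = (\<Sum>m\<in>M. f m * zpower x y m)"
      and f': "finite M'" "range f' \<subseteq> ?D" "\<forall>m. m \<notin> M' \<longrightarrow> f' m = 0" "r = (\<Sum>m\<in>M'. f' m * zpower x y m)"
      by blast
    have "q = (\<Sum>m\<in>M \<union> M'. f m * zpower x y m)" "r = (\<Sum>m\<in>M \<union> M'. f' m * zpower x y m)"
      unfolding f(4) f'(4) using f f' by (auto intro!: sum.mono_neutral_left)
    then show ?case
      using f f' D
      by (intro exI[of _ "\<lambda>a. f a + f' a"] exI[of _ "M \<union> M'"])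
         (auto simp: csubspace_def distrib_right sum.distrib image_subset_iff)
  next
    case (mult q z)
    from mult.IH obtain f M where f: "finite M" "range f \<subseteq> ?D" "\<forall>m. m \<notin> M \<longrightarrow> f m = 0" "q = (\<Sum>m\<in>M. f m * zpower x y m)"
      by blast
    consider "z = g" | "z = x" | "z = y" using mult.hyps by auto
    then show ?case
    proof cases
      case 1
      have *: "f m * (of_int m * zpower x y m) = of_int m * (f m * zpower x y m)" for m
        by (metis mult.assoc mult_of_int_commute)
      have "q * g = (\<Sum>m\<in>M. (f m * g + of_int m * f m) * zpower x y m)"
        unfolding f(4) sum_distrib_right
        by (rule sum.cong) (simp_all add: mult.assoc zpower_shift[OF inv x] distrib_left distrib_right *)
      moreover have "range (\<lambda>m. f m * g + of_int m * f m) \<subseteq> ?D"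
        using f(2) D
        by (auto simp: of_int_mult_conv_scaleC csubspace_def intro!: right_ext.add intro: right_ext.mult)
      ultimately show ?thesis
        using f(1,3) 1 by (intro exI[of _ "\<lambda>m. f m * g + of_int m * f m"] exI[of _ M]) auto
    next
      case 2
      have "q * x = (\<Sum>m\<in>M. f m * zpower x y (m + 1))"
        by (simp add: f(4) sum_distrib_right mult.assoc zpower_mult[OF inv])
      also have "\<dots> = (\<Sum>m\<in>(\<lambda>m. m + 1) ` M. f (m - 1) * zpower x y m)"
        by (subst sum.reindex) auto
      finally show ?thesis
        using f(1-3) 2
        by (intro exI[of _ "\<lambda>m. f (m - 1)"] exI[of _ "(\<lambda>m. m + 1) ` M"])
           (auto simp: image_iff, metis diff_add_cancel)
    next
      case 3
      have "q * y = (\<Sum>m\<in>M. f m * zpower x y (m - 1))"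
        by (simp add: f(4) sum_distrib_right mult.assoc zpower_mult_inverse[OF inv])
      also have "\<dots> = (\<Sum>m\<in>(\<lambda>m. m - 1) ` M. f (m + 1) * zpower x y m)"
        by (subst sum.reindex) auto
      finally show ?thesis
        using f(1-3) 3
        by (intro exI[of _ "\<lambda>m. f (m + 1)"] exI[of _ "(\<lambda>m. m - 1) ` M"])
           (auto simp: image_iff, metis add_diff_cancel)
    qed
  }
qed

text \<open>Commuting with \<open>g\<close> kills all powers of \<open>x\<close> except \<open>x\<^sup>0\<close>, and commuting with \<open>x\<close> then leaves the
constant polynomials in \<open>g\<close> only.\<close>
lemma right_ext_pair_centralizer:
  assumes P: "csubspace P" and inv: "x * y = 1" "y * x = 1" and x: "x * g = (g + 1) * (x :: 'a::complex_algebra_1)"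
    and comm: "\<And>p. p \<in> P \<Longrightarrow> p * g = g * p" "\<And>p. p \<in> P \<Longrightarrow> p * x = x * p"
    and q: "q \<in> right_ext {g, x, y} P" "q * g = g * q" "q * x = x * q"
  shows "q \<in> P"
proof -
  obtain f M where f: "finite M" "range f \<subseteq> right_ext {g} P" "\<forall>m. m \<notin> M \<longrightarrow> f m = 0"
    "q = (\<Sum>m\<in>M. f m * zpower x y m)"
    using right_ext_weights[OF P inv x q(1)] by blast
  define M' where "M' = insert 0 M"
  have M': "finite M'" "0 \<in> M'" "q = (\<Sum>m\<in>M'. f m * zpower x y m)"
    using f by (auto simp: M'_def sum.insert_if)
  define v where "v m = f m * zpower x y m - (if m = 0 then q else 0)" for m
  have fg: "f m * g = g * f m" for m
    by (rule right_ext_commute[of _ "{g}" P]) (use f(2) comm(1) in auto)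
  have fz: "f m * zpower x y m * g - g * (f m * zpower x y m) = of_int m * (f m * zpower x y m)" for m
  proof -
    have "f m * zpower x y m * g = (f m * g) * zpower x y m + f m * of_int m * zpower x y m"
      by (simp add: mult.assoc zpower_shift[OF inv x] distrib_right distrib_left)
    also have "f m * of_int m = of_int m * f m" by (rule mult_of_int_commute[symmetric])
    finally show ?thesis by (simp add: fg mult.assoc)
  qed
  have "v m * g - g * v m = of_int m * v m" for m
    using fz[of m] q(2) by (auto simp: v_def left_diff_distrib right_diff_distrib)
  moreover have "(\<Sum>m\<in>M'. v m) = 0"
    using M' by (simp add: v_def sum_subtractf)
  ultimately have "v 0 = 0"
    using eigen_independent[of M' v g 0] M' by blast
  then have "q \<in> right_ext {g} P"
    using f(2) by (auto simp: v_def zpower_0)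
  then show ?thesis
    using right_ext_shift_invariant[OF P x inv(1) comm(2) _ q(3)] by blast
qed

text \<open>The splitting lemma. It is used for two subspaces \<open>P\<close> of the centralizer: the kernel of a character,
to see that the ideal it generates is proper, and the algebra generated by the \<open>A\<^sub>\<alpha>\<close>, to see that it
is the whole centralizer.\<close>
theorem right_ext_centralizer:
  fixes g x y :: "'i \<Rightarrow> 'a::complex_algebra_1"
  assumes "finite F" and P: "csubspace P"
    and inv: "\<And>i. x i * y i = 1" "\<And>i. y i * x i = 1"
    and gg: "\<And>i j. g i * g j = g j * g i" and xx: "\<And>i j. x i * x j = x j * x i"
    and xg: "\<And>i j. x j * g i = (g i + of_bool (i = j)) * x j"
    and comm: "\<And>p i. p \<in> P \<Longrightarrow> p * g i = g i * p" "\<And>p i. p \<in> P \<Longrightarrow> p * x i = x i * p"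
    and q: "q \<in> right_ext (\<Union>i\<in>F. {g i, x i, y i}) P" "\<And>i. q * g i = g i * q" "\<And>i. q * x i = x i * q"
  shows "q \<in> P"
  using assms(1) q(1)
proof (induction F)
  case empty
  have "right_ext {} P \<subseteq> P"
  proof
    fix r assume "r \<in> right_ext {} P"
    then show "r \<in> P" by induction (use P in \<open>auto simp: csubspace_def\<close>)
  qed
  then show ?case using empty by auto
next
  case (insert i F)
  let ?G = "\<Union>i\<in>F. {g i, x i, y i}"
  have y_comm: "y j * z = z * y j" if "x j * z = z * x j" for j z
  proof -
    have "y j = rinv (x j)" by (rule rinv_eq[symmetric]) (rule inv)+
    moreover have "invertible_elt (x j)" unfolding invertible_elt_def using inv by blast
    ultimately show ?thesis using commute_rinv that by metis
  qed
  have *: "a * b = b * a" if a: "a \<in> {g i, x i, y i}" and b: "b \<in> ?G" for a b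
  proof -
    obtain j where j: "j \<in> F" "b \<in> {g j, x j, y j}" using b by (rule UN_E)
    then have ij: "i \<noteq> j" using insert.hyps by auto
    have xg': "x i * g j = g j * x i" "x j * g i = g i * x j"
      using ij by (simp_all add: xg)
    have yg: "y i * g j = g j * y i" "y j * g i = g i * y j"
      by (intro y_comm xg')+
    have yx: "y i * x j = x j * y i" "y j * x i = x i * y j"
      by (intro y_comm xx)+
    have yy: "y i * y j = y j * y i"
      by (intro y_comm yx(2)[symmetric])
    show ?thesis
      using a j(2)
      by (elim insertE emptyE; hypsubst; intro gg xx yy xg' yg yx xg'[symmetric] yg[symmetric] yx[symmetric])
  qed
  have "(\<Union>i\<in>insert i F. {g i, x i, y i}) = {g i, x i, y i} \<union> ?G" by auto
  then have "q \<in> right_ext {g i, x i, y i} (right_ext ?G P)"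
    using insert.prems right_ext_Un[of "{g i, x i, y i}" ?G P] * by auto
  moreover have "p * g i = g i * p" "p * x i = x i * p" if "p \<in> right_ext ?G P" for p
  proof -
    show "p * g i = g i * p"
      by (rule right_ext_commute[OF that]) (erule comm, rule *[symmetric], simp)
    show "p * x i = x i * p"
      by (rule right_ext_commute[OF that]) (erule comm, rule *[symmetric], simp)
  qed
  moreover have "x i * g i = (g i + 1) * x i" using xg[of i i] by simp
  ultimately have "q \<in> right_ext ?G P"
    by (intro right_ext_pair_centralizer[OF csubspace_right_ext[OF P] inv, where g = "g i"]) (auto simp: q)
  then show ?case by (rule insert.IH)
qed

section \<open>Universal properties of enveloping algebra and localization\<close>

lemma alg_homD:
  assumes "alg_hom f"
  shows "f 1 = 1" "f (x + y) = f x + f y" "f (x * y) = f x * f y" "f (scaleC c x) = scaleC c (f x)"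
  using assms by (auto simp: alg_hom_def)

lemma alg_hom_diff: "alg_hom f \<Longrightarrow> f (x - y) = f x - f y"
  by (metis add_diff_cancel_right' alg_homD(2) diff_add_cancel)

lemma alg_hom_0: "alg_hom f \<Longrightarrow> f 0 = 0"
  by (metis alg_hom_diff diff_self)

definition free_eval :: "('a \<Rightarrow> 'r::complex_algebra_1) \<Rightarrow> 'a free_alg \<Rightarrow> 'r" where
  "free_eval f p = (\<Sum>w\<in>Poly_Mapping.keys p. scaleC (Poly_Mapping.lookup p w) (prod_list (map f (letters w))))"

lemma free_eval_superset:
  "finite K \<Longrightarrow> Poly_Mapping.keys p \<subseteq> K \<Longrightarrow>
    free_eval f p = (\<Sum>w\<in>K. scaleC (Poly_Mapping.lookup p w) (prod_list (map f (letters w))))"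
  unfolding free_eval_def by (rule sum.mono_neutral_left) (auto simp: in_keys_iff)

lemma free_eval_add: "free_eval f (p + q) = free_eval f p + free_eval f q"
proof -
  let ?K = "Poly_Mapping.keys p \<union> Poly_Mapping.keys q"
  have "Poly_Mapping.keys (p + q) \<subseteq> ?K" by (rule keys_add)
  then show ?thesis
    by (simp add: free_eval_superset[of ?K] lookup_add scaleC_add_left sum.distrib)
qed

lemma free_eval_0: "free_eval f 0 = 0"
  by (simp add: free_eval_def)

lemma free_eval_diff: "free_eval f (p - q) = free_eval f p - free_eval f q"
  by (metis add_diff_cancel_right' free_eval_add diff_add_cancel)

lemma free_eval_single: "free_eval f (Poly_Mapping.single w c) = scaleC c (prod_list (map f (letters w)))"
  by (simp add: free_eval_superset[of "{w}"])

lemma free_alg_induct [case_names zero add]: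
  assumes "P 0" "\<And>p w c. P p \<Longrightarrow> P (p + Poly_Mapping.single w c)"
  shows "P (p :: 'a free_alg)"
proof (induction p rule: update_induct)
  case (update f a b)
  then have "Poly_Mapping.update a b f = f + Poly_Mapping.single a b"
    by (intro poly_mapping_eqI) (auto simp: lookup_update lookup_add lookup_single in_keys_iff)
  then show ?case using update.IH assms(2) by simp
qed (rule assms(1))

lemma free_eval_mult: "free_eval f (p * q) = free_eval f p * free_eval f q"
proof (induction p rule: free_alg_induct)
  case (add p w c)
  have "free_eval f (Poly_Mapping.single w c * q) = free_eval f (Poly_Mapping.single w c) * free_eval f q"
  proof (induction q rule: free_alg_induct)
    case (add q v d)
    then show ?case
      by (simp add: distrib_left free_eval_add mult_single free_eval_single mult_scaleC_left mult_scaleC_right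
          scaleC_scaleC plus_fword_def mult.commute)
  qed (simp add: free_eval_0)
  then show ?case using add by (simp add: distrib_right free_eval_add)
qed (simp add: free_eval_0)

lemma free_eval_one: "free_eval f 1 = 1"
  by (simp add: free_eval_single[of f 0 1, simplified single_one] zero_fword_def scaleC_one)

lemma free_eval_fgen: "free_eval f (fgen x) = f x"
  by (simp add: fgen_def free_eval_single scaleC_one)

lemma free_eval_fconst: "free_eval f (fconst c) = scaleC c 1"
  by (simp add: fconst_def free_eval_single zero_fword_def)

lemma usp_inj_add: "usp_inj (sp_add x y) = usp_inj x + usp_inj y"
  unfolding usp_inj_def plus_usp.abs_eq usp.abs_eq_iff env_eq_def
  by (rule ideal_gen) (auto simp: env_rels_def)

lemma usp_inj_scale: "usp_inj (sp_scale c x) = scaleC c (usp_inj x)"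
  unfolding usp_inj_def scaleC_usp.abs_eq usp.abs_eq_iff env_eq_def
  by (rule ideal_gen) (auto simp: env_rels_def)

lemma usp_inj_bracket: "usp_inj (sp_bracket x y) = usp_inj x * usp_inj y - usp_inj y * usp_inj x"
proof -
  have "usp_inj x * usp_inj y - usp_inj y * usp_inj x = usp_inj (sp_bracket x y)"
    unfolding usp_inj_def times_usp.abs_eq minus_usp.abs_eq usp.abs_eq_iff env_eq_def
    by (rule ideal_gen) (auto simp: env_rels_def)
  then show ?thesis by simp
qed

text \<open>Evaluation of noncommutative polynomials kills the defining relations, hence the ideal they generate.\<close>
theorem usp_universal:
  fixes f :: "'n::finite sp \<Rightarrow> 'r::complex_algebra_1"
  assumes add: "\<And>x y. f (sp_add x y) = f x + f y"
    and scale: "\<And>c x. f (sp_scale c x) = scaleC c (f x)"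
    and bracket: "\<And>x y. f (sp_bracket x y) = f x * f y - f y * f x"
  shows "\<exists>\<phi>. alg_hom \<phi> \<and> (\<forall>x. \<phi> (usp_inj x) = f x)"
proof -
  have ideal: "free_eval f p = 0" if "p \<in> two_sided_ideal env_rels" for p
    using that
  proof induction
    case (ideal_gen r)
    then show ?case
      by (auto simp: env_rels_def free_eval_diff free_eval_add free_eval_mult free_eval_fgen free_eval_fconst add scale bracket
          mult_scaleC_left)
  qed (simp_all add: free_eval_0 free_eval_add free_eval_mult)
  define \<phi> where "\<phi> u = free_eval f (rep_usp u)" for u
  have \<phi>: "\<phi> (abs_usp p) = free_eval f p" for p
  proof -
    have "abs_usp (rep_usp (abs_usp p)) = abs_usp p"
      by (rule Quotient_abs_rep[OF Quotient_usp])
    then have "env_eq (rep_usp (abs_usp p)) p"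
      by (simp add: usp.abs_eq_iff)
    then show ?thesis
      using ideal[of "rep_usp (abs_usp p) - p"] by (simp add: \<phi>_def env_eq_def free_eval_diff)
  qed
  have ex: "\<exists>p. u = abs_usp p" for u :: "'n usp"
    by (metis Quotient_abs_rep[OF Quotient_usp])
  have "\<phi> (u + v) = \<phi> u + \<phi> v \<and> \<phi> (u * v) = \<phi> u * \<phi> v \<and> \<phi> (scaleC c u) = scaleC c (\<phi> u)" for u v c
  proof -
    obtain p q where "u = abs_usp p" "v = abs_usp q" using ex by metis
    then show ?thesis
      by (simp add: plus_usp.abs_eq times_usp.abs_eq scaleC_usp.abs_eq \<phi> free_eval_add free_eval_mult free_eval_fconst
          mult_scaleC_left)
  qed
  moreover have "\<phi> 1 = 1"
    by (simp add: one_usp_def \<phi> free_eval_one)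
  moreover have "\<phi> (usp_inj x) = f x" for x
    by (simp add: usp_inj_def \<phi> free_eval_fgen)
  ultimately show ?thesis
    unfolding alg_hom_def by blast
qed

lemma usp_generated:
  assumes T: "subalgebra T" and inj: "\<And>x. usp_inj x \<in> T"
  shows "(u :: 'n::finite usp) \<in> T"
proof -
  obtain p where u: "u = abs_usp p"
    by (metis Quotient_abs_rep[OF Quotient_usp])
  have word: "abs_usp (Poly_Mapping.single (FWord xs) 1) \<in> T" for xs :: "'n sp list"
  proof (induction xs)
    case Nil
    have "abs_usp (Poly_Mapping.single (FWord []) 1) = (1 :: 'n usp)"
      by (metis one_usp_def single_one zero_fword_def)
    then show ?case using T by (simp add: subalgebra_def)
  next
    case (Cons x xs)
    have "Poly_Mapping.single (FWord (x # xs)) (1::complex) = fgen x * Poly_Mapping.single (FWord xs) 1"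
      by (simp add: fgen_def mult_single plus_fword_def)
    then have "abs_usp (Poly_Mapping.single (FWord (x # xs)) 1)
        = usp_inj x * abs_usp (Poly_Mapping.single (FWord xs) 1)"
      by (simp add: usp_inj_def times_usp.abs_eq)
    then show ?case using T Cons inj by (simp add: subalgebra_def)
  qed
  have "abs_usp p \<in> T"
  proof (induction p rule: free_alg_induct)
    case zero
    then show ?case
      using subalgebra_csubspace[OF T] by (metis csubspace_def zero_usp_def)
  next
    case (add p w c)
    have "Poly_Mapping.single w c = fconst c * Poly_Mapping.single w 1"
      by (simp add: fconst_def mult_single)
    then have "abs_usp (p + Poly_Mapping.single w c)
        = abs_usp p + scaleC c (abs_usp (Poly_Mapping.single w 1))"
      by (simp add: plus_usp.abs_eq scaleC_usp.abs_eq)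
    moreover have "abs_usp (Poly_Mapping.single w 1) \<in> T"
      using word[of "letters w"] by simp
    ultimately show ?case using T add by (simp add: subalgebra_def)
  qed
  then show ?thesis using u by simp
qed

lemma sum_of_bool_pair:
  fixes f :: "'n::finite \<Rightarrow> 'n \<Rightarrow> complex"
  shows "(\<Sum>i\<in>UNIV. \<Sum>j\<in>UNIV. f i j * (of_bool (a = i) * of_bool (b = j))) = f a b"
    and "(\<Sum>i\<in>UNIV. \<Sum>j\<in>UNIV. f i j * (of_bool (a = j) * of_bool (b = i))) = f b a"
proof -
  have *: "f i j * (of_bool (a = i) * of_bool (b = j)) = (if b = j then (if a = i then f i j else 0) else 0)"
    "f i j * (of_bool (a = j) * of_bool (b = i)) = (if a = j then (if b = i then f i j else 0) else 0)" for i j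
    by auto
  show "(\<Sum>i\<in>UNIV. \<Sum>j\<in>UNIV. f i j * (of_bool (a = i) * of_bool (b = j))) = f a b"
    "(\<Sum>i\<in>UNIV. \<Sum>j\<in>UNIV. f i j * (of_bool (a = j) * of_bool (b = i))) = f b a"
    unfolding * by simp_all
qed

text \<open>An element of \<open>sp\<close> is recovered from its block entries. The entries of the two off-diagonal blocks
are halved because \<open>X\<^bsub>\<epsilon>\<^sub>i + \<epsilon>\<^sub>j\<^esub> = X\<^bsub>\<epsilon>\<^sub>j + \<epsilon>\<^sub>i\<^esub>\<close> is counted twice in the sum over all \<open>i, j\<close>.\<close>
lemma sp_generated:
  assumes add: "\<And>x y. x \<in> L \<Longrightarrow> y \<in> L \<Longrightarrow> sp_add x y \<in> L"
    and scale: "\<And>c x. x \<in> L \<Longrightarrow> sp_scale c x \<in> L"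
    and gens: "\<And>i j. sp_diff i j \<in> L" "\<And>i j. sp_pos i j \<in> L" "\<And>i j. sp_neg i j \<in> L"
  shows "(x :: 'n::finite sp) \<in> L"
proof -
  define M where "M = Rep_sp ` L"
  have M_add: "A + B \<in> M" if "A \<in> M" "B \<in> M" for A B
    using that add by (auto simp: M_def sp_add.rep_eq[symmetric])
  have M_scale: "(\<chi> a b. c * A $ a $ b) \<in> M" if "A \<in> M" for A c
    using that scale by (auto simp: M_def sp_scale.rep_eq[symmetric])
  have "Rep_sp (sp_diff undefined undefined) \<in> M" using gens by (auto simp: M_def)
  from M_scale[OF this, of 0] have M_0: "0 \<in> M" by (simp add: zero_vec_def)
  have M_sum: "sum f I \<in> M" if "\<And>i. i \<in> I \<Longrightarrow> f i \<in> M" for f :: "'n \<Rightarrow> 'n mat2" and I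
    using that by (induction I rule: infinite_finite_induct) (auto simp: M_0 M_add)
  define A where "A = Rep_sp x"
  have A: "A \<in> sp_set" by (simp add: A_def Rep_sp)
  define D where "D = (\<Sum>i\<in>UNIV. \<Sum>j\<in>UNIV. (\<chi> a b. A $ Inl i $ Inl j * Rep_sp (sp_diff i j) $ a $ b))"
  define E where "E = (\<Sum>i\<in>UNIV. \<Sum>j\<in>UNIV. (\<chi> a b. (A $ Inl i $ Inr j / 2) * Rep_sp (sp_pos i j) $ a $ b))"
  define F where "F = (\<Sum>i\<in>UNIV. \<Sum>j\<in>UNIV. (\<chi> a b. (A $ Inr i $ Inl j / 2) * Rep_sp (sp_neg i j) $ a $ b))"
  have "D \<in> M" "E \<in> M" "F \<in> M"
    unfolding D_def E_def F_def by (intro M_sum M_scale; simp add: M_def gens)+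
  then have "D + E + F \<in> M" by (intro M_add)
  moreover have "D + E + F = A"
    using A unfolding mat2_eq_iff sp_set_iff
    by (simp add: D_def E_def F_def sp_diff.rep_eq sp_pos.rep_eq sp_neg.rep_eq unit_mat_nth
        sum.distrib sum_subtractf distrib_left right_diff_distrib sum_of_bool_pair sum_negf
        add_divide_distrib sum_divide_distrib[symmetric])
  ultimately show ?thesis by (auto simp: M_def A_def Rep_sp_inject)
qed

lemma ore_set_image_mem:
  assumes \<phi>: "alg_hom \<phi>" and one: "1 \<in> V" and mult: "\<And>a b. a \<in> V \<Longrightarrow> b \<in> V \<Longrightarrow> a * b \<in> V"
    and pos: "\<phi> (usp_inj (sp_pos ix1 ix1)) \<in> V" and diff: "\<And>k. k \<in> ixs \<Longrightarrow> \<phi> (usp_inj (sp_diff ix1 k)) \<in> V"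
    and s: "s \<in> ore_set"
  shows "\<phi> s \<in> V"
proof -
  note hom = alg_homD[OF \<phi>]
  obtain e where s: "s = usp_inj (sp_pos ix1 ix1) ^ e ix1
      * prod_list (map (\<lambda>k. usp_inj (sp_diff ix1 k) ^ e k) (sorted_list_of_set ixs))"
    using s unfolding ore_set_def by blast
  have pow: "\<phi> (a ^ z) \<in> V" if "\<phi> a \<in> V" for a z
    using that by (induction z) (auto simp: hom one mult)
  have "\<phi> (prod_list (map (\<lambda>k. usp_inj (sp_diff ix1 k) ^ e k) ks)) \<in> V" if "set ks \<subseteq> ixs" for ks
    using that by (induction ks) (auto simp: hom one mult pow diff)
  then have "\<phi> (prod_list (map (\<lambda>k. usp_inj (sp_diff ix1 k) ^ e k) (sorted_list_of_set ixs))) \<in> V"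
    by simp
  then show ?thesis
    unfolding s by (simp add: hom mult pow pos)
qed

text \<open>The value at \<open>q = \<theta>(s)\<^sup>-\<^sup>1 \<theta>(u)\<close> must be \<open>\<phi>(s)\<^sup>-\<^sup>1 \<phi>(u)\<close>. The Ore condition, which makes this
well defined and multiplicative, comes for free: writing \<open>\<theta>(a) \<theta>(s)\<^sup>-\<^sup>1\<close> as a left fraction gives a
common multiple in the image of \<open>\<theta>\<close>, and the kernel of \<open>\<theta>\<close>, being \<open>S\<close>-torsion, is contained in the
kernel of \<open>\<phi>\<close>.\<close>
theorem localization_universal:
  fixes \<theta> :: "'u::complex_algebra_1 \<Rightarrow> 'q::complex_algebra_1" and \<phi> :: "'u \<Rightarrow> 'r::complex_algebra_1"
  assumes loc: "is_localization S \<theta>" and \<phi>: "alg_hom \<phi>" and inv: "\<And>s. s \<in> S \<Longrightarrow> invertible_elt (\<phi> s)"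
  shows "\<exists>\<psi>. alg_hom \<psi> \<and> (\<forall>u. \<psi> (\<theta> u) = \<phi> u)"
proof -
  have \<theta>: "alg_hom \<theta>" and \<theta>inv: "\<And>s. s \<in> S \<Longrightarrow> invertible_elt (\<theta> s)"
    using loc by (auto simp: is_localization_def)
  note hom = alg_homD[OF \<theta>] alg_homD[OF \<phi>]
  have frac: "\<exists>s\<in>S. \<exists>u. \<theta> s * q = \<theta> u" for q
  proof -
    obtain s u where "s \<in> S" "q = rinv (\<theta> s) * \<theta> u" using loc unfolding is_localization_def by blast
    then have "\<theta> s * q = \<theta> u" using rinv_mult[OF \<theta>inv] by (simp add: mult.assoc[symmetric])
    then show ?thesis using \<open>s \<in> S\<close> by blast
  qed
  have cancel: "a = b" if "s \<in> S" "\<phi> s * a = \<phi> s * b" for s a b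
    using invertible_elt_cancel_left[OF inv] that by blast
  have kernel: "\<phi> u = \<phi> v" if "\<theta> u = \<theta> v" for u v
  proof -
    have "\<theta> (u - v) = 0" using that by (simp add: alg_hom_diff[OF \<theta>])
    then obtain s where s: "s \<in> S" "s * (u - v) = 0" using loc by (auto simp: is_localization_def)
    then have "\<phi> s * \<phi> (u - v) = 0" by (metis hom(7) alg_hom_0[OF \<phi>])
    then have "\<phi> (u - v) = 0" using cancel[OF s(1), of "\<phi> (u - v)" 0] by simp
    then show ?thesis by (simp add: alg_hom_diff[OF \<phi>])
  qed
  have ore: "\<exists>r\<in>S. \<exists>w. \<theta> r * \<theta> a = \<theta> w * \<theta> s \<and> \<phi> r * \<phi> a = \<phi> w * \<phi> s" if "s \<in> S" for a s
  proof -
    obtain r w where r: "r \<in> S" "\<theta> r * (\<theta> a * rinv (\<theta> s)) = \<theta> w" using frac by blast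
    then have "\<theta> r * \<theta> a = \<theta> w * \<theta> s"
      using rinv_mult[OF \<theta>inv[OF that]] by (metis mult.assoc mult.right_neutral)
    moreover from this have "\<phi> r * \<phi> a = \<phi> w * \<phi> s"
      using kernel[of "r * a" "w * s"] by (simp add: hom)
    ultimately show ?thesis using r by blast
  qed
  \<comment> \<open>Characterizing the value by all equations \<open>\<theta>(a) q = \<theta>(b)\<close>, not only those with \<open>a \<in> S\<close>, makes
    the homomorphism properties below immediate.\<close>
  have "\<exists>p. \<forall>a b. \<theta> a * q = \<theta> b \<longrightarrow> \<phi> a * p = \<phi> b" for q
  proof -
    obtain s u where s: "s \<in> S" "\<theta> s * q = \<theta> u" using frac by blast
    define p where "p = rinv (\<phi> s) * \<phi> u"
    have p: "\<phi> s * p = \<phi> u"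
      using rinv_mult[OF inv[OF s(1)]] by (simp add: p_def mult.assoc[symmetric])
    have "\<phi> a * p = \<phi> b" if ab: "\<theta> a * q = \<theta> b" for a b
    proof -
      obtain r w where r: "r \<in> S" "\<theta> r * \<theta> a = \<theta> w * \<theta> s" "\<phi> r * \<phi> a = \<phi> w * \<phi> s"
        using ore[OF s(1)] by blast
      have "\<theta> (r * b) = \<theta> (w * u)" by (metis hom(3) ab r(2) s(2) mult.assoc)
      then have "\<phi> r * \<phi> b = \<phi> w * \<phi> u" using kernel by (metis hom(7))
      also have "\<dots> = \<phi> r * (\<phi> a * p)" by (metis p r(3) mult.assoc)
      finally show ?thesis using cancel[OF r(1)] by simp
    qed
    then show ?thesis by blast
  qed
  then obtain \<psi> where \<psi>: "\<And>q a b. \<theta> a * q = \<theta> b \<Longrightarrow> \<phi> a * \<psi> q = \<phi> b" by metis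
  have \<psi>\<theta>: "\<psi> (\<theta> u) = \<phi> u" for u
    using \<psi>[of 1 "\<theta> u" u] by (simp add: hom)
  have "\<psi> (q + q') = \<psi> q + \<psi> q' \<and> \<psi> (q * q') = \<psi> q * \<psi> q' \<and> \<psi> (scaleC c q) = scaleC c (\<psi> q)" for q q' c
  proof -
    obtain s u where s: "s \<in> S" "\<theta> s * q = \<theta> u" using frac by blast
    obtain t v where t: "t \<in> S" "\<theta> t * q' = \<theta> v" using frac by blast
    obtain r w where r: "r \<in> S" "\<theta> r * \<theta> s = \<theta> w * \<theta> t" "\<phi> r * \<phi> s = \<phi> w * \<phi> t"
      using ore[OF t(1)] by blast
    obtain r' w' where r': "r' \<in> S" "\<theta> r' * \<theta> u = \<theta> w' * \<theta> t" "\<phi> r' * \<phi> u = \<phi> w' * \<phi> t"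
      using ore[OF t(1)] by blast
    note p = \<psi>[OF s(2)] \<psi>[OF t(2)]
    have "\<theta> (r * s) * (q + q') = \<theta> r * (\<theta> s * q) + \<theta> w * (\<theta> t * q')"
      by (simp add: hom distrib_left mult.assoc[symmetric] r(2))
    then have "\<phi> (r * s) * \<psi> (q + q') = \<phi> (r * u + w * v)"
      by (intro \<psi>) (simp add: s t hom)
    also have "\<dots> = \<phi> r * (\<phi> s * \<psi> q) + \<phi> w * (\<phi> t * \<psi> q')" by (simp add: p hom)
    also have "\<dots> = \<phi> r * (\<phi> s * (\<psi> q + \<psi> q'))"
      by (simp add: distrib_left mult.assoc[symmetric] r(3))
    finally have 1: "\<psi> (q + q') = \<psi> q + \<psi> q'"
      using cancel r(1) s(1) by (metis hom(7) mult.assoc)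
    have "\<theta> (r' * s) * (q * q') = \<theta> r' * (\<theta> s * q) * q'"
      by (simp add: hom mult.assoc)
    also have "\<dots> = \<theta> w' * (\<theta> t * q')"
      by (simp add: s(2) r'(2) mult.assoc)
    also have "\<dots> = \<theta> (w' * v)" by (simp add: t(2) hom)
    finally have "\<phi> (r' * s) * \<psi> (q * q') = \<phi> (w' * v)" by (rule \<psi>)
    also have "\<dots> = \<phi> w' * (\<phi> t * \<psi> q')" by (simp add: p hom)
    also have "\<dots> = \<phi> r' * (\<phi> s * \<psi> q) * \<psi> q'"
      by (simp only: p(1) r'(3) mult.assoc[symmetric])
    finally have 2: "\<psi> (q * q') = \<psi> q * \<psi> q'"
      using cancel r'(1) s(1) by (metis hom(7) mult.assoc)
    have "\<theta> s * scaleC c q = \<theta> (scaleC c u)"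
      by (simp add: hom mult_scaleC_right s(2))
    then have "\<phi> s * \<psi> (scaleC c q) = \<phi> (scaleC c u)" by (rule \<psi>)
    also have "\<dots> = \<phi> s * scaleC c (\<psi> q)" by (simp add: hom mult_scaleC_right p)
    finally have 3: "\<psi> (scaleC c q) = scaleC c (\<psi> q)" using cancel s(1) by blast
    show ?thesis using 1 2 3 by blast
  qed
  moreover have "\<psi> 1 = 1" using \<psi>\<theta>[of 1] by (simp add: hom)
  ultimately have "alg_hom \<psi>" by (simp add: alg_hom_def)
  then show ?thesis using \<psi>\<theta> by blast
qed

section \<open>The oscillator representation\<close>

text \<open>The linear endomorphisms of the space of all functions on \<open>'a\<close>, as a type, so that the universal
properties above apply to representations.\<close>

typedef 'a cend = "{T :: ('a \<Rightarrow> complex) \<Rightarrow> ('a \<Rightarrow> complex).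
    (\<forall>f g. T (\<lambda>x. f x + g x) = (\<lambda>x. T f x + T g x)) \<and> (\<forall>c f. T (\<lambda>x. c * f x) = (\<lambda>x. c * T f x))}"
  morphisms cend_apply Cend
  by (rule exI[of _ "\<lambda>f. f"]) simp

setup_lifting type_definition_cend

instantiation cend :: (type) complex_algebra_1
begin
lift_definition zero_cend :: "'a cend" is "\<lambda>f x. 0" by simp
lift_definition one_cend :: "'a cend" is "\<lambda>f. f" by simp
lift_definition plus_cend :: "'a cend \<Rightarrow> 'a cend \<Rightarrow> 'a cend" is "\<lambda>S T f x. S f x + T f x"
  by (auto simp: algebra_simps)
lift_definition minus_cend :: "'a cend \<Rightarrow> 'a cend \<Rightarrow> 'a cend" is "\<lambda>S T f x. S f x - T f x"
  by (auto simp: algebra_simps)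
lift_definition uminus_cend :: "'a cend \<Rightarrow> 'a cend" is "\<lambda>S f x. - S f x"
  by (auto simp: algebra_simps)
lift_definition times_cend :: "'a cend \<Rightarrow> 'a cend \<Rightarrow> 'a cend" is "\<lambda>S T f. S (T f)"
  by auto
lift_definition scaleC_cend :: "complex \<Rightarrow> 'a cend \<Rightarrow> 'a cend" is "\<lambda>c S f x. c * S f x"
  by (auto simp: algebra_simps)
instance
  by (standard; transfer; force simp: algebra_simps fun_eq_iff)
end

lift_definition weighted_shift :: "('a \<Rightarrow> complex) \<Rightarrow> ('a \<Rightarrow> 'a) \<Rightarrow> 'a cend" is
  "\<lambda>w \<sigma> f x. w x * f (\<sigma> x)"
  by (auto simp: algebra_simps)

lemma weighted_shift_mult:
  "weighted_shift w \<sigma> * weighted_shift w' \<sigma>' = weighted_shift (\<lambda>x. w x * w' (\<sigma> x)) (\<lambda>x. \<sigma>' (\<sigma> x))"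
  by transfer (simp add: mult.assoc)

lemma weighted_shift_one: "weighted_shift (\<lambda>x. 1) (\<lambda>x. x) = 1"
  by transfer simp

lemma weighted_shift_diff: "weighted_shift w \<sigma> - weighted_shift w' \<sigma> = weighted_shift (\<lambda>x. w x - w' x) \<sigma>"
  by transfer (simp add: algebra_simps)

text \<open>The swap of the two halves of the index set, and the signs that it carries: together they encode the
symplectic form, and with it the condition that defines \<open>sp\<close> (lemma \<open>sp_set_swap_sum\<close>).\<close>

primrec swap_sum :: "'n + 'n \<Rightarrow> 'n + 'n" where
  "swap_sum (Inl i) = Inr i" | "swap_sum (Inr i) = Inl i"

primrec sum_sign :: "'n + 'n \<Rightarrow> complex" where
  "sum_sign (Inl i) = - 1" | "sum_sign (Inr i) = 1"

lemma swap_sum_swap_sum [simp]: "swap_sum (swap_sum a) = a"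
  by (cases a) auto

lemma sum_sign_swap_sum [simp]: "sum_sign (swap_sum a) = - sum_sign a"
  by (cases a) auto

lemma sum_sign_square [simp]: "sum_sign a * sum_sign a = 1" "sum_sign a * (sum_sign a * c) = c"
  by (cases a; simp)+

lemma sum_swap_sum: "(\<Sum>a\<in>UNIV. f (swap_sum a)) = (\<Sum>a\<in>(UNIV :: ('n::finite + 'n) set). f a)"
  by (rule sum.reindex_bij_witness[of _ swap_sum swap_sum]) auto

lemma sp_set_swap_sum:
  "A \<in> sp_set \<Longrightarrow> A $ a $ b = - (sum_sign a * sum_sign b * A $ swap_sum b $ swap_sum a)"
  by (cases a; cases b) (auto simp: sp_set_iff)

locale weyl_algebra =
  fixes x d :: "'n::finite \<Rightarrow> 'r::complex_algebra_1"
  assumes xx: "x i * x j = x j * x i" and dd: "d i * d j = d j * d i"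
    and dx: "d i * x j = x j * d i + of_bool (i = j)"
begin

text \<open>In terms of \<open>z = (x, - \<partial>)\<close> and \<open>w = (\<partial>, x)\<close> the relations of the Weyl algebra say that \<open>w\<close> is dual to
\<open>z\<close>, and both families span the same space. With this choice \<open>osc A\<close> acts on \<open>z\<close> by the matrix \<open>A\<close>.\<close>
primrec z :: "'n + 'n \<Rightarrow> 'r" where
  "z (Inl i) = x i" | "z (Inr i) = - d i"

definition w :: "'n + 'n \<Rightarrow> 'r" where
  "w b = scaleC (sum_sign b) (z (swap_sum b))"

lemma w_simps: "w (Inl i) = d i" "w (Inr i) = x i"
  by (simp_all add: w_def scaleC.scale_minus_left scaleC_one)

lemma z_swap: "z (swap_sum b) = scaleC (sum_sign b) (w b)"
  by (simp add: w_def scaleC_scaleC scaleC_one)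

lemma z_conv_w: "z b = scaleC (- sum_sign b) (w (swap_sum b))"
  using z_swap[of "swap_sum b"] by simp

lemma wz: "w b * z c = z c * w b + of_bool (b = c)"
  by (cases b; cases c) (auto simp: w_simps xx dd dx)

definition osc :: "'n mat2 \<Rightarrow> 'r" where
  "osc A = scaleC (1/2) (\<Sum>a\<in>UNIV. \<Sum>b\<in>UNIV. scaleC (A $ a $ b) (z a * w b))"

text \<open>The commutator with \<open>z\<^sub>a w\<^sub>b\<close> has a contribution from each factor. Both contribute the same sum,
because of the symmetry of \<open>A\<close>, and this cancels the factor \<open>1/2\<close>.\<close>
lemma osc_z:
  assumes A: "A \<in> sp_set"
  shows "osc A * z c - z c * osc A = (\<Sum>a\<in>UNIV. scaleC (A $ a $ c) (z a))"
proof -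
  have zz: "z a * z c - z c * z a = scaleC (of_bool (a = swap_sum c) * sum_sign c) 1" for a
  proof -
    have "z a * z c - z c * z a = scaleC (- sum_sign c) (z a * w (swap_sum c) - w (swap_sum c) * z a)"
      by (simp add: z_conv_w[of c] mult_scaleC_left mult_scaleC_right scaleC.scale_right_diff_distrib)
    also have "z a * w (swap_sum c) - w (swap_sum c) * z a = - of_bool (a = swap_sum c)"
      by (auto simp: wz[of "swap_sum c" a])
    finally show ?thesis
      by (auto simp: scaleC.scale_minus_left scaleC.scale_minus_right)
  qed
  have "z a * w b * z c - z c * (z a * w b) = z a * (w b * z c - z c * w b) + (z a * z c - z c * z a) * w b" for a b
    by (simp add: algebra_simps)
  also have "\<And>a b. z a * (w b * z c - z c * w b) + (z a * z c - z c * z a) * w b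
      = scaleC (of_bool (b = c)) (z a) + scaleC (of_bool (a = swap_sum c) * sum_sign c) (w b)"
    unfolding zz by (auto simp: wz[of _ c] mult_scaleC_left scaleC_one)
  finally have *: "z a * w b * z c - z c * (z a * w b)
      = scaleC (of_bool (b = c)) (z a) + scaleC (of_bool (a = swap_sum c) * sum_sign c) (w b)" for a b .
  have "(\<Sum>a\<in>UNIV. \<Sum>b\<in>UNIV. scaleC (A $ a $ b) (z a * w b)) * z c
      - z c * (\<Sum>a\<in>UNIV. \<Sum>b\<in>UNIV. scaleC (A $ a $ b) (z a * w b))
    = (\<Sum>a\<in>UNIV. \<Sum>b\<in>UNIV. scaleC (A $ a $ b) (z a * w b * z c - z c * (z a * w b)))"
    by (simp add: sum_distrib_left sum_distrib_right sum_subtractf mult_scaleC_left mult_scaleC_right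
        scaleC.scale_right_diff_distrib)
  also have "\<dots> = (\<Sum>a\<in>UNIV. \<Sum>b\<in>UNIV. scaleC (A $ a $ b * of_bool (b = c)) (z a))
      + (\<Sum>a\<in>UNIV. \<Sum>b\<in>UNIV. scaleC (of_bool (a = swap_sum c) * (A $ a $ b * sum_sign c)) (w b))"
    unfolding * by (simp add: sum.distrib scaleC_add_right scaleC_scaleC mult_ac)
  also have "(\<Sum>a\<in>UNIV. \<Sum>b\<in>UNIV. scaleC (A $ a $ b * of_bool (b = c)) (z a))
      = (\<Sum>a\<in>UNIV. scaleC (A $ a $ c) (z a))"
    by (simp add: of_bool_def if_distrib if_distribR cong: if_cong)
  also have "(\<Sum>a\<in>UNIV. \<Sum>b\<in>UNIV. scaleC (of_bool (a = swap_sum c) * (A $ a $ b * sum_sign c)) (w b))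
      = (\<Sum>b\<in>UNIV. scaleC (A $ swap_sum c $ b * sum_sign c) (w b))"
    by (subst sum.swap) (simp add: of_bool_def if_distrib if_distribR cong: if_cong)
  also have "\<dots> = (\<Sum>b\<in>UNIV. scaleC (A $ swap_sum b $ c) (z (swap_sum b)))"
    by (subst sp_set_swap_sum[OF A]) (simp add: z_swap scaleC_scaleC mult_ac)
  also have "\<dots> = (\<Sum>a\<in>UNIV. scaleC (A $ a $ c) (z a))"
    by (rule sum_swap_sum)
  finally have "osc A * z c - z c * osc A
      = scaleC (1/2) ((\<Sum>a\<in>UNIV. scaleC (A $ a $ c) (z a)) + (\<Sum>a\<in>UNIV. scaleC (A $ a $ c) (z a)))"
    by (simp add: osc_def mult_scaleC_left mult_scaleC_right scaleC.scale_right_diff_distrib[symmetric])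
  then show ?thesis
    by (simp add: scaleC_add_right scaleC_add_left[symmetric] scaleC_one)
qed

lemma osc_w:
  assumes A: "A \<in> sp_set"
  shows "osc A * w e - w e * osc A = - (\<Sum>c\<in>UNIV. scaleC (A $ e $ c) (w c))"
proof -
  have "osc A * w e - w e * osc A = scaleC (sum_sign e) (osc A * z (swap_sum e) - z (swap_sum e) * osc A)"
    by (simp add: w_def mult_scaleC_left mult_scaleC_right scaleC.scale_right_diff_distrib)
  also have "\<dots> = (\<Sum>a\<in>UNIV. scaleC (A $ swap_sum a $ swap_sum e * sum_sign e) (z (swap_sum a)))"
    unfolding osc_z[OF A] scaleC.scale_sum_right scaleC_scaleC
    by (subst sum_swap_sum[symmetric]) (simp only: mult.commute)
  also have "\<dots> = (\<Sum>a\<in>UNIV. - scaleC (A $ e $ a) (w a))"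
    by (rule sum.cong, simp, subst sp_set_swap_sum[OF A])
       (simp add: z_swap scaleC_scaleC mult_ac scaleC.scale_minus_left)
  finally show ?thesis by (simp add: sum_negf)
qed

text \<open>The commutator with \<open>osc A\<close> is a derivation, and it acts on \<open>z\<close> and \<open>w\<close> by \<open>A\<close> and by the negative
transpose of \<open>A\<close>.\<close>
lemma osc_bracket:
  assumes A: "A \<in> sp_set"
  shows "osc (A ** B - B ** A) = osc A * osc B - osc B * osc A"
proof -
  have "osc A * (z c * w e) - z c * w e * osc A
      = (osc A * z c - z c * osc A) * w e + z c * (osc A * w e - w e * osc A)" for c e
    by (simp add: algebra_simps)
  then have *: "osc A * (z c * w e) - z c * w e * osc A
      = (\<Sum>a\<in>UNIV. scaleC (A $ a $ c) (z a * w e)) - (\<Sum>a\<in>UNIV. scaleC (A $ e $ a) (z c * w a))" for c e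
    by (simp add: osc_z[OF A] osc_w[OF A] sum_distrib_left sum_distrib_right mult_scaleC_left mult_scaleC_right)
  have "osc A * osc B - osc B * osc A
      = scaleC (1/2) (\<Sum>c\<in>UNIV. \<Sum>e\<in>UNIV. scaleC (B $ c $ e) (osc A * (z c * w e) - z c * w e * osc A))"
    by (simp add: osc_def[of B] sum_distrib_left sum_distrib_right sum_subtractf mult_scaleC_left mult_scaleC_right
        scaleC.scale_right_diff_distrib)
  also have "(\<Sum>c\<in>UNIV. \<Sum>e\<in>UNIV. scaleC (B $ c $ e) (osc A * (z c * w e) - z c * w e * osc A))
     = (\<Sum>c\<in>UNIV. \<Sum>e\<in>UNIV. \<Sum>a\<in>UNIV. scaleC (A $ a $ c * B $ c $ e) (z a * w e))
      - (\<Sum>c\<in>UNIV. \<Sum>e\<in>UNIV. \<Sum>a\<in>UNIV. scaleC (B $ c $ e * A $ e $ a) (z c * w a))"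
    by (simp add: * scaleC.scale_right_diff_distrib scaleC.scale_sum_right scaleC_scaleC sum_subtractf mult.commute)
  also have "(\<Sum>c\<in>UNIV. \<Sum>e\<in>UNIV. \<Sum>a\<in>UNIV. scaleC (A $ a $ c * B $ c $ e) (z a * w e))
     = (\<Sum>a\<in>UNIV. \<Sum>b\<in>UNIV. scaleC ((A ** B) $ a $ b) (z a * w b))"
  proof -
    have "(\<Sum>c\<in>UNIV. \<Sum>e\<in>UNIV. \<Sum>a\<in>UNIV. scaleC (A $ a $ c * B $ c $ e) (z a * w e))
      = (\<Sum>c\<in>UNIV. \<Sum>a\<in>UNIV. \<Sum>e\<in>UNIV. scaleC (A $ a $ c * B $ c $ e) (z a * w e))"
      by (rule sum.cong[OF refl], rule sum.swap)
    also have "\<dots> = (\<Sum>a\<in>UNIV. \<Sum>c\<in>UNIV. \<Sum>e\<in>UNIV. scaleC (A $ a $ c * B $ c $ e) (z a * w e))"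
      by (rule sum.swap)
    also have "\<dots> = (\<Sum>a\<in>UNIV. \<Sum>e\<in>UNIV. \<Sum>c\<in>UNIV. scaleC (A $ a $ c * B $ c $ e) (z a * w e))"
      by (rule sum.cong[OF refl], rule sum.swap)
    finally show ?thesis by (simp add: matrix_matrix_mult_def scaleC.scale_sum_left)
  qed
  also have "(\<Sum>c\<in>UNIV. \<Sum>e\<in>UNIV. \<Sum>a\<in>UNIV. scaleC (B $ c $ e * A $ e $ a) (z c * w a))
     = (\<Sum>a\<in>UNIV. \<Sum>b\<in>UNIV. scaleC ((B ** A) $ a $ b) (z a * w b))"
  proof -
    have "(\<Sum>c\<in>UNIV. \<Sum>e\<in>UNIV. \<Sum>a\<in>UNIV. scaleC (B $ c $ e * A $ e $ a) (z c * w a))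
      = (\<Sum>c\<in>UNIV. \<Sum>a\<in>UNIV. \<Sum>e\<in>UNIV. scaleC (B $ c $ e * A $ e $ a) (z c * w a))"
      by (rule sum.cong[OF refl], rule sum.swap)
    then show ?thesis by (simp add: matrix_matrix_mult_def scaleC.scale_sum_left)
  qed
  finally show ?thesis
    by (simp add: osc_def scaleC.scale_left_diff_distrib sum_subtractf)
qed

lemma osc_add: "osc (A + B) = osc A + osc B"
  by (simp add: osc_def scaleC_add_left sum.distrib scaleC_add_right)

lemma osc_diff: "osc (A - B) = osc A - osc B"
  by (metis add_diff_cancel_right' osc_add diff_add_cancel)

lemma osc_scale: "osc (\<chi> a b. c * A $ a $ b) = scaleC c (osc A)"
  by (simp add: osc_def scaleC.scale_sum_right scaleC_scaleC mult.left_commute)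

lemma osc_unit: "osc (unit_mat a b) = scaleC (1/2) (z a * w b)"
proof -
  have "(\<Sum>i\<in>UNIV. \<Sum>j\<in>UNIV. scaleC (unit_mat a b $ i $ j) (z i * w j)) = z a * w b"
  proof -
    have "scaleC (unit_mat a b $ i $ j) (z i * w j) = (if j = b then (if i = a then z i * w j else 0) else 0)" for i j
      by (simp add: unit_mat_nth scaleC_one)
    then show ?thesis by simp
  qed
  then show ?thesis by (simp add: osc_def)
qed

lemma half_double: "scaleC (1/2) q + scaleC (1/2) q = (q :: 'r)"
  by (simp add: scaleC_add_left[symmetric] scaleC_one)

theorem oscillator_representation:
  "\<exists>\<phi>. alg_hom \<phi>
    \<and> (\<forall>i j. \<phi> (usp_inj (sp_diff i j)) = x i * d j + scaleC (of_bool (i = j) / 2) 1)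
    \<and> (\<forall>i j. \<phi> (usp_inj (sp_pos i j)) = x i * x j)
    \<and> (\<forall>i j. \<phi> (usp_inj (sp_neg i j)) = - (d i * d j))"
proof -
  obtain \<phi> where \<phi>: "alg_hom \<phi>" "\<And>A. \<phi> (usp_inj A) = osc (Rep_sp A)"
    using usp_universal[of "\<lambda>A. osc (Rep_sp A)"]
    by (auto simp: sp_add.rep_eq sp_scale.rep_eq sp_bracket.rep_eq osc_add osc_scale osc_bracket Rep_sp)
  have "\<phi> (usp_inj (sp_diff i j)) = x i * d j + scaleC (of_bool (i = j) / 2) 1" for i j
  proof -
    have "\<phi> (usp_inj (sp_diff i j)) = scaleC (1/2) (x i * d j) + scaleC (1/2) (d j * x i)"
      by (simp add: \<phi> sp_diff.rep_eq osc_diff osc_unit w_simps scaleC.scale_minus_right)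
    then show ?thesis
      by (auto simp: dx[of j i] scaleC_add_right half_double add.assoc[symmetric])
  qed
  moreover have "\<phi> (usp_inj (sp_pos i j)) = x i * x j" for i j
    by (simp add: \<phi> sp_pos.rep_eq osc_add osc_unit w_simps half_double xx[of j i])
  moreover have "\<phi> (usp_inj (sp_neg i j)) = - (d i * d j)" for i j
    by (simp add: \<phi> sp_neg.rep_eq osc_add osc_unit w_simps half_double dd[of j i] scaleC.scale_minus_right
        minus_diff_commute) (metis half_double minus_add_distrib add_uminus_conv_diff)
  ultimately show ?thesis using \<phi>(1) by blast
qed

end

section \<open>Commutation relations in the localization\<close>

lemma matrix_diff_ldistrib: "A ** (B - C) = A ** B - A ** (C :: 'a::ring_1 ^ _ ^ _)"
  by (simp add: matrix_matrix_mult_def vec_eq_iff right_diff_distrib sum_subtractf)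

lemma matrix_diff_rdistrib: "(A - B) ** C = A ** C - B ** (C :: 'a::ring_1 ^ _ ^ _)"
  by (simp add: matrix_matrix_mult_def vec_eq_iff left_diff_distrib sum_subtractf)

lemma matrix_add_rdistrib: "(A + B) ** C = A ** C + B ** (C :: 'a::ring_1 ^ _ ^ _)"
  by (simp add: matrix_matrix_mult_def vec_eq_iff distrib_right sum.distrib)

lemma unit_mat_mult: "unit_mat a b ** unit_mat c d = (if b = c then unit_mat a d else 0)"
proof -
  have "(\<Sum>k\<in>UNIV. of_bool (p = a) * of_bool (k = b) * (of_bool (k = c) * of_bool (q = d)))
      = (of_bool (b = c) * of_bool (p = a) * of_bool (q = d) :: complex)" for p q
  proof -
    have "of_bool (p = a) * of_bool (k = b) * (of_bool (k = c) * of_bool (q = d))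
      = (if k = b then of_bool (b = c) * of_bool (p = a) * of_bool (q = d) else (0 :: complex))" for k
      by auto
    then show ?thesis by simp
  qed
  then show ?thesis
    by (auto simp: matrix_matrix_mult_def vec_eq_iff unit_mat_nth)
qed

lemma scale_of_bool_mat: "(\<chi> a b. of_bool Q * A $ a $ b) = (if Q then A else 0 :: 'n::finite mat2)"
  "(\<chi> a b. - of_bool Q * A $ a $ b) = (if Q then - A else 0 :: 'n::finite mat2)"
  by (auto simp: vec_eq_iff)

lemmas sp_bracket_simps = sp_bracket.rep_eq sp_add.rep_eq sp_scale.rep_eq sp_diff.rep_eq sp_pos.rep_eq
  sp_neg.rep_eq scale_of_bool_mat matrix_diff_ldistrib matrix_diff_rdistrib matrix_add_ldistrib
  matrix_add_rdistrib unit_mat_mult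

lemma sp_diff_diag: "sp_diff i i = sp_h i"
  by (simp add: Rep_sp_inject[symmetric] sp_diff.rep_eq sp_h.rep_eq)

lemma sp_pos_sym: "sp_pos i j = sp_pos j i" and sp_neg_sym: "sp_neg i j = sp_neg j i"
  by (simp_all add: Rep_sp_inject[symmetric] sp_pos.rep_eq sp_neg.rep_eq add.commute)

text \<open>The structure constants of \<open>sp\<close>, uniformly in the indices; \<open>sp_diff i i\<close> is \<open>h\<^sub>i\<close>.\<close>
lemma bracket_diff_diff:
  "sp_bracket (sp_diff i j) (sp_diff k l)
    = sp_add (sp_scale (of_bool (j = k)) (sp_diff i l)) (sp_scale (- of_bool (i = l)) (sp_diff k j))"
  unfolding Rep_sp_inject[symmetric] sp_bracket_simps by (auto simp: algebra_simps)

lemma bracket_diff_pos: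
  "sp_bracket (sp_diff i j) (sp_pos k l)
    = sp_add (sp_scale (of_bool (j = k)) (sp_pos i l)) (sp_scale (of_bool (j = l)) (sp_pos i k))"
  unfolding Rep_sp_inject[symmetric] sp_bracket_simps by (auto simp: algebra_simps)

lemma bracket_diff_neg:
  "sp_bracket (sp_diff i j) (sp_neg k l)
    = sp_add (sp_scale (- of_bool (i = k)) (sp_neg j l)) (sp_scale (- of_bool (i = l)) (sp_neg j k))"
  unfolding Rep_sp_inject[symmetric] sp_bracket_simps by (auto simp: algebra_simps)

lemma bracket_pos_neg:
  "sp_bracket (sp_pos i j) (sp_neg k l)
    = sp_add (sp_add (sp_scale (of_bool (i = k)) (sp_diff j l)) (sp_scale (of_bool (i = l)) (sp_diff j k)))
        (sp_add (sp_scale (of_bool (j = k)) (sp_diff i l)) (sp_scale (of_bool (j = l)) (sp_diff i k)))"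
  unfolding Rep_sp_inject[symmetric] sp_bracket_simps by (auto simp: algebra_simps)

lemma bracket_pos_pos: "sp_bracket (sp_pos i j) (sp_pos k l) = sp_scale (of_bool False) (sp_pos i j)"
  unfolding Rep_sp_inject[symmetric] sp_bracket_simps by simp

lemma scaleC_of_bool: "scaleC (of_bool Q) u = of_bool Q * (u :: 'a::complex_algebra_1)"
  "scaleC (- of_bool Q) u = - (of_bool Q * u)"
  by (cases Q; simp add: scaleC_one scaleC.scale_minus_left)+

lemma mem_centralizer_range: "u \<in> centralizer (range f) \<longleftrightarrow> (\<forall>i. u * f i = f i * u)"
  by (auto simp: centralizer_def)

locale localized_sp =
  fixes \<theta> :: "'n::{finite,linorder} usp \<Rightarrow> 'q::complex_algebra_1"
  assumes loc: "is_localization ore_set \<theta>"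
begin

abbreviation "D \<equiv> Xdiff \<theta>"
abbreviation "P \<equiv> Xpos \<theta>"
abbreviation "N \<equiv> Xneg \<theta>"
abbreviation "h \<equiv> hh \<theta>"

lemma hom: "alg_hom \<theta>"
  using loc by (simp add: is_localization_def)

lemma theta_bracket: "\<theta> (usp_inj a) * \<theta> (usp_inj b) = \<theta> (usp_inj b) * \<theta> (usp_inj a) + \<theta> (usp_inj (sp_bracket a b))"
  by (simp add: usp_inj_bracket alg_hom_diff[OF hom] alg_homD[OF hom])

lemma theta_lin: "\<theta> (usp_inj (sp_add a b)) = \<theta> (usp_inj a) + \<theta> (usp_inj b)"
  "\<theta> (usp_inj (sp_scale c a)) = scaleC c (\<theta> (usp_inj a))"
  by (simp_all add: usp_inj_add usp_inj_scale alg_homD[OF hom])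

lemma D_diag: "D i i = h i"
  by (simp add: sp_diff_diag)

lemma P_sym: "P i j = P j i" and N_sym: "N i j = N j i"
  using sp_pos_sym[of i j] sp_neg_sym[of i j] by simp_all

lemma DD: "D i j * D k l = D k l * D i j + of_bool (j = k) * D i l - of_bool (i = l) * D k j"
  by (subst theta_bracket) (simp add: bracket_diff_diff theta_lin scaleC_of_bool)
lemma DP: "D i j * P k l = P k l * D i j + of_bool (j = k) * P i l + of_bool (j = l) * P i k"
  by (subst theta_bracket) (simp add: bracket_diff_pos theta_lin scaleC_of_bool)
lemma DN: "D i j * N k l = N k l * D i j - of_bool (i = k) * N j l - of_bool (i = l) * N j k"
  by (subst theta_bracket) (simp add: bracket_diff_neg theta_lin scaleC_of_bool)
lemma PN: "P i j * N k l = N k l * P i j + of_bool (i = k) * D j l + of_bool (i = l) * D j k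
    + of_bool (j = k) * D i l + of_bool (j = l) * D i k"
  by (subst theta_bracket) (simp add: bracket_pos_neg theta_lin scaleC_of_bool)
lemma PP: "P i j * P k l = P k l * P i j"
  by (subst theta_bracket) (simp add: bracket_pos_pos theta_lin scaleC_of_bool)
lemma hh_comm: "h i * h j = h j * h i"
  using DD[of i i j j] by (auto simp: D_diag)

text \<open>The invertible elements \<open>x\<^sub>1 = X\<^bsub>2 \<epsilon>\<^sub>1\<^esub>\<close> and \<open>x\<^sub>k = X\<^bsub>\<epsilon>\<^sub>1 - \<epsilon>\<^sub>k\<^esub>\<close> of \<open>B\<close>. One index set for both kinds lets
their commutation rules be stated once.\<close>

definition x :: "'n \<Rightarrow> 'q" where "x i = (if i = ix1 then P ix1 ix1 else D ix1 i)"
definition y :: "'n \<Rightarrow> 'q" where "y i = rinv (x i)"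

lemma x_ix1: "x ix1 = P ix1 ix1" and x_ixs: "k \<in> ixs \<Longrightarrow> x k = D ix1 k"
  by (auto simp: x_def ixs_def)

text \<open>Exponent vectors that are zero except for a single one show that each generator belongs to the Ore set.\<close>
lemma ore_set_gens: "\<exists>s\<in>ore_set. \<theta> s = x i"
proof -
  define m where "m k = (if k = i then 1 else 0 :: nat)" for k
  let ?Y = "\<lambda>k. usp_inj (sp_diff ix1 k)"
  have list: "prod_list (map (\<lambda>k. ?Y k ^ m k) ks) = (if i \<in> set ks then ?Y i else 1)"
    if "distinct ks" for ks
    using that by (induction ks) (auto simp: m_def)
  have "\<theta> (usp_inj (sp_pos ix1 ix1) ^ m ix1
      * prod_list (map (\<lambda>k. ?Y k ^ m k) (sorted_list_of_set ixs))) = x i"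
    by (subst list) (auto simp: m_def x_def ixs_def)
  moreover have "usp_inj (sp_pos ix1 ix1) ^ m ix1
      * prod_list (map (\<lambda>k. ?Y k ^ m k) (sorted_list_of_set ixs)) \<in> ore_set"
    unfolding ore_set_def by blast
  ultimately show ?thesis by blast
qed

lemma x_invertible: "invertible_elt (x i)"
  using loc ore_set_gens[of i] by (auto simp: is_localization_def)

lemma xy: "x i * y i = 1" and yx: "y i * x i = 1"
  using rinv_mult[OF x_invertible] by (simp_all add: y_def)

lemma xy_assoc: "x i * (y i * u) = u" and yx_assoc: "y i * (x i * u) = u"
  by (simp_all add: mult.assoc[symmetric] xy yx)

lemma xx: "x i * x j = x j * x i"
  using DD[of ix1 i ix1 j] PP[of ix1 ix1 ix1 ix1] DP[of ix1 i ix1 ix1] DP[of ix1 j ix1 ix1]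
  by (auto simp: x_def)

lemma yx_comm: "y i * x j = x j * y i"
  unfolding y_def by (rule commute_rinv[OF x_invertible xx])

lemma yy: "y i * y j = y j * y i"
  unfolding y_def[of i] by (rule commute_rinv[OF x_invertible yx_comm[symmetric]])

lemma xx_left: "x i * (x j * u) = x j * (x i * u)" and yy_left: "y i * (y j * u) = y j * (y i * u)"
  and yx_left: "y i * (x j * u) = x j * (y i * u)"
  by (simp_all add: mult.assoc[symmetric] xx[of i j] yy[of i j] yx_comm)

text \<open>As rewrite rules these bring every product of the \<open>x\<^sub>i\<close> and \<open>y\<^sub>i\<close> into a common form, without
cancellation.\<close>
lemmas mono_ac = mult.assoc xx xx_left yy yy_left yx_comm yx_left

text \<open>The weight of \<open>u\<close> for the adjoint action of the \<open>h\<^sub>i\<close>, in coordinates \<open>\<epsilon>\<^sub>1, \<dots>, \<epsilon>\<^sub>n\<close>.\<close>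
definition has_weight :: "'q \<Rightarrow> ('n \<Rightarrow> int) \<Rightarrow> bool" where
  "has_weight u a \<longleftrightarrow> (\<forall>i. h i * u = u * h i + of_int (a i) * u)"

lemma has_weightD: "has_weight u a \<Longrightarrow> u * h i = (h i - of_int (a i)) * u"
  by (simp add: has_weight_def left_diff_distrib)

lemma has_weight_mult: "has_weight u a \<Longrightarrow> has_weight v b \<Longrightarrow> has_weight (u * v) (\<lambda>i. a i + b i)"
proof -
  assume u: "has_weight u a" and v: "has_weight v b"
  have "h i * (u * v) = u * v * h i + of_int (a i + b i) * (u * v)" for i
  proof -
    have "h i * (u * v) = (u * h i + of_int (a i) * u) * v"
      using u by (simp add: has_weight_def mult.assoc[symmetric])
    also have "\<dots> = u * (h i * v) + of_int (a i) * (u * v)"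
      by (simp add: distrib_right mult.assoc)
    also have "u * (h i * v) = u * v * h i + u * of_int (b i) * v"
      using v by (simp add: has_weight_def distrib_left mult.assoc)
    also have "u * of_int (b i) * v = of_int (b i) * (u * v)"
      by (metis mult.assoc mult_of_int_commute)
    finally show ?thesis by (simp add: distrib_right add.assoc add.commute)
  qed
  then show ?thesis by (simp add: has_weight_def)
qed

lemma has_weight_inverse:
  assumes "has_weight u a" "u * v = 1" "v * u = 1"
  shows "has_weight v (\<lambda>i. - a i)"
proof -
  have "h i * v = v * h i + of_int (- a i) * v" for i
  proof -
    have "v * h i = v * (h i * u) * v" using assms(2) by (simp add: mult.assoc)
    also have "\<dots> = (v * u) * h i * v + v * of_int (a i) * (u * v)"
      using assms(1) by (simp only: has_weight_def distrib_left distrib_right mult.assoc)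
    also have "\<dots> = h i * v + of_int (a i) * v"
      using assms(2,3) mult_of_int_commute[of "a i" v] by simp
    finally show ?thesis by simp
  qed
  then show ?thesis by (simp add: has_weight_def)
qed

lemma has_weight_D: "has_weight (D j k) (\<lambda>i. of_bool (i = j) - of_bool (i = k))"
  unfolding has_weight_def D_diag[symmetric]
proof
  fix i show "D i i * D j k = D j k * D i i + of_int (of_bool (i = j) - of_bool (i = k)) * D j k"
    using DD[of i i j k] by (auto simp: left_diff_distrib)
qed
lemma has_weight_P: "has_weight (P j k) (\<lambda>i. of_bool (i = j) + of_bool (i = k))"
  using P_sym[of j k] by (auto simp: has_weight_def D_diag[symmetric] DP distrib_right)
lemma has_weight_N: "has_weight (N j k) (\<lambda>i. - of_bool (i = j) - of_bool (i = k))"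
  using N_sym[of j k] by (auto simp: has_weight_def D_diag[symmetric] DN distrib_right left_diff_distrib)

lemma has_weight_x: "has_weight (x j) (\<lambda>i. of_bool (i = ix1) + (if j = ix1 then of_bool (i = ix1) else - of_bool (i = j)))"
  using has_weight_P[of ix1 ix1] has_weight_D[of ix1 j] by (auto simp: x_def)
lemma has_weight_y: "has_weight (y j) (\<lambda>i. - (of_bool (i = ix1) + (if j = ix1 then of_bool (i = ix1) else - of_bool (i = j))))"
  by (rule has_weight_inverse[OF has_weight_x xy yx])

lemma has_weight_zero: "has_weight u a \<Longrightarrow> (\<And>i. a i = 0) \<Longrightarrow> u \<in> centralizer (range h)"
  by (simp add: has_weight_def mem_centralizer_range)

section \<open>Weight zero normal forms of the root vectors\<close>

text \<open>Each root vector \<open>X\<^sub>\<alpha>\<close> is multiplied on the right by the monomial in the \<open>x\<^sub>i\<close> and their inverses that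
has weight \<open>- \<alpha>\<close>. These elements commute with the \<open>h\<^sub>i\<close>, and conjugation by the \<open>x\<^sub>i\<close> moves them in a
simple triangular way.\<close>

definition hat_pos1 :: "'n \<Rightarrow> 'q" where "hat_pos1 k = P k ix1 * x k * y ix1"
definition hat_diff :: "'n \<Rightarrow> 'n \<Rightarrow> 'q" where "hat_diff i j = D i j * x i * y j"
definition hat_neg :: "'n \<Rightarrow> 'n \<Rightarrow> 'q" where "hat_neg k l = N k l * y k * y l * x ix1"
definition hat_pos :: "'n \<Rightarrow> 'n \<Rightarrow> 'q" where "hat_pos k l = P k l * x k * x l * y ix1"
definition hat_neg1 :: "'n \<Rightarrow> 'q" where "hat_neg1 k = N ix1 k * y k * x ix1"
definition hat_neg11 :: "'q" where "hat_neg11 = N ix1 ix1 * x ix1"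
definition hat_diff1 :: "'n \<Rightarrow> 'q" where "hat_diff1 k = D k ix1 * x k"

lemma hats_weight_zero:
  "k \<in> ixs \<Longrightarrow> hat_pos1 k \<in> centralizer (range h)"
  "i \<in> ixs \<Longrightarrow> j \<in> ixs \<Longrightarrow> hat_diff i j \<in> centralizer (range h)"
  "k \<in> ixs \<Longrightarrow> l \<in> ixs \<Longrightarrow> hat_neg k l \<in> centralizer (range h)"
  "k \<in> ixs \<Longrightarrow> l \<in> ixs \<Longrightarrow> hat_pos k l \<in> centralizer (range h)"
  "k \<in> ixs \<Longrightarrow> hat_neg1 k \<in> centralizer (range h)"
  "hat_neg11 \<in> centralizer (range h)"
  "k \<in> ixs \<Longrightarrow> hat_diff1 k \<in> centralizer (range h)"
  unfolding hat_pos1_def hat_diff_def hat_neg_def hat_pos_def hat_neg1_def hat_neg11_def hat_diff1_def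
  by (rule has_weight_zero, (rule has_weight_mult has_weight_D has_weight_P has_weight_N has_weight_x has_weight_y)+, simp add: ixs_def)+

lemma h_weight_zero: "h i \<in> centralizer (range h)"
  by (simp add: mem_centralizer_range hh_comm)

text \<open>Conjugation by \<open>x\<^sub>i\<close>. An element of weight zero belongs to the centralizer of \<open>B\<close> if and only if it is
fixed by all these automorphisms.\<close>
definition shift :: "'n \<Rightarrow> 'q \<Rightarrow> 'q" where "shift i u = x i * u * y i"

lemma shift_mult: "shift i (u * u') = shift i u * shift i u'"
proof -
  have "shift i u * shift i u' = x i * u * (y i * x i) * u' * y i" by (simp only: shift_def mult.assoc)
  then show ?thesis by (simp add: shift_def yx mult.assoc)
qed

lemma shift_lin: "shift i (u + u') = shift i u + shift i u'" "shift i (u - u') = shift i u - shift i u'"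
  "shift i (- u) = - shift i u" "shift i 1 = 1" "shift i 0 = 0" "shift i (of_nat k) = of_nat k"
  "shift i (sum f K) = (\<Sum>k\<in>K. shift i (f k))" "shift i (numeral nn) = numeral nn"
proof -
  show nat: "shift i (of_nat k) = of_nat k" for k
    unfolding shift_def mult_of_nat_commute[symmetric] by (simp add: mult.assoc xy)
  show "shift i (numeral nn) = numeral nn" using nat[of "numeral nn"] by simp
qed (simp_all add: shift_def distrib_left distrib_right left_diff_distrib right_diff_distrib xy
      sum_distrib_left sum_distrib_right)

lemma shift_x: "shift i (x j) = x j" and shift_y: "shift i (y j) = y j"
proof -
  have "shift i (x j) = x j * (x i * y i)" unfolding shift_def by (subst xx) (rule mult.assoc)
  then show "shift i (x j) = x j" by (simp add: xy)
  have "shift i (y j) = y j * (x i * y i)" unfolding shift_def by (subst yx_comm[symmetric]) (rule mult.assoc)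
  then show "shift i (y j) = y j" by (simp add: xy)
qed

lemma shift_h: "shift j (h i) = h i - of_bool (i = ix1) - (if j = ix1 then of_bool (i = ix1) else - of_bool (i = j))"
proof -
  have "shift j (h i) = (h i - of_int (of_bool (i = ix1) + (if j = ix1 then of_bool (i = ix1) else - of_bool (i = j)))) * (x j * y j)"
    unfolding shift_def by (subst has_weightD[OF has_weight_x]) (simp only: mult.assoc)
  then show ?thesis by (simp add: xy)
qed

lemma shift_I: "shift j (hsum \<theta>) = hsum \<theta> - 2 * of_bool (j = ix1)"
proof -
  have "shift j (hsum \<theta>) = hsum \<theta> - (\<Sum>i\<in>(UNIV :: 'n set). of_bool (i = ix1)) - (\<Sum>i\<in>UNIV. if j = ix1 then of_bool (i = ix1) else - of_bool (i = j))"
    unfolding hsum_def shift_lin shift_h sum_subtractf by simp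
  also have "\<dots> = hsum \<theta> - 2 * of_bool (j = ix1)"
    by (auto simp: of_bool_def sum_negf)
  finally show ?thesis .
qed

lemma shift_commutator: "x i * u = u * x i + c \<Longrightarrow> shift i u = u + c * y i"
  by (simp add: shift_def distrib_right mult.assoc xy)

lemma shift_P:
  "k \<in> ixs \<or> l \<in> ixs \<or> k = l \<Longrightarrow> shift ix1 (P k l) = P k l"
  "j \<in> ixs \<Longrightarrow> shift j (P k l) = P k l + (of_bool (j = k) * P ix1 l + of_bool (j = l) * P ix1 k) * y j"
  using shift_commutator[of ix1 "P k l" 0] shift_commutator[of j "P k l" "of_bool (j = k) * P ix1 l + of_bool (j = l) * P ix1 k"]
  by (auto simp: x_ix1 x_ixs PP DP)

lemma shift_D:
  "j \<in> ixs \<Longrightarrow> i \<in> ixs \<Longrightarrow> shift ix1 (D i j) = D i j"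
  "i \<in> ixs \<Longrightarrow> shift ix1 (D i ix1) = D i ix1 - 2 * P i ix1 * y ix1"
  "i \<in> ixs \<Longrightarrow> j \<in> ixs \<Longrightarrow> k \<in> ixs \<Longrightarrow> shift k (D i j) = D i j + of_bool (k = i) * x j * y k"
  "i \<in> ixs \<Longrightarrow> k \<in> ixs \<Longrightarrow> shift k (D i ix1) = D i ix1 + (of_bool (k = i) * h ix1 - D i k) * y k"
proof -
  show "shift ix1 (D i j) = D i j" if "j \<in> ixs" "i \<in> ixs"
    using shift_commutator[of ix1 "D i j" 0] DP[of i j ix1 ix1] that by (auto simp: x_ix1 ixs_def)
  show "shift ix1 (D i ix1) = D i ix1 - 2 * P i ix1 * y ix1" if "i \<in> ixs"
    using shift_commutator[of ix1 "D i ix1" "- 2 * P i ix1"] DP[of i ix1 ix1 ix1]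
    by (auto simp: x_ix1 mult_2 distrib_right left_diff_distrib)
  show "shift k (D i j) = D i j + of_bool (k = i) * x j * y k" if "i \<in> ixs" "j \<in> ixs" "k \<in> ixs"
    using shift_commutator[of k "D i j" "of_bool (k = i) * x j"] DD[of ix1 k i j] that
    by (auto simp: x_ixs) (auto simp: ixs_def)
  show "shift k (D i ix1) = D i ix1 + (of_bool (k = i) * h ix1 - D i k) * y k" if "i \<in> ixs" "k \<in> ixs"
    using shift_commutator[of k "D i ix1" "of_bool (k = i) * h ix1 - D i k"] DD[of ix1 k i ix1] that
    by (auto simp: x_ixs D_diag)
qed

lemma shift_N:
  "k \<in> ixs \<Longrightarrow> l \<in> ixs \<Longrightarrow> shift j (N k l) = N k l"
  "k \<in> ixs \<Longrightarrow> shift ix1 (N ix1 k) = N ix1 k + 2 * x k * y ix1"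
  "k \<in> ixs \<Longrightarrow> j \<in> ixs \<Longrightarrow> shift j (N ix1 k) = N ix1 k - N j k * y j"
  "shift ix1 (N ix1 ix1) = N ix1 ix1 + 4 * h ix1 * y ix1"
  "j \<in> ixs \<Longrightarrow> shift j (N ix1 ix1) = N ix1 ix1 - 2 * N ix1 j * y j"
proof -
  show "shift j (N k l) = N k l" if "k \<in> ixs" "l \<in> ixs"
  proof (cases "j = ix1")
    case True
    then show ?thesis
      using shift_commutator[of ix1 "N k l" 0] PN[of ix1 ix1 k l] that by (auto simp: x_ix1 ixs_def)
  next
    case False
    then show ?thesis
      using shift_commutator[of j "N k l" 0] DN[of ix1 j k l] that by (auto simp: x_def ixs_def)
  qed
  show "shift ix1 (N ix1 k) = N ix1 k + 2 * x k * y ix1" if "k \<in> ixs"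
    using shift_commutator[of ix1 "N ix1 k" "2 * x k"] PN[of ix1 ix1 ix1 k] that
    by (auto simp: x_ix1 x_ixs mult_2) (auto simp: ixs_def)
  show "shift j (N ix1 k) = N ix1 k - N j k * y j" if "k \<in> ixs" "j \<in> ixs"
    using shift_commutator[of j "N ix1 k" "- N j k"] DN[of ix1 j ix1 k] that
    by (auto simp: x_ixs) (auto simp: ixs_def)
  show "shift ix1 (N ix1 ix1) = N ix1 ix1 + 4 * h ix1 * y ix1"
    using shift_commutator[of ix1 "N ix1 ix1" "4 * h ix1"] PN[of ix1 ix1 ix1 ix1]
    using distrib_right[of 2 2 "h ix1"] by (auto simp: x_ix1 D_diag mult_2 add_ac distrib_right)
  show "shift j (N ix1 ix1) = N ix1 ix1 - 2 * N ix1 j * y j" if "j \<in> ixs"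
    using shift_commutator[of j "N ix1 ix1" "- 2 * N ix1 j"] DN[of ix1 j ix1 ix1] that N_sym[of j ix1]
    by (auto simp: x_ixs mult_2 distrib_right left_diff_distrib)
qed

lemma ixs_ne: "k \<in> ixs \<Longrightarrow> k \<noteq> ix1" and ix1_ne: "k \<in> ixs \<Longrightarrow> ix1 \<noteq> k"
  by (auto simp: ixs_def)

lemma hat_diff_diag: "hat_diff k k = h k"
  by (simp add: hat_diff_def D_diag mult.assoc xy)

text \<open>The action of the shifts on the hats. It lowers a degree, from \<open>hat_neg11\<close> through \<open>hat_neg1\<close> to the
invariant \<open>hat_neg\<close>, for example: each \<open>A\<^sub>\<alpha>\<close> is a Newton expansion that corrects the hat of \<open>X\<^sub>\<alpha>\<close> by its
first and second differences, multiplied by polynomials in the \<open>h\<^sub>i\<close>.\<close>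
lemma shift_hat_pos1: "k \<in> ixs \<Longrightarrow> shift j (hat_pos1 k) = hat_pos1 k + of_bool (j = k)"
proof (cases "j = ix1")
  case False
  moreover assume "k \<in> ixs"
  moreover have "P ix1 ix1 * (y k * (x k * y ix1)) = 1"
    by (simp add: yx_assoc x_ix1[symmetric] xy)
  ultimately show ?thesis
    by (auto simp: hat_pos1_def shift_mult shift_x shift_y shift_P ixs_def distrib_right mult.assoc)
next
  case True
  moreover assume "k \<in> ixs"
  ultimately show ?thesis
    by (auto simp: hat_pos1_def shift_mult shift_x shift_y shift_P dest: ixs_ne)
qed

lemma shift_hat_diff:
  assumes "i \<in> ixs" "j \<in> ixs"
  shows "shift k (hat_diff i j) = hat_diff i j + of_bool (k = i)"
proof (cases "k = ix1")
  case False
  moreover have "x j * (y i * (x i * y j)) = 1"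
    by (simp add: yx_assoc xy)
  ultimately show ?thesis using assms
    by (auto simp: hat_diff_def shift_mult shift_x shift_y shift_D ixs_def distrib_right mult.assoc)
next
  case True
  then show ?thesis using assms
    by (auto simp: hat_diff_def shift_mult shift_x shift_y shift_D dest: ixs_ne)
qed

lemma shift_hat_neg: "k \<in> ixs \<Longrightarrow> l \<in> ixs \<Longrightarrow> shift j (hat_neg k l) = hat_neg k l"
  by (simp add: hat_neg_def shift_mult shift_x shift_y shift_N)

lemma shift_hat_pos:
  assumes "k \<in> ixs" "l \<in> ixs"
  shows "shift j (hat_pos k l) = hat_pos k l + of_bool (j = k) * hat_pos1 l + of_bool (j = l) * hat_pos1 k"
proof (cases "j = ix1")
  case False
  have 1: "P ix1 l * y k * x k * x l * y ix1 = hat_pos1 l"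
    using P_sym[of ix1 l] by (simp add: hat_pos1_def mult.assoc yx_assoc)
  have 2: "P ix1 k * y l * x k * x l * y ix1 = hat_pos1 k"
    using P_sym[of ix1 k] by (simp add: hat_pos1_def mult.assoc xx[of k] xx_left[of k] yx_assoc)
  show ?thesis using False assms 1 2
    by (auto simp: hat_pos_def shift_mult shift_x shift_y shift_P ixs_def distrib_right)
next
  case True
  then show ?thesis using assms
    by (auto simp: hat_pos_def shift_mult shift_x shift_y shift_P dest: ixs_ne)
qed

lemma shift_hat_neg1:
  assumes "k \<in> ixs"
  shows "shift j (hat_neg1 k) = hat_neg1 k + (if j = ix1 then 2 else - hat_neg j k)"
proof (cases "j = ix1")
  case False
  have 1: "N j k * y j * y k * x ix1 = hat_neg j k"
    by (simp add: hat_neg_def mult.assoc)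
  show ?thesis using False assms 1
    by (auto simp: hat_neg1_def shift_mult shift_x shift_y shift_N ixs_def left_diff_distrib)
next
  case True
  have "2 * x k * y ix1 * y k * x ix1 = 2"
    by (simp only: mult.assoc yy_left[of ix1 k] xy_assoc xy yx mult_1_right)
  then show ?thesis using True assms
    by (auto simp: hat_neg1_def shift_mult shift_x shift_y shift_N distrib_right)
qed

lemma shift_hat_neg11: "shift j hat_neg11 = hat_neg11 + (if j = ix1 then 4 * h ix1 else - 2 * hat_neg1 j)"
proof (cases "j = ix1")
  case False
  then show ?thesis
    by (auto simp: hat_neg11_def hat_neg1_def shift_mult shift_x shift_y shift_N ixs_def left_diff_distrib mult.assoc)
next
  case True
  then show ?thesis
    by (auto simp: hat_neg11_def shift_mult shift_x shift_y shift_N distrib_right mult.assoc yx)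
qed

lemma shift_hat_diff1:
  assumes "k \<in> ixs"
  shows "shift j (hat_diff1 k) = hat_diff1 k + (if j = ix1 then - 2 * hat_pos1 k else of_bool (j = k) * h ix1 - hat_diff k j)"
proof (cases "j = ix1")
  case False
  have 1: "h ix1 * y k * x k = h ix1"
    by (simp add: mult.assoc yx)
  have 2: "D k j * y j * x k = hat_diff k j"
    by (simp add: hat_diff_def mult.assoc yx_comm)
  show ?thesis using False assms 1 2
    by (auto simp: hat_diff1_def shift_mult shift_x shift_y shift_D ixs_def left_diff_distrib distrib_right)
next
  case True
  have "2 * P k ix1 * y ix1 * x k = 2 * hat_pos1 k"
    by (simp add: hat_pos1_def mult.assoc yx_comm)
  then show ?thesis using True assms
    by (auto simp: hat_diff1_def shift_mult shift_x shift_y shift_D left_diff_distrib)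
qed

end

section \<open>The elements \<open>A\<^sub>\<alpha>\<close> lie in the centralizer\<close>

definition two_sided :: "'a::complex_algebra_1 set \<Rightarrow> bool" where
  "two_sided J \<longleftrightarrow> csubspace J \<and> (\<forall>z\<in>J. \<forall>a. a * z \<in> J \<and> z * a \<in> J)"

definition cong_mod :: "'a::complex_algebra_1 set \<Rightarrow> 'a \<Rightarrow> 'a \<Rightarrow> bool" where
  "cong_mod J a b \<longleftrightarrow> a - b \<in> J"

lemma cong_mod_refl: "two_sided J \<Longrightarrow> cong_mod J a a"
  by (simp add: cong_mod_def two_sided_def csubspace_def)

lemma cong_mod_sym: "two_sided J \<Longrightarrow> cong_mod J a b \<Longrightarrow> cong_mod J b a"
  using csubspace_diff[of J 0 "a - b"] by (simp add: cong_mod_def two_sided_def csubspace_def)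

lemma cong_mod_trans: "two_sided J \<Longrightarrow> cong_mod J a b \<Longrightarrow> cong_mod J b c \<Longrightarrow> cong_mod J a c"
  unfolding cong_mod_def two_sided_def csubspace_def by (metis add.commute diff_add_cancel add_diff_eq)

lemma cong_mod_add: "two_sided J \<Longrightarrow> cong_mod J a b \<Longrightarrow> cong_mod J c d \<Longrightarrow> cong_mod J (a + c) (b + d)"
  unfolding cong_mod_def two_sided_def csubspace_def by (metis add_diff_add)

lemma cong_mod_diff: "two_sided J \<Longrightarrow> cong_mod J a b \<Longrightarrow> cong_mod J c d \<Longrightarrow> cong_mod J (a - c) (b - d)"
proof -
  assume "two_sided J" "cong_mod J a b" "cong_mod J c d"
  then have "(a - b) - (c - d) \<in> J" unfolding cong_mod_def two_sided_def by (blast intro: csubspace_diff)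
  then show ?thesis by (simp add: cong_mod_def algebra_simps)
qed

lemma cong_mod_mult: "two_sided J \<Longrightarrow> cong_mod J a b \<Longrightarrow> cong_mod J c d \<Longrightarrow> cong_mod J (a * c) (b * d)"
proof -
  assume J: "two_sided J" and "cong_mod J a b" "cong_mod J c d"
  then have "(a - b) * c + b * (c - d) \<in> J"
    unfolding cong_mod_def two_sided_def csubspace_def by blast
  then show ?thesis by (simp add: cong_mod_def algebra_simps)
qed

lemma cong_mod_sum: "two_sided J \<Longrightarrow> (\<And>i. i \<in> K \<Longrightarrow> cong_mod J (f i) (g i)) \<Longrightarrow> cong_mod J (sum f K) (sum g K)"
  unfolding cong_mod_def sum_subtractf[symmetric] two_sided_def by (blast intro: csubspace_sum)

lemmas cong_mod_intros = cong_mod_add cong_mod_diff cong_mod_mult cong_mod_sum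

lemma add_self: "a + a = scaleC 2 (a :: 'a::complex_algebra_1)"
  using scaleC_add_left[of 1 1 a] by (simp add: scaleC_one)

lemma sum_of_bool_select: "finite K \<Longrightarrow> j \<in> K \<Longrightarrow> (\<Sum>k\<in>K. f k * of_bool (j = k)) = (f j :: 'a::ring_1)"
  "finite K \<Longrightarrow> j \<in> K \<Longrightarrow> (\<Sum>k\<in>K. of_bool (j = k) * f k) = (f j :: 'a::ring_1)"
proof -
  assume "finite K" "j \<in> K"
  moreover have "f k * of_bool (j = k) = (if j = k then f k else 0)"
    "of_bool (j = k) * f k = (if j = k then f k else 0)" for k by auto
  ultimately show "(\<Sum>k\<in>K. f k * of_bool (j = k)) = f j" "(\<Sum>k\<in>K. of_bool (j = k) * f k) = f j"
    by simp_all
qed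

context localized_sp
begin

lemma ix1_notin [simp]: "ix1 \<notin> ixs"
  by (simp add: ixs_def)

lemma rinv_x: "rinv (P ix1 ix1) = y ix1" "k \<in> ixs \<Longrightarrow> rinv (D ix1 k) = y k"
  by (simp_all add: y_def x_ix1 x_ixs)

lemma hat_neg_sym: "hat_neg k l = hat_neg l k"
  using N_sym[of k l] by (simp add: hat_neg_def mult.assoc yy_left[of k l])

lemma has_weight_move: "has_weight u a \<Longrightarrow> h i * u = u * (h i + of_int (a i))"
  unfolding has_weight_def distrib_left mult_of_int_commute[symmetric] by simp

lemma h_x: "k \<in> ixs \<Longrightarrow> l \<in> ixs \<Longrightarrow> h k * x l = x l * (h k - of_bool (k = l))"
  "k \<in> ixs \<Longrightarrow> l \<in> ixs \<Longrightarrow> h k * y l = y l * (h k + of_bool (k = l))"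
  "k \<in> ixs \<Longrightarrow> h k * x ix1 = x ix1 * h k"
  "k \<in> ixs \<Longrightarrow> h k * y ix1 = y ix1 * h k"
  using has_weight_move[OF has_weight_x[of l], of k] has_weight_move[OF has_weight_y[of l], of k]
    has_weight_move[OF has_weight_x[of ix1], of k] has_weight_move[OF has_weight_y[of ix1], of k]
  by (auto simp: ixs_def)

lemma shift_fixed_iff: "shift i u = u \<longleftrightarrow> x i * u = u * x i"
proof
  assume "shift i u = u"
  then have "x i * u * (y i * x i) = u * x i" by (simp only: shift_def mult.assoc[symmetric])
  then show "x i * u = u * x i" by (simp add: yx)
next
  assume "x i * u = u * x i"
  then show "shift i u = u" by (simp add: shift_def mult.assoc xy)
qed

lemma shift_move: "shift i u = shift_u \<Longrightarrow> x i * u = shift_u * x i"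
  by (auto simp: shift_def mult.assoc yx)

lemma hsum_x: "hsum \<theta> * x k = x k * (hsum \<theta> + 2 * of_bool (k = ix1))"
  and hsum_y: "hsum \<theta> * y k = y k * (hsum \<theta> - 2 * of_bool (k = ix1))"
proof -
  have *: "x k * hsum \<theta> = (hsum \<theta> - 2 * of_bool (k = ix1)) * x k"
    by (rule shift_move) (rule shift_I)
  then show "hsum \<theta> * x k = x k * (hsum \<theta> + 2 * of_bool (k = ix1))"
    by (auto simp: left_diff_distrib distrib_left mult_2 mult_2_right distrib_right)
  have "y k * (hsum \<theta> - 2 * of_bool (k = ix1)) = y k * ((hsum \<theta> - 2 * of_bool (k = ix1)) * x k) * y k"
    by (simp add: mult.assoc xy)
  also have "\<dots> = hsum \<theta> * y k" by (simp add: *[symmetric] mult.assoc[symmetric] yx)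
  finally show "hsum \<theta> * y k = y k * (hsum \<theta> - 2 * of_bool (k = ix1))" ..
qed

text \<open>The elements \<open>A\<^sub>\<alpha>\<close> in terms of hats. Moving the \<open>h\<^sub>i\<close> to the right of the monomials produces the
additional constants.\<close>
lemma A_pos1_eq: "k \<in> ixs \<Longrightarrow> A_pos1 \<theta> k = hat_pos1 k - h k"
  by (simp add: A_pos1_def hat_pos1_def rinv_x x_ixs)

lemma A_pos_eq:
  assumes "k \<in> ixs" "l \<in> ixs"
  shows "A_pos \<theta> k l = hat_pos k l - hat_pos1 l * (h k - of_bool (k = l)) - hat_pos1 k * (h l - of_bool (k = l))
    + h l * (h k - of_bool (k = l))"
proof -
  have *: "P ix1 l * h k * D ix1 l * y ix1 = hat_pos1 l * (h k - of_bool (k = l))" if "k \<in> ixs" "l \<in> ixs" for k l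
  proof -
    have "P ix1 l * h k * D ix1 l * y ix1 = P ix1 l * ((h k * x l) * y ix1)"
      using that by (simp add: x_ixs mult.assoc)
    also have "\<dots> = P ix1 l * (x l * (h k * y ix1 - of_bool (k = l) * y ix1))"
      using that by (simp only: h_x mult.assoc left_diff_distrib)
    also have "\<dots> = hat_pos1 l * (h k - of_bool (k = l))"
      using that P_sym[of ix1 l] by (auto simp: h_x hat_pos1_def mult.assoc right_diff_distrib)
    finally show ?thesis .
  qed
  show ?thesis
    using *[OF assms] *[OF assms(2,1)] assms
    by (auto simp: A_pos_def rinv_x hat_pos_def x_ixs eq_commute[of l k])
qed

lemma A_diff_eq: "i \<in> ixs \<Longrightarrow> j \<in> ixs \<Longrightarrow> A_diff \<theta> i j = hat_diff i j - h i"
  by (simp add: A_diff_def hat_diff_def rinv_x x_ixs)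

lemma A_diff1_eq:
  assumes "k \<in> ixs"
  shows "A_diff1 \<theta> k = hat_diff1 k + (\<Sum>j\<in>ixs - {k}. hat_diff k j * h j) + h k * (h k - 1) - hat_pos1 k * hsum \<theta>"
proof -
  have 1: "D k j * (h j - 1) * D ix1 k * rinv (D ix1 j) = hat_diff k j * h j" if "j \<in> ixs - {k}" for j
  proof -
    have "(h j - 1) * x k * y j = x k * y j * h j"
      using that assms by (simp add: left_diff_distrib h_x mult.assoc) (simp add: h_x distrib_left right_diff_distrib)
    then show ?thesis using that assms by (simp add: x_ixs[symmetric] y_def[symmetric] hat_diff_def mult.assoc)
  qed
  have 2: "P k ix1 * (hsum \<theta> + 2) * D ix1 k * y ix1 = hat_pos1 k * hsum \<theta>"
  proof -
    have "(hsum \<theta> + 2) * x k * y ix1 = x k * y ix1 * hsum \<theta>"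
      using assms by (simp add: distrib_right hsum_x ixs_ne mult.assoc mult_2)
        (simp add: hsum_y distrib_left right_diff_distrib mult_2 mult_2_right)
    then show ?thesis using assms by (simp add: x_ixs[symmetric] hat_pos1_def mult.assoc)
  qed
  show ?thesis
    using assms by (simp add: A_diff1_def 1 rinv_x(1) 2 hat_diff1_def x_ixs)
qed

lemma A_neg_eq: "k \<in> ixs \<Longrightarrow> l \<in> ixs \<Longrightarrow> A_neg \<theta> k l = hat_neg k l"
  by (simp add: A_neg_def hat_neg_def rinv_x x_ix1)

lemma h_yyx:
  assumes "i \<in> ixs" "k \<in> ixs" "l \<in> ixs"
  shows "h i * (y k * (y l * x ix1)) = y k * (y l * (x ix1 * (h i + of_bool (i = k) + of_bool (i = l))))"
proof -
  have *: "h i * (y l * u) = y l * (h i * u + of_bool (i = l) * u)" if "i \<in> ixs" "l \<in> ixs" for i l u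
    using that by (simp only: mult.assoc[symmetric] h_x) (simp only: mult.assoc distrib_right)
  show ?thesis
    using assms by (cases "i = k"; cases "i = l"; simp add: * h_x distrib_left distrib_right)
qed

lemma A_neg1_eq:
  assumes "k \<in> ixs"
  shows "A_neg1 \<theta> k = hat_neg1 k + (\<Sum>l\<in>ixs. hat_neg k l * (h l + 1 + of_bool (k = l))) + hsum \<theta>"
proof -
  have "N k l * h l * rinv (D ix1 k) * rinv (D ix1 l) * P ix1 ix1 = hat_neg k l * (h l + 1 + of_bool (k = l))"
    if "l \<in> ixs" for l
    using that assms h_yyx[of l k l]
    by (auto simp: rinv_x x_ix1[symmetric] hat_neg_def mult.assoc add_ac)
  then show ?thesis
    using assms by (simp add: A_neg1_def hat_neg1_def rinv_x x_ix1)
qed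

text \<open>After moving to the right, \<open>h\<^sub>k\<close> occurs in \<open>A\<^bsub>- 2 \<epsilon>\<^sub>1\<^esub>\<close> always through \<open>h\<^sub>k + 1\<close>; in this variable the
formula has the shape of a Newton expansion of degree two.\<close>
abbreviation h_succ :: "'n \<Rightarrow> 'q" where "h_succ k \<equiv> h k + 1"

lemma A_neg11_eq:
  "A_neg11 \<theta> = hat_neg11 + (\<Sum>k\<in>ixs. 2 * hat_neg1 k * h_succ k) + (\<Sum>k\<in>ixs. \<Sum>l\<in>ixs. hat_neg k l * (h_succ k * h_succ l))
    + (\<Sum>k\<in>ixs. hat_neg k k * h_succ k) + (hsum \<theta> + 2 * of_nat (CARD('n))) * hsum \<theta>"
proof -
  have 1: "2 * N ix1 k * h k * rinv (D ix1 k) * P ix1 ix1 = 2 * hat_neg1 k * h_succ k" if "k \<in> ixs" for k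
  proof -
    have "h k * (y k * x ix1) = y k * (x ix1 * h_succ k)"
      using that by (simp add: mult.assoc[symmetric] h_x) (simp add: mult.assoc h_x distrib_left distrib_right)
    then show ?thesis using that by (simp add: rinv_x x_ix1[symmetric] hat_neg1_def mult.assoc)
  qed
  have 2: "N k k * h k * (rinv (D ix1 k))\<^sup>2 * P ix1 ix1 = hat_neg k k * (h_succ k + 1)" if "k \<in> ixs" for k
    using that h_yyx[of k k k]
    by (simp add: rinv_x x_ix1[symmetric] hat_neg_def mult.assoc power2_eq_square add.assoc)
  have 3: "N k l * h k * h l * rinv (D ix1 k) * rinv (D ix1 l) * P ix1 ix1
      = hat_neg k l * (h_succ k * h_succ l) + hat_neg k l * (of_bool (k = l) * (h_succ k + h_succ k + 1))" if "k \<in> ixs" "l \<in> ixs" for k l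
  proof -
    have "N k l * h k * h l * rinv (D ix1 k) * rinv (D ix1 l) * P ix1 ix1
        = N k l * (h k * (h l * (y k * (y l * x ix1))))"
      using that by (simp add: rinv_x x_ix1[symmetric] mult.assoc)
    also have "h l * (y k * (y l * x ix1)) = y k * (y l * x ix1) * (h_succ l + of_bool (k = l))"
      using that by (subst h_yyx) (auto simp: mult.assoc add_ac)
    also have "h k * (y k * (y l * x ix1) * (h_succ l + of_bool (k = l)))
        = h k * (y k * (y l * x ix1)) * (h_succ l + of_bool (k = l))" by (simp only: mult.assoc)
    also have "h k * (y k * (y l * x ix1)) = y k * (y l * x ix1) * (h_succ k + of_bool (k = l))"
      using that by (subst h_yyx) (auto simp: mult.assoc add_ac)
    finally show ?thesis
      by (auto simp: hat_neg_def mult.assoc distrib_left distrib_right add_ac)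
  qed
  have "(\<Sum>k\<in>ixs. \<Sum>l\<in>ixs. N k l * h k * h l * rinv (D ix1 k) * rinv (D ix1 l) * P ix1 ix1)
    = (\<Sum>k\<in>ixs. \<Sum>l\<in>ixs. hat_neg k l * (h_succ k * h_succ l)) + (\<Sum>k\<in>ixs. hat_neg k k * (h_succ k + h_succ k + 1))"
  proof -
    have "(\<Sum>l\<in>ixs. hat_neg k l * (of_bool (k = l) * (h_succ k + h_succ k + 1))) = hat_neg k k * (h_succ k + h_succ k + 1)" if "k \<in> ixs" for k
      using that sum_of_bool_select(1)[of ixs k "\<lambda>l. hat_neg k l"]
      by (simp only: mult.assoc[symmetric] sum_distrib_right[symmetric] finite)
    then show ?thesis by (simp add: 3 sum.distrib)
  qed
  moreover have "hat_neg k k * (h_succ k + h_succ k + 1) = hat_neg k k * h_succ k + hat_neg k k * (h_succ k + 1)" for k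
    by (simp only: distrib_left[symmetric] add.assoc)
  ultimately show ?thesis
    by (simp add: A_neg11_def 1 2 sum.distrib del: distrib_left)
       (simp add: hat_neg11_def x_ix1 rinv_x)
qed

lemma C_alg_iff: "u \<in> C_alg \<theta> \<longleftrightarrow> u \<in> centralizer (range h) \<and> (\<forall>i. shift i u = u)"
proof -
  have y: "u * y i = y i * u" if "u * x i = x i * u" for i
    unfolding y_def using commute_rinv[OF x_invertible that[symmetric]] by simp
  have "u \<in> C_alg \<theta> \<longleftrightarrow> (\<forall>i. u * h i = h i * u) \<and> (\<forall>k\<in>ixs. u * x k = x k * u \<and> u * y k = y k * u)
      \<and> u * x ix1 = x ix1 * u \<and> u * y ix1 = y ix1 * u"
    unfolding C_alg_def B_alg_def centralizer_hull_iff
    by (auto simp: x_ixs rinv_x x_ix1)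
  also have "\<dots> \<longleftrightarrow> (\<forall>i. u * h i = h i * u) \<and> (\<forall>i. u * x i = x i * u)"
    using y by (metis DiffI UNIV_I ixs_def singletonD)
  finally show ?thesis by (auto simp: mem_centralizer_range shift_fixed_iff)
qed

lemma centralizer_closed:
  "u \<in> centralizer (range h) \<Longrightarrow> u' \<in> centralizer (range h) \<Longrightarrow> u + u' \<in> centralizer (range h)"
  "u \<in> centralizer (range h) \<Longrightarrow> u' \<in> centralizer (range h) \<Longrightarrow> u - u' \<in> centralizer (range h)"
  "u \<in> centralizer (range h) \<Longrightarrow> u' \<in> centralizer (range h) \<Longrightarrow> u * u' \<in> centralizer (range h)"
  "(\<And>k. k \<in> K \<Longrightarrow> f k \<in> centralizer (range h)) \<Longrightarrow> sum f K \<in> centralizer (range h)"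
  "of_nat z \<in> centralizer (range h)" "numeral num \<in> centralizer (range h)" "1 \<in> centralizer (range h)"
  "of_bool Q \<in> centralizer (range h)"
proof -
  note s = subalgebra_centralizer[of "range h"] subalgebra_csubspace[OF subalgebra_centralizer[of "range h"]]
  show one: "1 \<in> centralizer (range h)" using s by (simp add: subalgebra_def)
  show nat: "of_nat z \<in> centralizer (range h)" for z
    using csubspace_of_nat[OF s(2) one, of z] by simp
  show "numeral num \<in> centralizer (range h)" using nat[of "numeral num"] by simp
  show "of_bool Q \<in> centralizer (range h)" using one s(2) by (cases Q) (auto simp: csubspace_def)
  show "sum f K \<in> centralizer (range h)" if "\<And>k. k \<in> K \<Longrightarrow> f k \<in> centralizer (range h)"
    using csubspace_sum[OF s(2)] that by blast
qed (use subalgebra_centralizer[of "range h"] subalgebra_csubspace[OF subalgebra_centralizer[of "range h"]]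
      csubspace_diff in \<open>auto simp: subalgebra_def\<close>)

lemma hsum_weight_zero: "hsum \<theta> \<in> centralizer (range h)"
  unfolding hsum_def by (intro centralizer_closed h_weight_zero)

lemma A_pos1_mem: "k \<in> ixs \<Longrightarrow> A_pos1 \<theta> k \<in> C_alg \<theta>"
  unfolding C_alg_iff
  by (auto simp: A_pos1_eq shift_lin shift_hat_pos1 shift_h ixs_ne
      intro!: centralizer_closed hats_weight_zero h_weight_zero)

lemma A_pos_mem: "k \<in> ixs \<Longrightarrow> l \<in> ixs \<Longrightarrow> A_pos \<theta> k l \<in> C_alg \<theta>"
proof -
  assume k: "k \<in> ixs" and l: "l \<in> ixs"
  have "shift i (A_pos \<theta> k l) = A_pos \<theta> k l" for i
    using k l
    by (cases "i = ix1"; cases "i = k"; cases "i = l")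
       (auto simp: A_pos_eq shift_lin shift_mult shift_hat_pos1 shift_hat_pos shift_h ixs_ne algebra_simps of_bool_def)
  then show ?thesis
    using k l unfolding C_alg_iff
    by (auto simp: A_pos_eq intro!: centralizer_closed hats_weight_zero h_weight_zero)
qed

lemma A_diff_mem: "i \<in> ixs \<Longrightarrow> j \<in> ixs \<Longrightarrow> A_diff \<theta> i j \<in> C_alg \<theta>"
  unfolding C_alg_iff
  by (auto simp: A_diff_eq shift_lin shift_hat_diff shift_h ixs_ne
      intro!: centralizer_closed hats_weight_zero h_weight_zero)

lemma A_neg_mem: "k \<in> ixs \<Longrightarrow> l \<in> ixs \<Longrightarrow> A_neg \<theta> k l \<in> C_alg \<theta>"
  unfolding C_alg_iff by (simp add: A_neg_eq shift_hat_neg hats_weight_zero)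

lemma hsum_split: "hsum \<theta> = h ix1 + (\<Sum>k\<in>ixs. h k)"
  unfolding hsum_def ixs_def by (rule sum.remove) auto

lemma A_diff1_mem: "k \<in> ixs \<Longrightarrow> A_diff1 \<theta> k \<in> C_alg \<theta>"
proof -
  assume k: "k \<in> ixs"
  let ?K = "ixs - {k}"
  have hat_diff: "(\<Sum>j\<in>?K. shift i (hat_diff k j * h j)) = (\<Sum>j\<in>?K. hat_diff k j * h j) + (\<Sum>j\<in>?K. of_bool (i = k) * h j)
      + (\<Sum>j\<in>?K. of_bool (i = j) * hat_diff k j)" for i
    using k unfolding sum.distrib[symmetric]
    by (intro sum.cong) (auto simp: shift_mult shift_hat_diff shift_h ixs_ne distrib_left distrib_right)
  have tsel: "(\<Sum>j\<in>?K. of_bool (i = j) * hat_diff k j) = of_bool (i \<in> ixs) * (hat_diff k i - of_bool (i = k) * h k)" for i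
  proof (cases "i \<in> ?K")
    case True
    then show ?thesis by (simp add: sum_of_bool_select(2))
  next
    case False
    then have "(\<Sum>j\<in>?K. of_bool (i = j) * hat_diff k j) = 0" by (intro sum.neutral) auto
    then show ?thesis using False by (auto simp: hat_diff_diag)
  qed
  have I: "hsum \<theta> = h ix1 + (h k + (\<Sum>j\<in>?K. h j))"
    unfolding hsum_split using k by (subst sum.remove[of ixs k]) auto
  have "shift i (A_diff1 \<theta> k) = A_diff1 \<theta> k" for i
  proof -
    consider "i = ix1" | "i = k" "i \<noteq> ix1" | "i \<in> ixs" "i \<noteq> k" by (auto simp: ixs_def)
    then show ?thesis
    proof cases
      case 1
      then show ?thesis using k
        by (simp add: A_diff1_eq shift_lin hat_diff tsel) (simp add: shift_mult shift_lin shift_hat_diff1 shift_hat_pos1 shift_h shift_I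
            ixs_ne ix1_ne algebra_simps mult_2 mult_2_right)
    next
      case 2
      then show ?thesis using k
        by (simp add: A_diff1_eq shift_lin hat_diff tsel) (simp add: shift_mult shift_lin shift_hat_diff1 shift_hat_pos1 shift_h shift_I
            ixs_ne ix1_ne algebra_simps hat_diff_diag, simp add: I)
    next
      case 3
      then show ?thesis using k
        by (simp add: A_diff1_eq shift_lin hat_diff tsel) (simp add: shift_mult shift_lin shift_hat_diff1 shift_hat_pos1 shift_h shift_I
            ixs_ne ix1_ne algebra_simps)
    qed
  qed
  then show ?thesis
    using k unfolding C_alg_iff
    by (auto simp: A_diff1_eq intro!: centralizer_closed hats_weight_zero h_weight_zero hsum_weight_zero)
qed

lemma A_neg1_mem: "k \<in> ixs \<Longrightarrow> A_neg1 \<theta> k \<in> C_alg \<theta>"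
proof -
  assume k: "k \<in> ixs"
  have "shift i (A_neg1 \<theta> k) = A_neg1 \<theta> k" for i
  proof (cases "i = ix1")
    case True
    have "(\<Sum>l\<in>ixs. shift i (hat_neg k l * (h l + 1 + of_bool (k = l)))) = (\<Sum>l\<in>ixs. hat_neg k l * (h l + 1 + of_bool (k = l)))"
      using k True by (intro sum.cong) (auto simp: shift_mult shift_hat_neg shift_lin shift_h ixs_ne of_bool_def)
    then show ?thesis using k True
      by (simp add: A_neg1_eq shift_lin shift_hat_neg1 shift_I)
  next
    case False
    then have i: "i \<in> ixs" by (simp add: ixs_def)
    have "(\<Sum>l\<in>ixs. shift i (hat_neg k l * (h l + 1 + of_bool (k = l))))
        = (\<Sum>l\<in>ixs. hat_neg k l * (h l + 1 + of_bool (k = l))) + (\<Sum>l\<in>ixs. hat_neg k l * of_bool (i = l))"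
      using k i unfolding sum.distrib[symmetric]
      by (intro sum.cong) (auto simp: shift_mult shift_hat_neg shift_lin shift_h ixs_ne of_bool_def algebra_simps)
    also have "(\<Sum>l\<in>ixs. hat_neg k l * of_bool (i = l)) = hat_neg i k"
      using i by (simp add: sum_of_bool_select hat_neg_sym)
    finally show ?thesis using k False
      by (simp add: A_neg1_eq shift_lin shift_hat_neg1 shift_I)
  qed
  then show ?thesis
    using k unfolding C_alg_iff
    by (auto simp: A_neg1_eq intro!: centralizer_closed hats_weight_zero h_weight_zero hsum_weight_zero)
qed

lemma four: "4 * u = u + u + u + (u :: 'q)"
  using distrib_right[of 2 2 u] by (simp add: mult_2 add.assoc)

lemma CARD_ixs: "CARD('n) = Suc (card (ixs :: 'n set))"
  unfolding ixs_def by (rule card.remove) auto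

lemma sum_h_succ: "(\<Sum>k\<in>ixs. h_succ k) = hsum \<theta> - h ix1 + of_nat (CARD('n)) - 1"
  by (simp add: sum.distrib hsum_split CARD_ixs)

lemma sum_shifted_h:
  assumes "k \<in> ixs"
  shows "(\<Sum>l\<in>ixs. - 1 * (h l + 1 + of_bool (k = l))) = - (hsum \<theta> - h ix1 + of_nat (CARD('n)))"
  using sum_of_bool_select(1)[of ixs k "\<lambda>_. 1 :: 'q"] assms
  by (simp add: sum.distrib sum_subtractf sum_negf hsum_split CARD_ixs)

lemma shift_h_succ: "k \<in> ixs \<Longrightarrow> shift j (h_succ k) = h_succ k + of_bool (j = k)"
  by (auto simp: shift_lin shift_h ixs_ne)

text \<open>Under the shift by \<open>x\<^sub>1\<close> the linear terms combine with \<open>4 h\<^sub>1\<close> to cancel the change of the quadratic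
polynomial in \<open>I\<^sub>n = h\<^sub>1 + \<dots> + h\<^sub>n\<close>. Under the shift by \<open>x\<^sub>i\<close> with \<open>i \<noteq> 1\<close> the cancellation is that of a
second order Newton expansion, by the symmetry of \<open>hat_neg\<close>.\<close>
lemma A_neg11_mem: "A_neg11 \<theta> \<in> C_alg \<theta>"
proof -
  let ?n = "of_nat (CARD('n)) :: 'q"
  have dbl: "2 * (a + 2) * c = 2 * a * c + 4 * c" "2 * (a - e) * (c + d) = 2 * a * c - 2 * (e * c) + (2 * a - 2 * e) * d"
    for a c d e :: 'q
    by (simp_all add: algebra_simps)
  have nprod: "e * ((a + of_bool Q) * (c + of_bool R))
      = e * (a * c) + e * a * of_bool R + of_bool Q * (e * c) + of_bool Q * (e * of_bool R)" for a c e :: 'q and Q R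
    by (cases Q; simp add: algebra_simps)
  have "shift i (A_neg11 \<theta>) = A_neg11 \<theta>" for i
  proof (cases "i = ix1")
    case True
    have 1: "(\<Sum>k\<in>ixs. shift i (2 * hat_neg1 k * h_succ k)) = (\<Sum>k\<in>ixs. 2 * hat_neg1 k * h_succ k) + 4 * (hsum \<theta> - h ix1 + ?n - 1)"
    proof -
      have "shift i (2 * hat_neg1 k * h_succ k) = 2 * hat_neg1 k * h_succ k + 4 * h_succ k" if "k \<in> ixs" for k
      proof -
        have "shift i (2 * hat_neg1 k * h_succ k) = 2 * (hat_neg1 k + 2) * (h_succ k + of_bool (i = k))"
          using shift_hat_neg1[OF that, of i] True
          by (simp only: shift_mult shift_h_succ[OF that] shift_lin(8) simp_thms if_True)
        also have "\<dots> = 2 * (hat_neg1 k + 2) * h_succ k" using True that by auto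
        also have "\<dots> = 2 * hat_neg1 k * h_succ k + 4 * h_succ k" by (rule dbl)
        finally show ?thesis .
      qed
      then show ?thesis
        unfolding sum_h_succ[symmetric] sum_distrib_left sum.distrib[symmetric] by (rule sum.cong[OF refl])
    qed
    have 2: "(\<Sum>k\<in>ixs. \<Sum>l\<in>ixs. shift i (hat_neg k l * (h_succ k * h_succ l))) = (\<Sum>k\<in>ixs. \<Sum>l\<in>ixs. hat_neg k l * (h_succ k * h_succ l))"
      using True by (intro sum.cong refl) (auto simp only: shift_mult shift_h_succ shift_hat_neg, auto)
    have 3: "(\<Sum>k\<in>ixs. shift i (hat_neg k k * h_succ k)) = (\<Sum>k\<in>ixs. hat_neg k k * h_succ k)"
      using True by (intro sum.cong refl) (auto simp only: shift_mult shift_h_succ shift_hat_neg, auto)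
    have 4: "4 * h ix1 + 4 * (hsum \<theta> - h ix1 + ?n - 1) + (hsum \<theta> - 2 + 2 * ?n) * (hsum \<theta> - 2)
        = (hsum \<theta> + 2 * ?n) * hsum \<theta>"
      by (simp add: algebra_simps four mult_2 mult_2_right mult_of_nat_commute)
    have "shift i (A_neg11 \<theta>) = hat_neg11 + 4 * h ix1 + ((\<Sum>k\<in>ixs. 2 * hat_neg1 k * h_succ k) + 4 * (hsum \<theta> - h ix1 + ?n - 1))
        + (\<Sum>k\<in>ixs. \<Sum>l\<in>ixs. hat_neg k l * (h_succ k * h_succ l)) + (\<Sum>k\<in>ixs. hat_neg k k * h_succ k)
        + (hsum \<theta> - 2 + 2 * ?n) * (hsum \<theta> - 2)"
      unfolding A_neg11_eq shift_lin(1,7) 1 2 3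
      using True by (simp add: shift_mult shift_lin shift_I shift_hat_neg11)
    then show ?thesis unfolding A_neg11_eq 4[symmetric] by (simp only: add_ac)
  next
    case False
    then have i: "i \<in> ixs" by (simp add: ixs_def)
    have 1: "(\<Sum>k\<in>ixs. shift i (2 * hat_neg1 k * h_succ k)) = (\<Sum>k\<in>ixs. 2 * hat_neg1 k * h_succ k) - (\<Sum>k\<in>ixs. 2 * (hat_neg i k * h_succ k))
        + (\<Sum>k\<in>ixs. (2 * hat_neg1 k - 2 * hat_neg i k) * of_bool (i = k))"
    proof -
      have "shift i (2 * hat_neg1 k * h_succ k) = 2 * hat_neg1 k * h_succ k - 2 * (hat_neg i k * h_succ k) + (2 * hat_neg1 k - 2 * hat_neg i k) * of_bool (i = k)"
        if "k \<in> ixs" for k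
      proof -
        have "shift i (2 * hat_neg1 k * h_succ k) = 2 * (hat_neg1 k - hat_neg i k) * (h_succ k + of_bool (i = k))"
          using shift_hat_neg1[OF that, of i] False
          by (simp only: shift_mult shift_h_succ[OF that] shift_lin(8) simp_thms if_False add_uminus_conv_diff)
        then show ?thesis by (simp only: dbl)
      qed
      then show ?thesis
        unfolding sum.distrib[symmetric] sum_subtractf[symmetric] by (rule sum.cong[OF refl])
    qed
    have s1: "(\<Sum>k\<in>ixs. (2 * hat_neg1 k - 2 * hat_neg i k) * of_bool (i = k)) = 2 * hat_neg1 i - 2 * hat_neg i i"
      using i by (subst sum_of_bool_select) auto
    have 2: "(\<Sum>k\<in>ixs. \<Sum>l\<in>ixs. shift i (hat_neg k l * (h_succ k * h_succ l)))
       = (\<Sum>k\<in>ixs. \<Sum>l\<in>ixs. hat_neg k l * (h_succ k * h_succ l)) + (\<Sum>k\<in>ixs. \<Sum>l\<in>ixs. hat_neg k l * h_succ k * of_bool (i = l))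
        + (\<Sum>k\<in>ixs. \<Sum>l\<in>ixs. of_bool (i = k) * (hat_neg k l * h_succ l)) + (\<Sum>k\<in>ixs. \<Sum>l\<in>ixs. of_bool (i = k) * (hat_neg k l * of_bool (i = l)))"
      unfolding sum.distrib[symmetric]
      by (intro sum.cong refl) (simp only: shift_mult shift_h_succ shift_hat_neg nprod)
    have s2a: "(\<Sum>k\<in>ixs. \<Sum>l\<in>ixs. hat_neg k l * h_succ k * of_bool (i = l)) = (\<Sum>k\<in>ixs. hat_neg i k * h_succ k)"
      using i by (simp add: sum_of_bool_select(1)[OF _ i] hat_neg_sym[of i])
    have s2b: "(\<Sum>k\<in>ixs. \<Sum>l\<in>ixs. of_bool (i = k) * (hat_neg k l * h_succ l)) = (\<Sum>k\<in>ixs. hat_neg i k * h_succ k)"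
      by (simp only: sum_distrib_left[symmetric] sum_of_bool_select(2)[OF _ i] finite)
    have two4: "(\<Sum>k\<in>ixs. \<Sum>l\<in>ixs. of_bool (i = k) * (hat_neg k l * of_bool (i = l))) = hat_neg i i"
      by (simp only: sum_distrib_left[symmetric] sum_of_bool_select[OF _ i] finite)
    have 3: "(\<Sum>k\<in>ixs. shift i (hat_neg k k * h_succ k)) = (\<Sum>k\<in>ixs. hat_neg k k * h_succ k) + (\<Sum>k\<in>ixs. hat_neg k k * of_bool (i = k))"
      unfolding sum.distrib[symmetric]
      by (intro sum.cong refl) (simp only: shift_mult shift_h_succ shift_hat_neg distrib_left[of "hat_neg _ _" "h_succ _"])
    have s3: "(\<Sum>k\<in>ixs. hat_neg k k * of_bool (i = k)) = hat_neg i i"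
      by (simp only: sum_of_bool_select[OF _ i] finite)
    show ?thesis
      using False unfolding A_neg11_eq
      by (simp only: shift_lin(1,7) 1 s1 2 s2a s2b two4 3 s3)
         (simp add: shift_mult shift_lin shift_I shift_hat_neg11 mult_2 sum.distrib)
  qed
  then show ?thesis
    unfolding C_alg_iff
    by (auto simp: A_neg11_eq intro!: centralizer_closed hats_weight_zero h_weight_zero hsum_weight_zero)
qed

section \<open>The \<open>A\<^sub>\<alpha>\<close> and \<open>B\<close> generate the localization\<close>

definition A_set :: "'q set" where
  "A_set = A_pos1 \<theta> ` ixs \<union> (\<Union>k\<in>ixs. A_pos \<theta> k ` ixs) \<union> (\<Union>k\<in>ixs. A_neg \<theta> k ` ixs)
    \<union> {A_diff \<theta> i j | i j. i \<in> ixs \<and> j \<in> ixs \<and> i \<noteq> j} \<union> A_diff1 \<theta> ` ixs \<union> A_neg1 \<theta> ` ixs \<union> {A_neg11 \<theta>}"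

lemma A_setI:
  "k \<in> ixs \<Longrightarrow> A_pos1 \<theta> k \<in> A_set"
  "k \<in> ixs \<Longrightarrow> l \<in> ixs \<Longrightarrow> A_pos \<theta> k l \<in> A_set"
  "k \<in> ixs \<Longrightarrow> l \<in> ixs \<Longrightarrow> A_neg \<theta> k l \<in> A_set"
  "i \<in> ixs \<Longrightarrow> j \<in> ixs \<Longrightarrow> i \<noteq> j \<Longrightarrow> A_diff \<theta> i j \<in> A_set"
  "k \<in> ixs \<Longrightarrow> A_diff1 \<theta> k \<in> A_set"
  "k \<in> ixs \<Longrightarrow> A_neg1 \<theta> k \<in> A_set"
  "A_neg11 \<theta> \<in> A_set"
  by (auto simp: A_set_def)

lemma A_set_subset: "A_set \<subseteq> C_alg \<theta>"
  by (auto simp: A_set_def A_pos1_mem A_pos_mem A_neg_mem A_diff_mem A_diff1_mem A_neg1_mem A_neg11_mem)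

text \<open>The root vectors recovered from their hats, with the monomial of weight \<open>\<alpha>\<close> on the right.\<close>
lemma X_eq:
  "P k ix1 = hat_pos1 k * (x ix1 * y k)"
  "D i j = hat_diff i j * (y i * x j)"
  "N k l = hat_neg k l * (y ix1 * x k * x l)"
  "P k l = hat_pos k l * (x ix1 * y k * y l)"
  "N ix1 k = hat_neg1 k * (y ix1 * x k)"
  "N ix1 ix1 = hat_neg11 * y ix1"
  "D k ix1 = hat_diff1 k * y k"
proof -
  show "P k ix1 = hat_pos1 k * (x ix1 * y k)"
    by (simp add: hat_pos1_def mult.assoc yx_assoc xy)
  show "D i j = hat_diff i j * (y i * x j)"
    by (simp add: hat_diff_def mult.assoc yx_comm xy_assoc yx_left xy)
  show "N k l = hat_neg k l * (y ix1 * x k * x l)"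
  proof -
    have "y k * y l * x ix1 * (y ix1 * x k * x l) = y k * (y l * (x ix1 * (y ix1 * (x k * x l))))"
      by (simp only: mult.assoc)
    also have "\<dots> = y k * (y l * (x l * x k))" by (simp only: xy_assoc xx[of k l])
    also have "\<dots> = 1" by (simp add: yx_assoc yx)
    finally show ?thesis by (simp add: hat_neg_def mult.assoc)
  qed
  show "P k l = hat_pos k l * (x ix1 * y k * y l)"
  proof -
    have "x k * x l * y ix1 * (x ix1 * y k * y l) = x k * (x l * (y ix1 * (x ix1 * (y k * y l))))"
      by (simp only: mult.assoc)
    also have "\<dots> = x k * (x l * (y l * y k))" by (simp only: yx_assoc yy[of k l])
    also have "\<dots> = 1" by (simp add: xy_assoc xy)
    finally show ?thesis by (simp add: hat_pos_def mult.assoc)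
  qed
  show "N ix1 k = hat_neg1 k * (y ix1 * x k)"
    by (simp add: hat_neg1_def mult.assoc xy_assoc yx)
  show "N ix1 ix1 = hat_neg11 * y ix1"
    by (simp add: hat_neg11_def mult.assoc xy)
  show "D k ix1 = hat_diff1 k * y k"
    by (simp add: hat_diff1_def mult.assoc xy)
qed

text \<open>The formulas for the \<open>A\<^sub>\<alpha>\<close> are triangular in the hats, so they can be solved for the hats in the order
\<open>hat_pos1\<close>, \<open>hat_neg\<close>, \<open>hat_diff\<close>, \<open>hat_pos\<close>, \<open>hat_neg1\<close>, \<open>hat_neg11\<close>, \<open>hat_diff1\<close>. This gives all root
vectors; denominators are products of the \<open>x\<^sub>i\<close>, whose inverses belong to \<open>T\<close>.\<close>
theorem generated_by_A:
  assumes T: "subalgebra T" and A: "A_set \<subseteq> T" and h: "\<And>i. h i \<in> T"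
    and xT: "\<And>i. x i \<in> T" and yT: "\<And>i. y i \<in> T"
  shows "T = UNIV"
proof -
  have add: "\<And>a c. a \<in> T \<Longrightarrow> c \<in> T \<Longrightarrow> a + c \<in> T" and mult: "\<And>a c. a \<in> T \<Longrightarrow> c \<in> T \<Longrightarrow> a * c \<in> T"
    and one: "1 \<in> T"
    using T by (auto simp: subalgebra_def)
  have diff: "\<And>a c. a \<in> T \<Longrightarrow> c \<in> T \<Longrightarrow> a - c \<in> T"
    using csubspace_diff subalgebra_csubspace[OF T] by blast
  have sum: "\<And>f (K :: 'n set). (\<And>k. k \<in> K \<Longrightarrow> f k \<in> T) \<Longrightarrow> sum f K \<in> T"
    using csubspace_sum subalgebra_csubspace[OF T] by blast
  have nat: "of_nat z \<in> T" for z
    using csubspace_of_nat[OF subalgebra_csubspace[OF T] one, of z] by simp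
  have num: "2 \<in> T" using nat[of 2] by simp
  have bool: "of_bool Q \<in> T" for Q
    using nat[of 0] one by (cases Q) auto
  have I: "hsum \<theta> \<in> T" unfolding hsum_def by (intro sum h)
  note closed = add mult diff one sum num bool h I nat
  have wT: "hat_pos1 k \<in> T" if "k \<in> ixs" for k
  proof -
    have "hat_pos1 k = A_pos1 \<theta> k + h k" using A_pos1_eq[OF that] by simp
    moreover have "A_pos1 \<theta> k \<in> T" using that by (intro subsetD[OF A] A_setI)
    ultimately show ?thesis by (simp add: add h)
  qed
  have nT: "hat_neg k l \<in> T" if "k \<in> ixs" "l \<in> ixs" for k l
  proof -
    have "A_neg \<theta> k l \<in> T" using that by (intro subsetD[OF A] A_setI)
    then show ?thesis using A_neg_eq[OF that] by simp
  qed
  have tT: "hat_diff i j \<in> T" if "i \<in> ixs" "j \<in> ixs" for i j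
  proof (cases "i = j")
    case True
    then show ?thesis by (simp add: hat_diff_diag h)
  next
    case False
    have "hat_diff i j = A_diff \<theta> i j + h i" using A_diff_eq[OF that] by simp
    moreover have "A_diff \<theta> i j \<in> T" using that False by (intro subsetD[OF A] A_setI)
    ultimately show ?thesis by (simp add: add h)
  qed
  have qT: "hat_pos k l \<in> T" if "k \<in> ixs" "l \<in> ixs" for k l
  proof -
    have "hat_pos k l = A_pos \<theta> k l + hat_pos1 l * (h k - of_bool (k = l)) + hat_pos1 k * (h l - of_bool (k = l))
      - h l * (h k - of_bool (k = l))"
      using A_pos_eq[OF that] by simp
    moreover have "A_pos \<theta> k l \<in> T" using that by (intro subsetD[OF A] A_setI)
    ultimately show ?thesis using that by (simp add: closed wT)
  qed
  have vT: "hat_neg1 k \<in> T" if "k \<in> ixs" for k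
  proof -
    have "hat_neg1 k = A_neg1 \<theta> k - (\<Sum>l\<in>ixs. hat_neg k l * (h l + 1 + of_bool (k = l))) - hsum \<theta>"
      using A_neg1_eq[OF that] by simp
    moreover have "A_neg1 \<theta> k \<in> T" using that by (intro subsetD[OF A] A_setI)
    ultimately show ?thesis using that by (auto intro!: closed nT)
  qed
  have mT: "hat_neg11 \<in> T"
  proof -
    have "hat_neg11 = A_neg11 \<theta> - (\<Sum>k\<in>ixs. 2 * hat_neg1 k * h_succ k) - (\<Sum>k\<in>ixs. \<Sum>l\<in>ixs. hat_neg k l * (h_succ k * h_succ l))
      - (\<Sum>k\<in>ixs. hat_neg k k * h_succ k) - (hsum \<theta> + 2 * of_nat (CARD('n))) * hsum \<theta>"
      by (simp add: A_neg11_eq)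
    also have "\<dots> \<in> T" by (intro closed vT nT subsetD[OF A] A_setI)
    finally show ?thesis .
  qed
  have bT: "hat_diff1 k \<in> T" if "k \<in> ixs" for k
  proof -
    have "hat_diff1 k = A_diff1 \<theta> k - (\<Sum>j\<in>ixs - {k}. hat_diff k j * h j) - h k * (h k - 1) + hat_pos1 k * hsum \<theta>"
      using A_diff1_eq[OF that] by simp
    also have "\<dots> \<in> T" using that by (intro closed tT wT subsetD[OF A] A_setI) auto
    finally show ?thesis .
  qed
  have ixs: "k \<in> ixs" if "k \<noteq> ix1" for k :: 'n
    using that by (simp add: ixs_def)
  have P1T: "P k ix1 \<in> T" for k
    by (cases "k = ix1", metis x_ix1 xT, subst X_eq(1), intro mult wT ixs xT yT)
  have PT: "P k l \<in> T" for k l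
  proof (cases "k = ix1 \<or> l = ix1")
    case True
    then show ?thesis using P1T P_sym by metis
  next
    case False
    then show ?thesis by (subst X_eq(4)) (intro mult qT ixs xT yT; simp)
  qed
  have N1T: "N ix1 k \<in> T" for k
  proof (cases "k = ix1")
    case True
    then show ?thesis by (simp only: X_eq(6)) (intro mult mT yT)
  next
    case False
    then show ?thesis by (subst X_eq(5)) (intro mult vT ixs xT yT)
  qed
  have NT: "N k l \<in> T" for k l
  proof (cases "k = ix1 \<or> l = ix1")
    case True
    then show ?thesis using N1T N_sym by metis
  next
    case False
    then show ?thesis by (subst X_eq(3)) (intro mult nT ixs xT yT; simp)
  qed
  have DT: "D i j \<in> T" for i j
  proof -
    consider "i = j" | "i = ix1" "j \<noteq> ix1" | "i \<noteq> ix1" "j = ix1" | "i \<noteq> ix1" "j \<noteq> ix1" by blast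
    then show ?thesis
    proof cases
      case 1 then show ?thesis using h by (simp add: sp_diff_diag)
    next
      case 2 then show ?thesis using xT[of j] x_ixs[OF ixs] by simp
    next
      case 3 then show ?thesis by (simp only: X_eq(7)) (intro mult bT ixs yT)
    next
      case 4 then show ?thesis by (subst X_eq(2)) (intro mult tT ixs xT yT)
    qed
  qed
  have theta: "\<theta> u \<in> T" for u
  proof -
    have "subalgebra {u. \<theta> u \<in> T}"
      using T by (auto simp: subalgebra_def alg_homD[OF hom])
    moreover have "usp_inj a \<in> {u. \<theta> u \<in> T}" for a
      using sp_generated[of "{a. \<theta> (usp_inj a) \<in> T}" a] T PT NT DT
      by (auto simp: theta_lin subalgebra_def)
    ultimately show ?thesis using usp_generated[of "{u. \<theta> u \<in> T}" u] by auto
  qed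
  define V where "V = {a. \<exists>a'\<in>T. a * a' = 1 \<and> a' * a = 1}"
  have V1: "1 \<in> V" unfolding V_def using one by auto
  have Vmult: "a * c \<in> V" if ac: "a \<in> V" "c \<in> V" for a c
  proof -
    obtain a' c' where *: "a' \<in> T" "a * a' = 1" "a' * a = 1" "c' \<in> T" "c * c' = 1" "c' * c = 1"
      using ac by (auto simp: V_def)
    have "a * c * (c' * a') = a * (c * c') * a'" "c' * a' * (a * c) = c' * (a' * a) * c"
      by (simp_all only: mult.assoc)
    then show ?thesis unfolding V_def using * mult by (auto intro!: bexI[of _ "c' * a'"])
  qed
  have Vx: "x i \<in> V" for i unfolding V_def using xy yx yT by blast
  have S: "\<theta> s \<in> V" if "s \<in> ore_set" for s
    by (rule ore_set_image_mem[OF hom V1 Vmult _ _ that]) (use Vx x_ix1 x_ixs in \<open>auto, metis+\<close>)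
  have "z \<in> T" for z
  proof -
    obtain s u where z: "s \<in> ore_set" "z = rinv (\<theta> s) * \<theta> u"
      using loc unfolding is_localization_def by blast
    obtain s' where s': "s' \<in> T" "\<theta> s * s' = 1" "s' * \<theta> s = 1" using S[OF z(1)] by (auto simp: V_def)
    then show ?thesis using rinv_eq[OF s'(2,3)] z(2) theta mult by simp
  qed
  then show ?thesis by blast
qed

end

section \<open>The oscillator values\<close>

text \<open>Three polynomial identities in commuting elements of a noncommutative ring, which evaluate
\<open>A\<^bsub>\<epsilon>\<^sub>k + \<epsilon>\<^sub>l\<^esub>\<close>, \<open>A\<^bsub>\<epsilon>\<^sub>k - \<epsilon>\<^sub>1\<^esub>\<close> and \<open>A\<^bsub>- 2 \<epsilon>\<^sub>1\<^esub>\<close>. There \<open>e\<close> is \<open>1/2\<close>, \<open>i\<close> is \<open>I\<^sub>n\<close> and \<open>c\<close> in the last one is \<open>n - 1/2\<close>.\<close>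

lemma pos_identity:
  fixes a b e :: "'a::ring_1"
  assumes "a * b = b * a" "e * a = a * e" "e * b = b * e"
  shows "a * b - of_bool Q * b - b * (a + e - of_bool Q) - a * (b + e - of_bool Q) + (b + e) * (a + e - of_bool Q)
    = e * e + of_bool Q * (a - b) - of_bool Q * e"
  using assms by (cases Q) (simp_all add: algebra_simps)

lemma diff1_identity:
  fixes a c i e :: "'a::ring_1"
  assumes "a * c = c * a" "e * a = a * e" "e + e = 1"
  shows "c * a + a * (i - (c - e) - (a + e)) + (a + e) * (a + e - 1) - a * i = e * e - e"
proof -
  have "a * e + a * e = a" using assms(3) by (metis distrib_left mult.right_neutral)
  moreover have "c * a + a * (i - (c - e) - (a + e)) + (a + e) * (a + e - 1) - a * i
    = (a * e + a * e) - a + e * e - e"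
    using assms(1,2) by (simp add: algebra_simps)
  ultimately show ?thesis by simp
qed

lemma neg11_identity:
  fixes a c i z :: "'a::ring_1"
  assumes "a * i = i * a" "c * a = a * c" "c * i = i * c" "z = c + c + 1"
  shows "- (a * (a + 1)) - (a + a) * (i - a + c) - (i - a + c) * (i - a + c) - (i - a + c) + (i + z) * i
    = - (c * c) - c"
  using assms(1-3) unfolding assms(4) by (simp add: algebra_simps)

context localized_sp
begin

definition half :: "'q" where "half = scaleC (1/2) 1"

text \<open>In the oscillator representation \<open>H\<^sub>1\<close> is \<open>\<partial>\<^sub>1 x\<^sub>1\<close> and \<open>H\<^sub>k\<close> is \<open>x\<^sub>k \<partial>\<^sub>k\<close> for \<open>k \<noteq> 1\<close>.\<close>
definition H :: "'n \<Rightarrow> 'q" where "H i = (if i = ix1 then h i + half else h i - half)"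

lemma half_central: "half * u = u * half"
  by (simp add: half_def mult_scaleC_left mult_scaleC_right)

lemma half_half: "half + half = 1"
  by (simp add: half_def scaleC_add_left[symmetric] scaleC_one)

lemma half_square: "half * half = scaleC (1/4) 1"
  by (simp add: half_def mult_scaleC_left scaleC_scaleC)

lemma h_H: "h ix1 = H ix1 - half" "k \<in> ixs \<Longrightarrow> h k = H k + half"
  by (auto simp: H_def)

lemma H_comm: "H i * H j = H j * H i"
  by (simp add: H_def algebra_simps half_central hh_comm)

text \<open>Modulo \<open>J\<close> the hats take the values that they have in the oscillator representation, for instance
\<open>- \<partial>\<^sub>1\<^sup>2 x\<^sub>1\<^sup>2 = - H\<^sub>1 (H\<^sub>1 + 1)\<close> for \<open>X\<^bsub>- 2 \<epsilon>\<^sub>1\<^esub>\<close>. For \<open>i = j\<close> the element \<open>hat_diff\<close> is \<open>h\<^sub>i\<close> itself, by \<open>hat_diff_diag\<close>.\<close>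
definition oscillator_mod :: "'q set \<Rightarrow> bool" where
  "oscillator_mod J \<longleftrightarrow>
      (\<forall>k\<in>ixs. cong_mod J (hat_pos1 k) (H k))
    \<and> (\<forall>i\<in>ixs. \<forall>j\<in>ixs. cong_mod J (hat_diff i j) (if i = j then h i else H i))
    \<and> (\<forall>k\<in>ixs. \<forall>l\<in>ixs. cong_mod J (hat_neg k l) (- 1))
    \<and> (\<forall>k\<in>ixs. \<forall>l\<in>ixs. cong_mod J (hat_pos k l) (H k * H l - of_bool (k = l) * H l))
    \<and> (\<forall>k\<in>ixs. cong_mod J (hat_neg1 k) (- H ix1))
    \<and> cong_mod J hat_neg11 (- (H ix1 * (H ix1 + 1)))
    \<and> (\<forall>k\<in>ixs. cong_mod J (hat_diff1 k) (H ix1 * H k))"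

lemma oscillator_modD:
  assumes "oscillator_mod J"
  shows "k \<in> ixs \<Longrightarrow> cong_mod J (hat_pos1 k) (H k)"
    "i \<in> ixs \<Longrightarrow> j \<in> ixs \<Longrightarrow> i \<noteq> j \<Longrightarrow> cong_mod J (hat_diff i j) (H i)"
    "k \<in> ixs \<Longrightarrow> l \<in> ixs \<Longrightarrow> cong_mod J (hat_neg k l) (- 1)"
    "k \<in> ixs \<Longrightarrow> l \<in> ixs \<Longrightarrow> cong_mod J (hat_pos k l) (H k * H l - of_bool (k = l) * H l)"
    "k \<in> ixs \<Longrightarrow> cong_mod J (hat_neg1 k) (- H ix1)"
    "cong_mod J hat_neg11 (- (H ix1 * (H ix1 + 1)))"
    "k \<in> ixs \<Longrightarrow> cong_mod J (hat_diff1 k) (H ix1 * H k)"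
  using assms unfolding oscillator_mod_def by (auto split: if_splits)

lemma hsum_H: "H i * hsum \<theta> = hsum \<theta> * H i"
  unfolding hsum_def sum_distrib_left sum_distrib_right
  by (intro sum.cong) (auto simp: H_def algebra_simps half_central hh_comm)

text \<open>All polynomials in the \<open>h\<^sub>i\<close> cancel, as they must for elements of the centralizer.\<close>
theorem A_values:
  assumes J: "two_sided J" and osc: "oscillator_mod J"
  shows "k \<in> ixs \<Longrightarrow> cong_mod J (A_pos1 \<theta> k) (scaleC (- 1/2) 1)"
    "k \<in> ixs \<Longrightarrow> l \<in> ixs \<Longrightarrow> cong_mod J (A_pos \<theta> k l) (scaleC (1/4 - (if l = k then 1 else 0)/2) 1)"
    "k \<in> ixs \<Longrightarrow> l \<in> ixs \<Longrightarrow> cong_mod J (A_neg \<theta> k l) (scaleC (- 1) 1)"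
    "i \<in> ixs \<Longrightarrow> j \<in> ixs \<Longrightarrow> i \<noteq> j \<Longrightarrow> cong_mod J (A_diff \<theta> i j) (scaleC (- 1/2) 1)"
    "k \<in> ixs \<Longrightarrow> cong_mod J (A_diff1 \<theta> k) (scaleC (- 1/4) 1)"
    "k \<in> ixs \<Longrightarrow> cong_mod J (A_neg1 \<theta> k) (scaleC (- 1/2 - of_nat (CARD('n))) 1)"
    "cong_mod J (A_neg11 \<theta>) (scaleC (- (of_nat (CARD('n)))\<^sup>2 + 1/4) 1)"
proof -
  note cong_rules = cong_mod_intros[OF J] cong_mod_refl[OF J] oscillator_modD[OF osc]
  note sc = scaleC.scale_left_diff_distrib scaleC.scale_minus_left scaleC_add_left scaleC_one
  show "cong_mod J (A_pos1 \<theta> k) (scaleC (- 1/2) 1)" if k: "k \<in> ixs"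
  proof -
    have "cong_mod J (A_pos1 \<theta> k) (H k - h k)"
      unfolding A_pos1_eq[OF k] by (intro cong_rules k)
    also have "H k - h k = scaleC (- 1/2) 1" using k by (simp add: h_H half_def sc)
    finally show ?thesis .
  qed
  show "cong_mod J (A_neg \<theta> k l) (scaleC (- 1) 1)" if k: "k \<in> ixs" "l \<in> ixs"
    using oscillator_modD(3)[OF osc k] by (simp add: A_neg_eq[OF k] sc)
  show "cong_mod J (A_diff \<theta> i j) (scaleC (- 1/2) 1)" if k: "i \<in> ixs" "j \<in> ixs" "i \<noteq> j"
  proof -
    have "cong_mod J (A_diff \<theta> i j) (H i - h i)"
      unfolding A_diff_eq[OF k(1,2)] by (intro cong_rules k)
    also have "H i - h i = scaleC (- 1/2) 1" using k by (simp add: h_H half_def sc)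
    finally show ?thesis .
  qed
  show "cong_mod J (A_pos \<theta> k l) (scaleC (1/4 - (if l = k then 1 else 0)/2) 1)" if k: "k \<in> ixs" "l \<in> ixs"
  proof -
    have "cong_mod J (A_pos \<theta> k l) (H k * H l - of_bool (k = l) * H l - H l * (h k - of_bool (k = l))
        - H k * (h l - of_bool (k = l)) + h l * (h k - of_bool (k = l)))"
      unfolding A_pos_eq[OF k] by (intro cong_rules k)
    also have "\<dots> = half * half + of_bool (k = l) * (H k - H l) - of_bool (k = l) * half"
      unfolding h_H(2)[OF k(1)] h_H(2)[OF k(2)]
      by (rule pos_identity) (simp_all add: H_comm[of k l] half_central)
    also have "\<dots> = scaleC (1/4 - (if l = k then 1 else 0)/2) 1"
      unfolding half_square by (auto simp: half_def sc)
    finally show ?thesis .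
  qed
  show "cong_mod J (A_diff1 \<theta> k) (scaleC (- 1/4) 1)" if k: "k \<in> ixs"
  proof -
    have "cong_mod J (A_diff1 \<theta> k) (H ix1 * H k + (\<Sum>j\<in>ixs - {k}. H k * h j) + h k * (h k - 1) - H k * hsum \<theta>)"
      unfolding A_diff1_eq[OF k] by (intro cong_rules k) auto
    also have "(\<Sum>j\<in>ixs - {k}. H k * h j) = H k * (hsum \<theta> - (H ix1 - half) - (H k + half))"
      unfolding sum_distrib_left[symmetric] h_H(1)[symmetric] h_H(2)[OF k, symmetric] hsum_split
      using sum.remove[of ixs k h] k by simp
    also have "H ix1 * H k + H k * (hsum \<theta> - (H ix1 - half) - (H k + half)) + h k * (h k - 1) - H k * hsum \<theta>
        = half * half - half"
      unfolding h_H(2)[OF k]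
      by (rule diff1_identity) (simp_all add: H_comm[of k ix1] half_central half_half)
    also have "\<dots> = scaleC (- 1/4) 1"
      unfolding half_square unfolding half_def scaleC.scale_left_diff_distrib[symmetric] by simp
    finally show ?thesis .
  qed
  show "cong_mod J (A_neg1 \<theta> k) (scaleC (- 1/2 - of_nat (CARD('n))) 1)" if k: "k \<in> ixs"
  proof -
    have "cong_mod J (A_neg1 \<theta> k) (- H ix1 + (\<Sum>l\<in>ixs. - 1 * (h l + 1 + of_bool (k = l))) + hsum \<theta>)"
      unfolding A_neg1_eq[OF k] by (intro cong_rules k)
    also have "(\<Sum>l\<in>ixs. - 1 * (h l + 1 + of_bool (k = l))) = - (hsum \<theta> - h ix1 + of_nat (CARD('n)))"
      by (rule sum_shifted_h[OF k])
    also have "- H ix1 + - (hsum \<theta> - h ix1 + of_nat (CARD('n))) + hsum \<theta> = - half - of_nat (CARD('n))"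
      by (simp add: h_H)
    also have "\<dots> = scaleC (- 1/2 - of_nat (CARD('n))) 1"
      using of_nat_mult_conv_scaleC[of "CARD('n)" "1 :: 'q"] by (simp add: half_def sc)
    finally show ?thesis .
  qed
  show "cong_mod J (A_neg11 \<theta>) (scaleC (- (of_nat (CARD('n)))\<^sup>2 + 1/4) 1)"
  proof -
    let ?n = "of_nat (CARD('n)) :: 'q" and ?N = "of_nat (CARD('n)) :: complex"
    let ?c = "scaleC (?N - 1/2) 1 :: 'q"
    have N: "?n = scaleC ?N 1"
      using of_nat_mult_conv_scaleC[of "CARD('n)" "1 :: 'q"] by simp
    have c: "half + ?n - 1 = ?c"
      unfolding N half_def by (simp add: sc) (simp add: scaleC_add_left[symmetric] add_self[symmetric] algebra_simps)
    have "cong_mod J (A_neg11 \<theta>) (- (H ix1 * (H ix1 + 1)) + (\<Sum>k\<in>ixs. 2 * (- H ix1) * h_succ k)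
        + (\<Sum>k\<in>ixs. \<Sum>l\<in>ixs. - 1 * (h_succ k * h_succ l)) + (\<Sum>k\<in>ixs. - 1 * h_succ k) + (hsum \<theta> + 2 * ?n) * hsum \<theta>)"
      unfolding A_neg11_eq by (intro cong_rules)
    also have "(\<Sum>k\<in>ixs. 2 * (- H ix1) * h_succ k) = - ((H ix1 + H ix1) * (\<Sum>k\<in>ixs. h_succ k))"
      by (simp only: sum_distrib_left[symmetric] mult_2) (simp add: left_diff_distrib distrib_right)
    also have "(\<Sum>k\<in>ixs. \<Sum>l\<in>ixs. - 1 * (h_succ k * h_succ l)) = - ((\<Sum>k\<in>ixs. h_succ k) * (\<Sum>k\<in>ixs. h_succ k))"
      by (simp only: sum_product sum_negf mult_minus1)
    also have "(\<Sum>k\<in>ixs. - 1 * h_succ k) = - (\<Sum>k\<in>ixs. h_succ k)"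
      by (simp only: sum_negf mult_minus1)
    also have "(\<Sum>k\<in>ixs. h_succ k) = hsum \<theta> - H ix1 + ?c"
      unfolding sum_h_succ h_H c[symmetric] by simp
    also have "- (H ix1 * (H ix1 + 1)) + - ((H ix1 + H ix1) * (hsum \<theta> - H ix1 + ?c))
        + - ((hsum \<theta> - H ix1 + ?c) * (hsum \<theta> - H ix1 + ?c)) + - (hsum \<theta> - H ix1 + ?c) + (hsum \<theta> + 2 * ?n) * hsum \<theta>
      = - (?c * ?c) - ?c"
    proof -
      have "2 * ?n = ?c + ?c + 1"
        unfolding c[symmetric] mult_2 using half_half by (simp add: algebra_simps)
      moreover have "H ix1 * hsum \<theta> = hsum \<theta> * H ix1" "?c * H ix1 = H ix1 * ?c" "?c * hsum \<theta> = hsum \<theta> * ?c"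
        by (simp_all add: hsum_H mult_scaleC_left mult_scaleC_right)
      ultimately show ?thesis
        unfolding add_uminus_conv_diff by (intro neg11_identity)
    qed
    also have "\<dots> = scaleC (- ((?N - 1/2) * (?N - 1/2)) - (?N - 1/2)) 1"
      by (simp add: mult_scaleC_left scaleC_scaleC scaleC.scale_left_diff_distrib[symmetric]
          scaleC.scale_minus_left[symmetric] del: scaleC.scale_minus_left)
    also have "- ((?N - 1/2) * (?N - 1/2)) - (?N - 1/2) = - ?N\<^sup>2 + 1/4"
      by (simp add: power2_eq_square field_simps)
    finally show ?thesis .
  qed
qed

end

section \<open>Existence of a character\<close>

text \<open>The operators \<open>x\<^sub>i\<close> and \<open>\<partial>\<^sub>i\<close> on functions of exponent vectors \<open>\<mu> \<in> \<int>\<^sup>n\<close>. The weights are distributed so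
that \<open>x\<^sub>i \<partial>\<^sub>i\<close> multiplies by \<open>\<mu>\<^sub>i\<close> for all \<open>i\<close>, while \<open>x\<^sub>1\<close> and the \<open>\<partial>\<^sub>k\<close> with \<open>k \<noteq> 1\<close> are pure translations and
thus invertible: Laurent polynomials in \<open>x\<^sub>1\<close> and in the Fourier transforms of the other variables.\<close>

definition osc_x :: "'n::{finite,linorder} \<Rightarrow> ('n \<Rightarrow> int) cend" where
  "osc_x i = weighted_shift (\<lambda>\<mu>. if i = ix1 then 1 else of_int (\<mu> i)) (\<lambda>\<mu>. \<mu>(i := \<mu> i - 1))"

definition osc_d :: "'n::{finite,linorder} \<Rightarrow> ('n \<Rightarrow> int) cend" where
  "osc_d i = weighted_shift (\<lambda>\<mu>. if i = ix1 then of_int (\<mu> i) + 1 else 1) (\<lambda>\<mu>. \<mu>(i := \<mu> i + 1))"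

lemma weyl_algebra_osc: "weyl_algebra osc_x (osc_d :: 'n::{finite,linorder} \<Rightarrow> _)"
proof
  fix i j :: 'n
  show "osc_x i * osc_x j = osc_x j * osc_x i"
    by (cases "i = j") (auto simp: osc_x_def weighted_shift_mult fun_upd_twist intro!: arg_cong2[where f = weighted_shift] ext)
  show "osc_d i * osc_d j = osc_d j * osc_d i"
    by (cases "i = j") (auto simp: osc_d_def weighted_shift_mult fun_upd_twist intro!: arg_cong2[where f = weighted_shift] ext)
  show "osc_d i * osc_x j = osc_x j * osc_d i + of_bool (i = j)"
  proof (cases "i = j")
    case True
    have "osc_d i * osc_x i - osc_x i * osc_d i = 1"
      unfolding osc_x_def osc_d_def weighted_shift_mult
      by (cases "i = ix1") (simp_all add: weighted_shift_diff weighted_shift_one)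
    then show ?thesis using True by (simp add: algebra_simps)
  next
    case False
    then show ?thesis
      by (auto simp: osc_d_def osc_x_def weighted_shift_mult fun_upd_twist intro!: arg_cong2[where f = weighted_shift] ext)
  qed
qed

lemma osc_x_d: "osc_x i * osc_d i = weighted_shift (\<lambda>\<mu>. of_int (\<mu> i)) (\<lambda>\<mu>. \<mu>)"
  by (auto simp: osc_d_def osc_x_def weighted_shift_mult intro!: arg_cong2[where f = weighted_shift] ext)

lemma invertible_osc_x: "invertible_elt (osc_x ix1)"
proof -
  let ?y = "weighted_shift (\<lambda>\<mu>. 1) (\<lambda>\<mu> :: 'a \<Rightarrow> int. \<mu>(ix1 := \<mu> ix1 + 1))"
  have "osc_x ix1 * ?y = 1" "?y * osc_x ix1 = 1"
    by (simp_all add: osc_x_def weighted_shift_mult weighted_shift_one)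
  then show ?thesis unfolding invertible_elt_def by blast
qed

lemma invertible_osc_d: "k \<noteq> ix1 \<Longrightarrow> invertible_elt (osc_d k)"
proof -
  assume k: "k \<noteq> ix1"
  let ?y = "weighted_shift (\<lambda>\<mu>. 1) (\<lambda>\<mu> :: 'a \<Rightarrow> int. \<mu>(k := \<mu> k - 1))"
  have "osc_d k * ?y = 1" "?y * osc_d k = 1"
    using k by (simp_all add: osc_d_def weighted_shift_mult weighted_shift_one)
  then show ?thesis unfolding invertible_elt_def by blast
qed

lemma cend_apply_weighted_shift: "cend_apply (weighted_shift w \<sigma>) f \<mu> = w \<mu> * f (\<sigma> \<mu>)"
  by transfer simp

lemma cend_apply_simps: "cend_apply (S + T) f \<mu> = cend_apply S f \<mu> + cend_apply T f \<mu>"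
  "cend_apply (S * T) f = cend_apply S (cend_apply T f)" "cend_apply (scaleC c S) f \<mu> = c * cend_apply S f \<mu>"
  "cend_apply 1 f = f" "cend_apply S (\<lambda>\<mu>. c * f \<mu>) = (\<lambda>\<mu>. c * cend_apply S f \<mu>)"
  by (transfer; simp)+

context localized_sp
begin

theorem oscillator_of_localization:
  "\<exists>\<psi> :: 'q \<Rightarrow> ('n \<Rightarrow> int) cend. alg_hom \<psi>
    \<and> (\<forall>i. \<psi> (h i) = weighted_shift (\<lambda>\<mu>. of_int (\<mu> i)) (\<lambda>\<mu>. \<mu>) + scaleC (1/2) 1)"
proof -
  interpret W: weyl_algebra osc_x "osc_d :: 'n \<Rightarrow> _" by (rule weyl_algebra_osc)
  obtain \<phi> :: "'n usp \<Rightarrow> ('n \<Rightarrow> int) cend" where \<phi>: "alg_hom \<phi>"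
    "\<And>i j. \<phi> (usp_inj (sp_diff i j)) = osc_x i * osc_d j + scaleC (of_bool (i = j) / 2) 1"
    "\<And>i j. \<phi> (usp_inj (sp_pos i j)) = osc_x i * osc_x j"
    "\<And>i j. \<phi> (usp_inj (sp_neg i j)) = - (osc_d i * osc_d j)"
    using W.oscillator_representation by blast
  have "\<phi> s \<in> {a. invertible_elt a}" if "s \<in> ore_set" for s
  proof (rule ore_set_image_mem[OF \<phi>(1) _ _ _ _ that])
    show "1 \<in> {a :: ('n \<Rightarrow> int) cend. invertible_elt a}" by (auto simp: invertible_elt_def)
    show "\<phi> (usp_inj (sp_diff ix1 k)) \<in> {a. invertible_elt a}" if "k \<in> ixs" for k
      using that by (auto simp: \<phi> intro!: invertible_elt_mult invertible_osc_x invertible_osc_d)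
  qed (auto simp: \<phi> intro!: invertible_elt_mult invertible_osc_x)
  then have "invertible_elt (\<phi> s)" if "s \<in> ore_set" for s
    using that by blast
  then obtain \<psi> :: "'q \<Rightarrow> ('n \<Rightarrow> int) cend" where \<psi>: "alg_hom \<psi>" "\<And>u. \<psi> (\<theta> u) = \<phi> u"
    using localization_universal[OF loc \<phi>(1)] by blast
  have "\<psi> (h i) = osc_x i * osc_d i + scaleC (1/2) 1" for i
    using \<phi>(2)[of i i] by (simp add: \<psi>(2) sp_diff_diag)
  then show ?thesis
    using \<psi>(1) by (auto simp: osc_x_d)
qed

text \<open>The delta function \<open>e0\<close> at the origin spans the joint eigenspace of the \<open>h\<^sub>i\<close> for the eigenvalues
\<open>1/2\<close>, so every element of the centralizer maps it to a multiple of itself.\<close>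
theorem character_exists:
  "\<exists>ch. ch 1 = 1 \<and> (\<forall>a\<in>C_alg \<theta>. \<forall>c\<in>C_alg \<theta>. ch (a + c) = ch a + ch c \<and> ch (a * c) = ch a * ch c)
    \<and> (\<forall>z. \<forall>a\<in>C_alg \<theta>. ch (scaleC z a) = z * ch a)"
proof -
  obtain \<psi> :: "'q \<Rightarrow> ('n \<Rightarrow> int) cend" where \<psi>: "alg_hom \<psi>"
    "\<And>i. \<psi> (h i) = weighted_shift (\<lambda>\<mu>. of_int (\<mu> i)) (\<lambda>\<mu>. \<mu>) + scaleC (1/2) 1"
    using oscillator_of_localization by blast
  note hom = alg_homD[OF \<psi>(1)]
  define e0 :: "('n \<Rightarrow> int) \<Rightarrow> complex" where "e0 = (\<lambda>\<mu>. of_bool (\<mu> = (\<lambda>_. 0)))"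
  define ch where "ch c = cend_apply (\<psi> c) e0 (\<lambda>_. 0)" for c
  have eig: "cend_apply (\<psi> c) e0 = (\<lambda>\<mu>. ch c * e0 \<mu>)" if c: "c \<in> C_alg \<theta>" for c
  proof
    fix \<mu> :: "'n \<Rightarrow> int"
    show "cend_apply (\<psi> c) e0 \<mu> = ch c * e0 \<mu>"
    proof (cases "\<mu> = (\<lambda>_. 0)")
      case True
      then show ?thesis by (simp add: ch_def e0_def)
    next
      case False
      then obtain i where i: "\<mu> i \<noteq> 0" by auto
      have he: "cend_apply (\<psi> (h i)) e0 = (\<lambda>\<mu>. 1/2 * e0 \<mu>)"
        by (rule ext) (auto simp: \<psi>(2) cend_apply_simps cend_apply_weighted_shift e0_def)
      have "c * h i = h i * c" using c by (auto simp: C_alg_iff mem_centralizer_range)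
      then have "cend_apply (\<psi> c) (cend_apply (\<psi> (h i)) e0) = cend_apply (\<psi> (h i)) (cend_apply (\<psi> c) e0)"
        by (simp only: cend_apply_simps(2)[symmetric] hom(3)[symmetric])
      then have "1/2 * cend_apply (\<psi> c) e0 \<mu> = cend_apply (\<psi> (h i)) (cend_apply (\<psi> c) e0) \<mu>"
        by (simp only: he cend_apply_simps(5)) (simp add: fun_eq_iff)
      also have "\<dots> = of_int (\<mu> i) * cend_apply (\<psi> c) e0 \<mu> + 1/2 * cend_apply (\<psi> c) e0 \<mu>"
        by (simp add: \<psi>(2) cend_apply_simps cend_apply_weighted_shift)
      finally show ?thesis using i False by (simp add: e0_def)
    qed
  qed
  have "ch 1 = 1" by (simp add: ch_def hom cend_apply_simps e0_def)
  moreover have "ch (a * c) = ch a * ch c" if "a \<in> C_alg \<theta>" "c \<in> C_alg \<theta>" for a c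
    unfolding ch_def[of "a * c"] hom(3) cend_apply_simps(2) eig[OF that(2)] cend_apply_simps(5) eig[OF that(1)]
    by (simp add: e0_def)
  ultimately show ?thesis
    by (intro exI[of _ ch]) (auto simp: ch_def hom cend_apply_simps)
qed

section \<open>The \<open>A\<^sub>\<alpha>\<close> generate the centralizer\<close>

text \<open>The basis of the span of the \<open>h\<^sub>i\<close> that is dual to the shifts, as the splitting lemma requires: the
shift by \<open>x\<^sub>j\<close> adds \<open>1\<close> to the \<open>j\<close>-th element and fixes the others.\<close>
definition dual_h :: "'n \<Rightarrow> 'q" where "dual_h i = (if i = ix1 then scaleC (- 1/2) (hsum \<theta>) else h i)"

definition B_gens :: "'q set" where "B_gens = (\<Union>i\<in>UNIV. {dual_h i, x i, y i})"

lemma B_gens_mem: "dual_h i \<in> B_gens" "x i \<in> B_gens" "y i \<in> B_gens"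
  unfolding B_gens_def by blast+

lemma shift_scaleC: "shift i (scaleC c u) = scaleC c (shift i u)"
  by (simp add: shift_def mult_scaleC_left mult_scaleC_right)

lemma shift_dual_h: "shift j (dual_h i) = dual_h i + of_bool (i = j)"
proof (cases "i = ix1")
  case True
  have "scaleC (- 1/2) 2 = (- 1 :: 'q)"
  proof -
    have two: "(2 :: 'q) = scaleC 2 1" using add_self[of "1 :: 'q"] by simp
    show ?thesis unfolding two scaleC_scaleC by (simp add: scaleC.scale_minus_left scaleC_one)
  qed
  then show ?thesis
    using True by (auto simp: dual_h_def shift_scaleC shift_I shift_lin scaleC.scale_right_diff_distrib)
qed (auto simp: dual_h_def shift_h)

lemma x_dual_h: "x j * dual_h i = (dual_h i + of_bool (i = j)) * x j"
  by (rule shift_move) (rule shift_dual_h)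

lemma dual_h_comm: "dual_h i * dual_h j = dual_h j * dual_h i"
proof -
  have "hsum \<theta> * h i = h i * hsum \<theta>" for i
    using hsum_weight_zero by (simp add: mem_centralizer_range)
  then show ?thesis
    by (simp add: dual_h_def mult_scaleC_left mult_scaleC_right hh_comm)
qed

lemma C_comm:
  assumes "c \<in> C_alg \<theta>"
  shows "c * h i = h i * c" "c * x i = x i * c" "c * y i = y i * c" "c * dual_h i = dual_h i * c"
proof -
  show h: "c * h i = h i * c" for i
    using assms by (auto simp: C_alg_iff mem_centralizer_range)
  show x: "c * x i = x i * c"
    using assms by (auto simp: C_alg_iff shift_fixed_iff)
  show "c * y i = y i * c"
    unfolding y_def using commute_rinv[OF x_invertible x[symmetric]] by simp
  have "c * hsum \<theta> = hsum \<theta> * c"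
    unfolding hsum_def sum_distrib_left sum_distrib_right by (simp add: h)
  then show "c * dual_h i = dual_h i * c"
    by (simp add: dual_h_def mult_scaleC_left mult_scaleC_right h)
qed

lemma C_comm_B_gens: "c \<in> C_alg \<theta> \<Longrightarrow> e \<in> B_gens \<Longrightarrow> e * c = c * e"
  by (auto simp: B_gens_def C_comm)

lemma h_dual_h: "h ix1 = scaleC (- 2) (dual_h ix1) - (\<Sum>k\<in>ixs. dual_h k)"
proof -
  have "(\<Sum>k\<in>ixs. dual_h k) = (\<Sum>k\<in>ixs. h k)" by (rule sum.cong) (auto simp: dual_h_def)
  then show ?thesis by (simp add: dual_h_def scaleC_scaleC scaleC_one hsum_split)
qed

lemma h_mem_subalgebra:
  assumes T: "subalgebra T" and dual_h: "\<And>i. dual_h i \<in> T"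
  shows "h i \<in> T"
proof (cases "i = ix1")
  case True
  have "scaleC (- 2) (dual_h ix1) - (\<Sum>k\<in>ixs. dual_h k) \<in> T"
    using dual_h subalgebra_csubspace[OF T] T
    by (intro csubspace_diff csubspace_sum) (auto simp: subalgebra_def simp del: scaleC.scale_minus_left)
  then show ?thesis using True h_dual_h by simp
next
  case False
  then show ?thesis using dual_h[of i] by (simp add: dual_h_def)
qed

lemma subalgebra_right_stable:
  "csubspace E \<Longrightarrow> subalgebra {r. \<forall>z\<in>E. z * r \<in> E}" for E :: "'q set"
  unfolding subalgebra_def csubspace_def
  by (auto simp: distrib_left mult_scaleC_right mult.assoc[symmetric])

lemma subalgebra_left_stable:
  "csubspace E \<Longrightarrow> subalgebra {r. \<forall>z\<in>E. r * z \<in> E}" for E :: "'q set"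
  unfolding subalgebra_def csubspace_def
  by (auto simp: distrib_right mult_scaleC_left mult.assoc)

text \<open>A subspace \<open>U\<close> of the centralizer that is stable under the \<open>A\<^sub>\<alpha>\<close> generates a one- or two-sided ideal by
multiplication with \<open>B\<close> from the right. As the \<open>A\<^sub>\<alpha>\<close> and \<open>B\<close> generate everything, it is enough to multiply by
these: on the right the \<open>A\<^sub>\<alpha>\<close> can be moved past \<open>B\<close>, on the left \<open>B\<close> can be moved past \<open>U\<close>.\<close>
lemma right_ext_right_ideal:
  assumes U: "csubspace U" and UA: "\<And>p a. p \<in> U \<Longrightarrow> a \<in> A_set \<Longrightarrow> p * a \<in> U"
    and z: "z \<in> right_ext B_gens U"
  shows "z * r \<in> right_ext B_gens U"
proof -
  let ?E = "right_ext B_gens U" and ?R = "{r. \<forall>z\<in>right_ext B_gens U. z * r \<in> right_ext B_gens U}"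
  have R: "subalgebra ?R" by (rule subalgebra_right_stable[OF csubspace_right_ext[OF U]])
  have gens: "e \<in> ?R" if "e \<in> B_gens" for e using that by (auto intro: right_ext.mult)
  have "?R = UNIV"
  proof (rule generated_by_A[OF R])
    show "A_set \<subseteq> ?R"
    proof (intro subsetI CollectI ballI)
      fix a z assume a: "a \<in> A_set" and z: "z \<in> ?E"
      show "z * a \<in> ?E"
        using z by (rule right_ext_right_closed) (use a UA A_set_subset in \<open>auto intro: right_ext.base C_comm_B_gens\<close>)
    qed
    show "x i \<in> ?R" "y i \<in> ?R" for i by (rule gens, rule B_gens_mem)+
    show "h i \<in> ?R" for i
      by (rule h_mem_subalgebra[OF R]) (rule gens, rule B_gens_mem)
  qed
  then show ?thesis using z by blast
qed

lemma right_ext_left_ideal: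
  assumes U: "csubspace U" "U \<subseteq> C_alg \<theta>" and UA: "\<And>p a. p \<in> U \<Longrightarrow> a \<in> A_set \<Longrightarrow> p * a \<in> U"
    and AU: "\<And>p a. p \<in> U \<Longrightarrow> a \<in> A_set \<Longrightarrow> a * p \<in> U"
    and z: "z \<in> right_ext B_gens U"
  shows "r * z \<in> right_ext B_gens U"
proof -
  let ?E = "right_ext B_gens U" and ?L = "{r. \<forall>z\<in>right_ext B_gens U. r * z \<in> right_ext B_gens U}"
  have L: "subalgebra ?L" by (rule subalgebra_left_stable[OF csubspace_right_ext[OF U(1)]])
  have comm: "e \<in> ?L" if e: "\<And>p. p \<in> U \<Longrightarrow> e * p = p * e" for e
  proof (intro CollectI ballI)
    fix z assume "z \<in> ?E"
    then show "e * z \<in> ?E"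
      by (rule right_ext_left_closed) (simp add: e right_ext_right_ideal[OF U(1) UA] right_ext.base)
  qed
  have "?L = UNIV"
  proof (rule generated_by_A[OF L])
    show "A_set \<subseteq> ?L"
    proof (intro subsetI CollectI ballI)
      fix a z assume a: "a \<in> A_set" and z: "z \<in> ?E"
      show "a * z \<in> ?E"
        using z by (rule right_ext_left_closed) (rule right_ext.base[OF AU[OF _ a]])
    qed
    show "x i \<in> ?L" for i by (rule comm, rule C_comm(2)[symmetric], erule subsetD[OF U(2)])
    show "y i \<in> ?L" for i by (rule comm, rule C_comm(3)[symmetric], erule subsetD[OF U(2)])
    show "h i \<in> ?L" for i by (rule comm, rule C_comm(1)[symmetric], erule subsetD[OF U(2)])
  qed
  then show ?thesis using z by blast
qed

lemma right_ext_B_gens_centralizer: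
  assumes "csubspace U" "U \<subseteq> C_alg \<theta>" "z \<in> right_ext B_gens U" "z \<in> C_alg \<theta>"
  shows "z \<in> U"
proof (rule right_ext_centralizer[where F = "UNIV :: 'n set" and g = dual_h and x = x and y = y])
  show "z \<in> right_ext (\<Union>i\<in>UNIV. {dual_h i, x i, y i}) U" using assms(3) by (simp add: B_gens_def)
qed (use assms C_comm xx xy yx dual_h_comm x_dual_h in \<open>auto\<close>)

text \<open>With \<open>T B\<close> a right ideal that contains \<open>1\<close>, the centralizer is contained in \<open>T B\<close>, and the splitting
lemma brings it down to \<open>T\<close>.\<close>
theorem C_alg_generated:
  assumes T: "subalgebra T" "T \<subseteq> C_alg \<theta>" and A: "A_set \<subseteq> T"
  shows "T = C_alg \<theta>"
proof
  show "C_alg \<theta> \<subseteq> T"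
  proof
    fix c assume c: "c \<in> C_alg \<theta>"
    have "1 * c \<in> right_ext B_gens T"
    proof (rule right_ext_right_ideal[OF subalgebra_csubspace[OF T(1)]])
      show "1 \<in> right_ext B_gens T" using T(1) by (auto simp: subalgebra_def intro: right_ext.base)
      show "p * a \<in> T" if "p \<in> T" "a \<in> A_set" for p a using that T(1) A by (auto simp: subalgebra_def)
    qed
    then show "c \<in> T"
      using right_ext_B_gens_centralizer[OF subalgebra_csubspace[OF T(1)] T(2) _ c] by simp
  qed
qed (rule T(2))

section \<open>Every character takes the oscillator values\<close>

definition intertwines :: "'q \<Rightarrow> 'q \<Rightarrow> 'q \<Rightarrow> bool" where "intertwines M f f' \<longleftrightarrow> M * f = f' * M"

lemma intertwines_add: "intertwines M f f' \<Longrightarrow> intertwines M fa fa' \<Longrightarrow> intertwines M (f + fa) (f' + fa')"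
  and intertwines_diff: "intertwines M f f' \<Longrightarrow> intertwines M fa fa' \<Longrightarrow> intertwines M (f - fa) (f' - fa')"
  and intertwines_minus: "intertwines M f f' \<Longrightarrow> intertwines M (- f) (- f')"
  and intertwines_scalar: "intertwines M (scaleC c 1) (scaleC c 1)"
  and intertwines_one: "intertwines M 1 1"
  by (simp_all add: intertwines_def distrib_left distrib_right left_diff_distrib right_diff_distrib
      mult_scaleC_left mult_scaleC_right)

lemma intertwines_mult: "intertwines M f f' \<Longrightarrow> intertwines M fa fa' \<Longrightarrow> intertwines M (f * fa) (f' * fa')"
  unfolding intertwines_def by (metis mult.assoc)

lemma intertwines_h: "has_weight M a \<Longrightarrow> of_int (a i) = c \<Longrightarrow> intertwines M (h i) (h i - c)"
  using has_weightD[of M a i] by (simp add: intertwines_def)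

lemma intertwines_H: "has_weight M a \<Longrightarrow> of_int (a i) = c \<Longrightarrow> intertwines M (H i) (H i - c)"
  using intertwines_add[OF intertwines_h[of M a i c] intertwines_scalar[of M "1/2"]] intertwines_diff[OF intertwines_h[of M a i c] intertwines_scalar[of M "1/2"]]
  by (auto simp: H_def half_def[symmetric] algebra_simps)

lemmas has_weight_y_x = has_weight_mult[OF has_weight_y has_weight_x] and has_weight_x_y = has_weight_mult[OF has_weight_x has_weight_y]

lemmas has_weight_monomials = has_weight_y has_weight_y_x has_weight_x_y has_weight_mult[OF has_weight_y_x has_weight_x] has_weight_mult[OF has_weight_x_y has_weight_y]

lemmas intertwines_intros = intertwines_add intertwines_diff intertwines_minus intertwines_scalar intertwines_one intertwines_mult has_weight_monomials[THEN intertwines_h] has_weight_monomials[THEN intertwines_H]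

text \<open>If two elements are congruent to \<open>f M\<close> and \<open>f' M'\<close>, with \<open>f, f'\<close> polynomials in the \<open>h\<^sub>i\<close> and \<open>M, M'\<close> monomials,
then their commutator is congruent to \<open>(f fa' - f' fa) M''\<close>, where \<open>fa\<close> and \<open>fa'\<close> are shifted copies of \<open>f\<close>
and \<open>f'\<close>. A known commutator therefore gives a difference equation for \<open>f\<close> and \<open>f'\<close>.\<close>
lemma commutator_relation:
  assumes J: "two_sided J" and X: "X = u * M" "X' = u' * M'" and u: "cong_mod J u f" "cong_mod J u' f'"
    and intertwines: "intertwines M f' fa'" "intertwines M' f fa" and M: "M * M' = M''" "M' * M = M''" "M'' * W = 1"
    and X'': "X * X' = X' * X + z * M''" and z: "cong_mod J z e"
  shows "cong_mod J (f * fa' - f' * fa) e"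
proof -
  have "cong_mod J (u * M * (u' * M') - u' * M' * (u * M)) (f * M * (f' * M') - f' * M' * (f * M))"
    by (intro cong_mod_intros[OF J] u cong_mod_refl[OF J])
  also have "f * M * (f' * M') - f' * M' * (f * M) = f * (M * f') * M' - f' * (M' * f) * M"
    by (simp only: mult.assoc)
  also have "\<dots> = f * fa' * (M * M') - f' * fa * (M' * M)"
    using intertwines by (simp only: intertwines_def mult.assoc)
  also have "\<dots> = (f * fa' - f' * fa) * M''"
    by (simp only: M left_diff_distrib)
  also have "u * M * (u' * M') - u' * M' * (u * M) = z * M''"
    using X'' by (simp add: X)
  finally have "cong_mod J (z * M'' * W) ((f * fa' - f' * fa) * M'' * W)"
    by (rule cong_mod_mult[OF J _ cong_mod_refl[OF J]])
  then have "cong_mod J z (f * fa' - f' * fa)"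
    by (simp only: mult.assoc M(3) mult_1_right)
  then show ?thesis
    using z cong_mod_sym[OF J] cong_mod_trans[OF J] by blast
qed

end

text \<open>A character of the centralizer; its values elsewhere are arbitrary.\<close>
locale sp_character = localized_sp \<theta> for \<theta> :: "'n::{finite,linorder} usp \<Rightarrow> 'q::complex_algebra_1" +
  fixes ch :: "'q \<Rightarrow> complex"
  assumes ch_one: "ch 1 = 1"
    and ch_add: "\<And>a c. a \<in> C_alg \<theta> \<Longrightarrow> c \<in> C_alg \<theta> \<Longrightarrow> ch (a + c) = ch a + ch c"
    and ch_mult: "\<And>a c. a \<in> C_alg \<theta> \<Longrightarrow> c \<in> C_alg \<theta> \<Longrightarrow> ch (a * c) = ch a * ch c"
    and ch_scale: "\<And>z a. a \<in> C_alg \<theta> \<Longrightarrow> ch (scaleC z a) = z * ch a"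
begin

lemma C_sub: "subalgebra (C_alg \<theta>)"
  unfolding C_alg_def by (rule subalgebra_centralizer)

lemma C_closed: "a \<in> C_alg \<theta> \<Longrightarrow> c \<in> C_alg \<theta> \<Longrightarrow> a + c \<in> C_alg \<theta>"
  "a \<in> C_alg \<theta> \<Longrightarrow> c \<in> C_alg \<theta> \<Longrightarrow> a * c \<in> C_alg \<theta>" "a \<in> C_alg \<theta> \<Longrightarrow> scaleC z a \<in> C_alg \<theta>"
  "1 \<in> C_alg \<theta>" "0 \<in> C_alg \<theta>"
  using C_sub subalgebra_csubspace[OF C_sub] by (auto simp: subalgebra_def csubspace_def)

definition K :: "'q set" where "K = {c \<in> C_alg \<theta>. ch c = 0}"

text \<open>The two-sided ideal generated by the kernel of the character.\<close>
definition J :: "'q set" where "J = right_ext B_gens K"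

lemma K_subspace: "csubspace K"
  using ch_scale[of 0 0] C_closed by (auto simp: csubspace_def K_def ch_add ch_scale)

lemma K_ideal: "p \<in> K \<Longrightarrow> a \<in> C_alg \<theta> \<Longrightarrow> p * a \<in> K" "p \<in> K \<Longrightarrow> a \<in> C_alg \<theta> \<Longrightarrow> a * p \<in> K"
  by (auto simp: K_def C_closed ch_mult)

lemma J: "two_sided J"
  unfolding two_sided_def J_def
  using csubspace_right_ext[OF K_subspace] right_ext_right_ideal[OF K_subspace, of _]
    right_ext_left_ideal[OF K_subspace] K_ideal A_set_subset K_def by blast

text \<open>The ideal is proper: \<open>1\<close> commutes with \<open>B\<close>, so by the splitting lemma it could belong to \<open>J = K B\<close> only
as an element of \<open>K\<close>.\<close>
lemma scalar_cong:
  assumes "cong_mod J (scaleC c 1) (scaleC d 1)"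
  shows "c = d"
proof (rule ccontr)
  assume ne: "c \<noteq> d"
  have "scaleC (c - d) 1 \<in> J"
    using assms by (simp add: cong_mod_def scaleC.scale_left_diff_distrib)
  then have "scaleC (1 / (c - d)) (scaleC (c - d) 1) \<in> J"
    using J unfolding two_sided_def csubspace_def by blast
  then have "1 \<in> J" using ne by (simp add: scaleC_scaleC scaleC_one)
  then have "1 \<in> K"
    unfolding J_def using right_ext_B_gens_centralizer[OF K_subspace _ _ C_closed(4)] K_def by blast
  then show False by (simp add: K_def ch_one)
qed

lemma cong_ch: "c \<in> C_alg \<theta> \<Longrightarrow> cong_mod J c (scaleC (ch c) 1)"
proof -
  assume c: "c \<in> C_alg \<theta>"
  have "c + scaleC (- ch c) 1 \<in> K"
    using c C_closed by (simp add: K_def ch_add ch_scale ch_one del: scaleC.scale_minus_left)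
  then show ?thesis
    by (simp add: cong_mod_def J_def right_ext.base scaleC.scale_minus_left)
qed

lemmas cong_rules = cong_mod_intros[OF J] cong_mod_refl[OF J]

lemma hat_pos1_cong: "k \<in> ixs \<Longrightarrow> cong_mod J (hat_pos1 k) (scaleC (ch (A_pos1 \<theta> k)) 1 + h k)"
  using cong_mod_add[OF J cong_ch[OF A_pos1_mem, of k] cong_mod_refl[OF J, of "h k"]]
  by (simp add: A_pos1_eq)

lemma scalar_central: "scaleC c 1 * u = u * scaleC c (1 :: 'q)"
  by (simp add: mult_scaleC_left mult_scaleC_right)

text \<open>From the commutator of \<open>X\<^bsub>\<epsilon>\<^sub>k + \<epsilon>\<^sub>1\<^esub>\<close> and \<open>X\<^bsub>- \<epsilon>\<^sub>k - \<epsilon>\<^sub>l\<^esub>\<close>, which is a multiple of \<open>X\<^bsub>\<epsilon>\<^sub>1 - \<epsilon>\<^sub>l\<^esub>\<close>: the scalar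
\<open>\<nu>\<close> satisfies \<open>- \<nu> d = d\<close>, where \<open>d\<close> is \<open>1\<close>, or \<open>2\<close> if \<open>k = l\<close>.\<close>
lemma hat_neg_value:
  assumes k: "k \<in> ixs" "l \<in> ixs"
  shows "cong_mod J (hat_neg k l) (- 1)"
proof -
  define \<nu> where "\<nu> = ch (A_neg \<theta> k l)"
  define a where "a = scaleC (ch (A_pos1 \<theta> k)) (1 :: 'q)"
  let ?d = "1 + of_bool (k = l) :: 'q"
  have hat_neg: "cong_mod J (hat_neg k l) (scaleC \<nu> 1)"
    using cong_ch[OF A_neg_mem[OF k]] by (simp add: A_neg_eq[OF k] \<nu>_def)
  have "cong_mod J ((a + h k) * scaleC \<nu> 1 - scaleC \<nu> 1 * (a + (h k - (- ?d)))) ?d"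
  proof (rule commutator_relation[OF J X_eq(1)[of k] X_eq(3)[of k l]])
    show "cong_mod J (hat_pos1 k) (a + h k)" unfolding a_def by (rule hat_pos1_cong[OF k(1)])
    show "x ix1 * y k * (y ix1 * x k * x l) = x l"
      by (simp only: mult.assoc yy_left[of k ix1] yx_assoc xy_assoc)
    then show "y ix1 * x k * x l * (x ix1 * y k) = x l"
      by (simp only: mono_ac)
    show "x l * y l = 1" by (rule xy)
    show "P k ix1 * N k l = N k l * P k ix1 + ?d * x l"
      using PN[of k ix1 k l] k by (auto simp: x_ixs distrib_right ixs_ne ix1_ne)
    show "intertwines (y ix1 * x k * x l) (a + h k) (a + (h k - (- ?d)))"
      unfolding a_def by (intro intertwines_intros) (use k in \<open>auto simp: ixs_ne ix1_ne\<close>)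
  qed (use hat_neg in \<open>auto intro: intertwines_scalar cong_mod_refl[OF J] simp: xy\<close>)
  also have "(a + h k) * scaleC \<nu> 1 - scaleC \<nu> 1 * (a + (h k - (- ?d))) = scaleC (- \<nu> * (1 + of_bool (k = l))) 1"
    by (cases "k = l") (simp_all add: scalar_central[of \<nu>, symmetric] distrib_left scaleC.scale_minus_left,
      simp add: add_self[symmetric] scaleC_add_left[symmetric] mult_2_right)
  also have "?d = scaleC (1 + of_bool (k = l)) 1"
    by (cases "k = l") (simp_all add: scaleC_one scaleC_add_left[symmetric] add_self)
  finally have "- \<nu> * (1 + of_bool (k = l)) = 1 + of_bool (k = l)" by (rule scalar_cong)
  then have "\<nu> = - 1" by (cases "k = l") (auto simp: minus_equation_iff)
  then show ?thesis using hat_neg by (simp add: scaleC.scale_minus_left scaleC_one)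
qed

lemma hat_pos_diag_cong:
  assumes k: "k \<in> ixs" and hat_pos1: "cong_mod J (hat_pos1 k) f"
  shows "cong_mod J (hat_pos k k) (scaleC (ch (A_pos \<theta> k k)) 1 + f * (h k - 1) + f * (h k - 1) - h k * (h k - 1))"
proof -
  have "hat_pos k k = A_pos \<theta> k k + hat_pos1 k * (h k - 1) + hat_pos1 k * (h k - 1) - h k * (h k - 1)"
    by (simp add: A_pos_eq[OF k k])
  then show ?thesis
    by (simp only:) (intro cong_rules hat_pos1 cong_ch A_pos_mem k)
qed

text \<open>From the commutator \<open>4 h\<^sub>k\<close> of \<open>X\<^bsub>2 \<epsilon>\<^sub>k\<^esub>\<close> and \<open>X\<^bsub>- 2 \<epsilon>\<^sub>k\<^esub>\<close>. The unknown value of \<open>A\<^bsub>2 \<epsilon>\<^sub>k\<^esub>\<close> drops out of the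
difference of the two polynomials, and \<open>4 \<alpha> + 2 = 0\<close> remains for the value \<open>\<alpha>\<close> of \<open>A\<^bsub>\<epsilon>\<^sub>k + \<epsilon>\<^sub>1\<^esub>\<close>.\<close>
lemma hat_pos1_value:
  assumes k: "k \<in> ixs"
  shows "cong_mod J (hat_pos1 k) (H k)"
proof -
  define \<alpha> where "\<alpha> = ch (A_pos1 \<theta> k)"
  define a where "a = scaleC \<alpha> (1 :: 'q)"
  define c where "c = scaleC (ch (A_pos \<theta> k k)) (1 :: 'q)"
  let ?f = "c + (a + h k) * (h k - 1) + (a + h k) * (h k - 1) - h k * (h k - 1)"
  let ?h = "h k - (- 2)"
  let ?g = "c + (a + ?h) * (?h - 1) + (a + ?h) * (?h - 1) - ?h * (?h - 1)"
  have hat_pos1: "cong_mod J (hat_pos1 k) (a + h k)" unfolding a_def \<alpha>_def by (rule hat_pos1_cong[OF k])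
  have "cong_mod J (?f * (- 1) - (- 1) * ?g) (4 * h k)"
  proof (rule commutator_relation[OF J X_eq(4)[of k k] X_eq(3)[of k k]])
    show "cong_mod J (hat_pos k k) ?f" unfolding c_def by (rule hat_pos_diag_cong[OF k hat_pos1])
    show "cong_mod J (hat_neg k k) (- 1)" by (rule hat_neg_value[OF k k])
    show "x ix1 * y k * y k * (y ix1 * x k * x k) = 1"
      by (simp only: mult.assoc yy_left[of k ix1] yx_assoc xy_assoc yx xy)
    then show "y ix1 * x k * x k * (x ix1 * y k * y k) = 1"
      by (simp only: mono_ac)
    show "P k k * N k k = N k k * P k k + 4 * h k * 1"
      using PN[of k k k k] by (simp add: four D_diag add.assoc)
    show "intertwines (y ix1 * x k * x k) ?f ?g"
      unfolding a_def c_def by (intro intertwines_intros) (use k in \<open>auto simp: ixs_ne ix1_ne\<close>)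
    show "intertwines (x ix1 * y k * y k) (- 1) (- 1)" by (intro intertwines_intros)
  qed (auto intro: cong_mod_refl[OF J])
  also have "?f * (- 1) - (- 1) * ?g = 4 * h k + (4 * a + 2)"
  proof -
    have "a * h k = h k * a" unfolding a_def by (rule scalar_central)
    then show ?thesis by (simp add: algebra_simps four mult_2 mult_2_right)
  qed
  finally have "cong_mod J (4 * h k + (4 * a + 2) - 4 * h k) (4 * h k - 4 * h k)"
    by (intro cong_rules)
  then have "cong_mod J (scaleC (4 * \<alpha> + 2) 1) (scaleC 0 1)"
    by (simp add: four a_def scaleC_add_left[symmetric] add_self[symmetric] scaleC_one)
       (simp add: scaleC_add_left algebra_simps scaleC_one add_self[symmetric])
  then have "4 * \<alpha> + 2 = 0" by (rule scalar_cong)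
  then have "4 * (\<alpha> + 1/2) = 0" by (simp add: algebra_simps)
  then have "\<alpha> + 1/2 = 0" by (simp only: mult_eq_0_iff) simp
  then have "\<alpha> = - 1/2" using eq_neg_iff_add_eq_0[of \<alpha> "1/2"] by simp
  then have "a + h k = H k"
    using k by (simp add: a_def H_def half_def ixs_ne scaleC.scale_minus_left)
  then show ?thesis using hat_pos1 by simp
qed

lemma H_h_comm: "H i * h j = h j * H i"
  by (simp add: H_def algebra_simps half_central hh_comm)

text \<open>From the commutator \<open>X\<^bsub>\<epsilon>\<^sub>i + \<epsilon>\<^sub>1\<^esub>\<close> of \<open>X\<^bsub>\<epsilon>\<^sub>i - \<epsilon>\<^sub>j\<^esub>\<close> and \<open>X\<^bsub>\<epsilon>\<^sub>j + \<epsilon>\<^sub>1\<^esub>\<close>.\<close>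
lemma hat_diff_value:
  assumes k: "i \<in> ixs" "j \<in> ixs" "i \<noteq> j"
  shows "cong_mod J (hat_diff i j) (H i)"
proof -
  define a where "a = scaleC (ch (A_diff \<theta> i j)) (1 :: 'q)"
  have hat_diff: "cong_mod J (hat_diff i j) (a + h i)"
    using cong_mod_add[OF J cong_ch[OF A_diff_mem[OF k(1,2)]] cong_mod_refl[OF J, of "h i"]]
    by (simp add: A_diff_eq k a_def)
  have "cong_mod J ((a + h i) * (H j - (- 1)) - H j * (a + (h i - 0))) (H i)"
  proof (rule commutator_relation[OF J X_eq(2)[of i j] X_eq(1)[of j] hat_diff hat_pos1_value[OF k(2)] _ _ _ _ _ _ hat_pos1_value[OF k(1)]])
    have "y i * x j * (x ix1 * y j) = y i * x ix1 * (x j * y j)"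
      by (simp only: mult.assoc xx_left[of j ix1])
    then show "y i * x j * (x ix1 * y j) = x ix1 * y i"
      by (simp only: xy mult_1_right yx_comm)
    then show "x ix1 * y j * (y i * x j) = x ix1 * y i"
      by (simp only: mono_ac)
    show "x ix1 * y i * (x i * y ix1) = 1"
      by (simp only: mult.assoc yx_assoc xy)
    show "D i j * P j ix1 = P j ix1 * D i j + hat_pos1 i * (x ix1 * y i)"
      using DP[of i j j ix1] k X_eq(1)[of i] by (auto simp: ixs_ne)
    show "intertwines (y i * x j) (H j) (H j - (- 1))"
      by (intro intertwines_intros) (use k in \<open>auto simp: ixs_ne ix1_ne\<close>)
    show "intertwines (x ix1 * y j) (a + h i) (a + (h i - 0))"
      unfolding a_def by (intro intertwines_intros) (use k in \<open>auto simp: ixs_ne ix1_ne\<close>)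
  qed
  also have "(a + h i) * (H j - (- 1)) - H j * (a + (h i - 0)) = a + h i"
    using scalar_central[of "ch (A_diff \<theta> i j)" "H j"]
    by (simp add: a_def algebra_simps H_h_comm)
  finally show ?thesis using cong_mod_trans[OF J hat_diff] by blast
qed

text \<open>From the commutator \<open>h\<^sub>1 + h\<^sub>k\<close> of \<open>X\<^bsub>\<epsilon>\<^sub>k + \<epsilon>\<^sub>1\<^esub>\<close> and \<open>X\<^bsub>- \<epsilon>\<^sub>1 - \<epsilon>\<^sub>k\<^esub>\<close>. The value of \<open>A\<^bsub>- \<epsilon>\<^sub>1 - \<epsilon>\<^sub>k\<^esub>\<close> enters through
\<open>c\<close>, to which the sum over \<open>l\<close> contributes the summand \<open>n\<close>.\<close>
lemma hat_neg1_value: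
  assumes k: "k \<in> ixs"
  shows "cong_mod J (hat_neg1 k) (- H ix1)"
proof -
  define c where "c = ch (A_neg1 \<theta> k) + of_nat (CARD('n))"
  define a where "a = scaleC c (1 :: 'q)"
  have hat_neg1: "cong_mod J (hat_neg1 k) (a - h ix1)"
  proof -
    have "hat_neg1 k = A_neg1 \<theta> k - (\<Sum>l\<in>ixs. hat_neg k l * (h l + 1 + of_bool (k = l))) - hsum \<theta>"
      by (simp add: A_neg1_eq[OF k])
    also have "cong_mod J \<dots> (scaleC (ch (A_neg1 \<theta> k)) 1 - (\<Sum>l\<in>ixs. - 1 * (h l + 1 + of_bool (k = l))) - hsum \<theta>)"
      by (intro cong_rules hat_neg_value k cong_ch A_neg1_mem)
    also have "(\<Sum>l\<in>ixs. - 1 * (h l + 1 + of_bool (k = l))) = - (hsum \<theta> - h ix1 + of_nat (CARD('n)))"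
      by (rule sum_shifted_h[OF k])
    also have "scaleC (ch (A_neg1 \<theta> k)) 1 - - (hsum \<theta> - h ix1 + of_nat (CARD('n))) - hsum \<theta> = a - h ix1"
      using of_nat_mult_conv_scaleC[of "CARD('n)" "1 :: 'q"] by (simp add: a_def c_def scaleC_add_left)
    finally show ?thesis .
  qed
  have "cong_mod J (H k * (a - (h ix1 - 1)) - (a - h ix1) * (H k - (- 1))) (h ix1 + h k)"
  proof (rule commutator_relation[OF J X_eq(1)[of k] X_eq(5)[of k] hat_pos1_value[OF k] hat_neg1])
    show "x ix1 * y k * (y ix1 * x k) = 1"
      by (simp only: mult.assoc yy_left[of k ix1] yx mult_1_right xy)
    then show "y ix1 * x k * (x ix1 * y k) = 1"
      by (simp only: mono_ac)
    show "P k ix1 * N ix1 k = N ix1 k * P k ix1 + (h ix1 + h k) * 1"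
      using PN[of k ix1 ix1 k] k by (auto simp: ixs_ne ix1_ne D_diag)
    show "intertwines (x ix1 * y k) (a - h ix1) (a - (h ix1 - 1))"
      unfolding a_def by (intro intertwines_intros) (use k in \<open>auto simp: ixs_ne ix1_ne\<close>)
    show "intertwines (y ix1 * x k) (H k) (H k - (- 1))"
      by (intro intertwines_intros) (use k in \<open>auto simp: ixs_ne ix1_ne\<close>)
  qed (auto intro: cong_mod_refl[OF J])
  also have "H k * (a - (h ix1 - 1)) - (a - h ix1) * (H k - (- 1)) = H k - a + h ix1"
    using scalar_central[of c "H k"] by (simp add: a_def algebra_simps H_h_comm)
  finally have "cong_mod J (H k - (H k - a + h ix1) + h ix1) (H k - (h ix1 + h k) + h ix1)"
    by (rule cong_mod_add[OF J cong_mod_diff[OF J cong_mod_refl[OF J]] cong_mod_refl[OF J]])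
  then have "cong_mod J (scaleC c 1) (scaleC (- 1/2) 1)"
    using k by (simp add: a_def h_H(2)[OF k] half_def scaleC.scale_minus_left)
  then have "c = - 1/2" by (rule scalar_cong)
  then have "a - h ix1 = - H ix1"
    by (simp add: a_def H_def half_def scaleC.scale_minus_left)
  then show ?thesis using hat_neg1 by simp
qed

text \<open>From the commutator \<open>2 X\<^bsub>\<epsilon>\<^sub>k - \<epsilon>\<^sub>1\<^esub>\<close> of \<open>X\<^bsub>2 \<epsilon>\<^sub>k\<^esub>\<close> and \<open>X\<^bsub>- \<epsilon>\<^sub>1 - \<epsilon>\<^sub>k\<^esub>\<close>; again the value of \<open>A\<^bsub>2 \<epsilon>\<^sub>k\<^esub>\<close> drops out.\<close>
lemma hat_diff1_value:
  assumes k: "k \<in> ixs"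
  shows "cong_mod J (hat_diff1 k) (H ix1 * H k)"
proof -
  define c where "c = scaleC (ch (A_pos \<theta> k k)) (1 :: 'q)"
  let ?f = "c + H k * (h k - 1) + H k * (h k - 1) - h k * (h k - 1)"
  let ?h = "h k - (- 1)"
  let ?H = "H k - (- 1)"
  let ?g = "c + ?H * (?h - 1) + ?H * (?h - 1) - ?h * (?h - 1)"
  have "cong_mod J (?f * (- (H ix1 - 0)) - (- H ix1) * ?g) (2 * hat_diff1 k)"
  proof (rule commutator_relation[OF J X_eq(4)[of k k] X_eq(5)[of k] _ hat_neg1_value[OF k]])
    show "cong_mod J (hat_pos k k) ?f" unfolding c_def by (rule hat_pos_diag_cong[OF k hat_pos1_value[OF k]])
    have "x ix1 * y k * y k * (y ix1 * x k) = x ix1 * y ix1 * (y k * (y k * x k))"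
      by (simp only: mult.assoc yy_left[of k ix1])
    then show "x ix1 * y k * y k * (y ix1 * x k) = y k"
      by (simp only: xy yx mult_1_right mult_1_left)
    then show "y ix1 * x k * (x ix1 * y k * y k) = y k"
      by (simp only: mono_ac)
    show "P k k * N ix1 k = N ix1 k * P k k + 2 * hat_diff1 k * y k"
      using PN[of k k ix1 k] k X_eq(7)[of k] by (auto simp: ixs_ne mult_2 distrib_right)
    show "intertwines (x ix1 * y k * y k) (- H ix1) (- (H ix1 - 0))"
      by (intro intertwines_intros) (use k in \<open>auto simp: ixs_ne ix1_ne\<close>)
    show "intertwines (y ix1 * x k) ?f ?g"
      unfolding c_def by (intro intertwines_intros) (use k in \<open>auto simp: ixs_ne ix1_ne\<close>)
  qed (auto intro: cong_mod_refl[OF J] yx)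
  also have "?f * (- (H ix1 - 0)) - (- H ix1) * ?g = H ix1 * H k + H ix1 * H k"
  proof -
    have "?f * H ix1 = H ix1 * ?f"
      using scalar_central[of "ch (A_pos \<theta> k k)" "H ix1"]
      by (simp add: c_def distrib_left distrib_right left_diff_distrib right_diff_distrib mult.assoc
          H_comm[of k ix1] H_h_comm[symmetric])
         (simp add: mult.assoc[symmetric] H_comm[of k ix1] H_h_comm[symmetric])
    moreover have "a * (- (e - 0)) - (- e) * c = e * (c - a)" if "a * e = e * a" for a c e :: 'q
      using that by (simp add: right_diff_distrib)
    ultimately have "?f * (- (H ix1 - 0)) - (- H ix1) * ?g = H ix1 * (?g - ?f)"
      by blast
    also have "?g - ?f = H k + H k"
      by (simp add: algebra_simps)
    finally show ?thesis by (simp add: distrib_left)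
  qed
  finally have "cong_mod J (scaleC (1/2) 1 * (H ix1 * H k + H ix1 * H k)) (scaleC (1/2) 1 * (2 * hat_diff1 k))"
    by (rule cong_mod_mult[OF J cong_mod_refl[OF J]])
  then have "cong_mod J (H ix1 * H k) (hat_diff1 k)"
    by (simp add: mult_2 add_self mult_scaleC_left scaleC_scaleC scaleC_one)
  then show ?thesis by (rule cong_mod_sym[OF J])
qed

text \<open>From the commutator \<open>X\<^bsub>\<epsilon>\<^sub>k + \<epsilon>\<^sub>l\<^esub>\<close> of \<open>X\<^bsub>\<epsilon>\<^sub>k - \<epsilon>\<^sub>1\<^esub>\<close> and \<open>X\<^bsub>\<epsilon>\<^sub>l + \<epsilon>\<^sub>1\<^esub>\<close>, both of which are known by now.\<close>
lemma hat_pos_value: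
  assumes k: "k \<in> ixs" "l \<in> ixs"
  shows "cong_mod J (hat_pos k l) (H k * H l - of_bool (k = l) * H l)"
proof -
  let ?d = "of_bool (k = l) :: 'q"
  have "cong_mod J ((H ix1 * H k) * (H l - ?d) - H l * ((H ix1 - 1) * (H k - ?d))) (hat_pos k l)"
  proof (rule commutator_relation[OF J X_eq(7)[of k] X_eq(1)[of l] hat_diff1_value[OF k(1)] hat_pos1_value[OF k(2)]])
    show "y k * (x ix1 * y l) = x ix1 * y k * y l"
      by (simp only: mult.assoc yx_left)
    then show "x ix1 * y l * y k = x ix1 * y k * y l"
      by (simp only: mono_ac)
    show "x ix1 * y k * y l * (x l * x k * y ix1) = 1"
      by (simp only: mult.assoc yx_assoc xy)
    show "D k ix1 * P l ix1 = P l ix1 * D k ix1 + hat_pos k l * (x ix1 * y k * y l)"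
      using DP[of k ix1 l ix1] k X_eq(4)[of k l] by (auto simp: ixs_ne ix1_ne)
    show "intertwines (y k) (H l) (H l - ?d)"
      by (intro intertwines_intros) (use k in \<open>auto simp: ixs_ne ix1_ne\<close>)
    show "intertwines (x ix1 * y l) (H ix1 * H k) ((H ix1 - 1) * (H k - ?d))"
      by (intro intertwines_intros) (use k in \<open>auto simp: ixs_ne ix1_ne\<close>)
  qed (rule cong_mod_refl[OF J])
  moreover have "(H ix1 * H k) * (H l - ?d) - H l * ((H ix1 - 1) * (H k - ?d)) = H k * H l - ?d * H l"
  proof -
    have left: "H i * (H j * u) = H j * (H i * u)" for i j u
      by (simp add: mult.assoc[symmetric] H_comm[of i j])
    show ?thesis
      by (cases "k = l") (simp_all add: algebra_simps H_comm left)
  qed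
  ultimately show ?thesis using cong_mod_sym[OF J] by simp
qed

text \<open>From the commutator \<open>X\<^bsub>- 2 \<epsilon>\<^sub>1\<^esub>\<close> of \<open>X\<^bsub>- \<epsilon>\<^sub>1 - \<epsilon>\<^sub>k\<^esub>\<close> and \<open>X\<^bsub>\<epsilon>\<^sub>k - \<epsilon>\<^sub>1\<^esub>\<close>. Some \<open>k \<noteq> 1\<close> must exist; this is where
\<open>n \<ge> 2\<close> enters.\<close>
lemma hat_neg11_value:
  assumes "ixs \<noteq> ({} :: 'n set)"
  shows "cong_mod J hat_neg11 (- (H ix1 * (H ix1 + 1)))"
proof -
  obtain k :: 'n where k: "k \<in> ixs" using assms by blast
  have "cong_mod J ((- H ix1) * ((H ix1 - (- 1)) * (H k - (- 1))) - (H ix1 * H k) * (- (H ix1 - (- 1)))) hat_neg11"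
  proof (rule commutator_relation[OF J X_eq(5)[of k] X_eq(7)[of k] hat_neg1_value[OF k] hat_diff1_value[OF k]])
    show "y ix1 * x k * y k = y ix1"
      by (simp only: mult.assoc xy mult_1_right)
    then show "y k * (y ix1 * x k) = y ix1"
      by (simp only: mono_ac)
    show "N ix1 k * D k ix1 = D k ix1 * N ix1 k + hat_neg11 * y ix1"
      using DN[of k ix1 ix1 k] k X_eq(6) by (auto simp: ixs_ne ix1_ne)
    show "intertwines (y ix1 * x k) (H ix1 * H k) ((H ix1 - (- 1)) * (H k - (- 1)))"
      by (intro intertwines_intros) (use k in \<open>auto simp: ixs_ne ix1_ne\<close>)
    show "intertwines (y k) (- H ix1) (- (H ix1 - (- 1)))"
      by (intro intertwines_intros) (use k in \<open>auto simp: ixs_ne ix1_ne\<close>)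
  qed (auto intro: cong_mod_refl[OF J] yx)
  moreover have "(- H ix1) * ((H ix1 - (- 1)) * (H k - (- 1))) - (H ix1 * H k) * (- (H ix1 - (- 1)))
      = - (H ix1 * (H ix1 + 1))"
    by (simp add: algebra_simps H_comm[of k ix1])
  ultimately show ?thesis using cong_mod_sym[OF J] by simp
qed

theorem oscillator_mod_J:
  assumes "ixs \<noteq> ({} :: 'n set)"
  shows "oscillator_mod J"
  unfolding oscillator_mod_def
  using hat_pos1_value hat_diff_value hat_neg_value hat_pos_value hat_neg1_value hat_neg11_value[OF assms] hat_diff1_value cong_mod_refl[OF J]
  by (auto simp: hat_diff_diag)

theorem ch_value:
  assumes "a \<in> C_alg \<theta>" "cong_mod J a (scaleC z 1)"
  shows "ch a = z"
  using scalar_cong cong_ch[OF assms(1)] assms(2) cong_mod_trans[OF J] cong_mod_sym[OF J] by blast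

lemma ch_values:
  assumes "ixs \<noteq> ({} :: 'n set)"
  shows "k \<in> ixs \<Longrightarrow> ch (A_pos1 \<theta> k) = - 1/2"
    "k \<in> ixs \<Longrightarrow> l \<in> ixs \<Longrightarrow> ch (A_pos \<theta> k l) = 1/4 - (if l = k then 1 else 0)/2"
    "k \<in> ixs \<Longrightarrow> l \<in> ixs \<Longrightarrow> ch (A_neg \<theta> k l) = - 1"
    "i \<in> ixs \<Longrightarrow> j \<in> ixs \<Longrightarrow> i \<noteq> j \<Longrightarrow> ch (A_diff \<theta> i j) = - 1/2"
    "k \<in> ixs \<Longrightarrow> ch (A_diff1 \<theta> k) = - 1/4"
    "k \<in> ixs \<Longrightarrow> ch (A_neg1 \<theta> k) = - 1/2 - of_nat (CARD('n))"
    "ch (A_neg11 \<theta>) = - (of_nat (CARD('n)))\<^sup>2 + 1/4"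
  using A_values[OF J oscillator_mod_J[OF assms]]
  by (blast intro: ch_value subsetD[OF A_set_subset] A_setI)+

end

section \<open>One-dimensional modules\<close>

theorem (in localized_sp) character_unique:
  assumes "ixs \<noteq> ({} :: 'n set)" and ch: "sp_character \<theta> ch" and ch': "sp_character \<theta> ch'"
    and c: "c \<in> C_alg \<theta>"
  shows "ch c = ch' c"
proof -
  interpret c1: sp_character \<theta> ch by (rule ch)
  interpret c2: sp_character \<theta> ch' by (rule ch')
  let ?T = "{c \<in> C_alg \<theta>. ch c = ch' c}"
  have "subalgebra ?T"
    using c1.C_sub
    by (auto simp: subalgebra_def c1.ch_one c2.ch_one c1.ch_add c2.ch_add c1.ch_mult c2.ch_mult
        c1.ch_scale c2.ch_scale)
  moreover have "A_set \<subseteq> ?T"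
  proof
    fix a assume a: "a \<in> A_set"
    then have "ch a = ch' a"
      by (auto simp: A_set_def c1.ch_values[OF assms(1)] c2.ch_values[OF assms(1)])
    then show "a \<in> ?T" using a A_set_subset by auto
  qed
  ultimately have "?T = C_alg \<theta>" by (intro C_alg_generated) auto
  then show ?thesis using c by blast
qed

lemma one_dim_basis:
  assumes "vector_space sc" "vector_space.dim sc (UNIV :: 'w::ab_group_add set) = 1"
  shows "\<exists>v0. v0 \<noteq> 0 \<and> (\<forall>v. \<exists>c. v = sc c v0)"
proof -
  interpret vector_space sc by (rule assms(1))
  obtain B where B: "independent B" "UNIV \<subseteq> span B" "card B = dim (UNIV :: 'w set)"
    by (rule basis_exists[of UNIV]) auto
  then obtain v0 where v0: "B = {v0}" using assms(2) card_1_singletonE by metis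
  then have "v0 \<noteq> 0" using B(1) by simp
  moreover have "\<exists>c. v = sc c v0" for v
    using B(2) v0 by (auto simp: span_singleton)
  ultimately show ?thesis by blast
qed

lemma (in localized_sp) one_dim_module_character:
  assumes W: "one_dim_module (C_alg \<theta>) sc (W :: 'q \<Rightarrow> 'w::ab_group_add \<Rightarrow> 'w)"
  shows "\<exists>ch v0. sp_character \<theta> ch \<and> v0 \<noteq> 0 \<and> (\<forall>v. \<exists>c. v = sc c v0)
    \<and> (\<forall>a\<in>C_alg \<theta>. \<forall>v. W a v = sc (ch a) v)"
proof -
  have vs: "vector_space sc" and dim: "vector_space.dim sc (UNIV :: 'w set) = 1"
    and lin: "\<And>a. a \<in> C_alg \<theta> \<Longrightarrow> Vector_Spaces.linear sc sc (W a)"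
    and one: "\<And>v. W 1 v = v"
    and add: "\<And>a b v. a \<in> C_alg \<theta> \<Longrightarrow> b \<in> C_alg \<theta> \<Longrightarrow> W (a + b) v = W a v + W b v"
    and mult: "\<And>a b v. a \<in> C_alg \<theta> \<Longrightarrow> b \<in> C_alg \<theta> \<Longrightarrow> W (a * b) v = W a (W b v)"
    and scale: "\<And>c a v. a \<in> C_alg \<theta> \<Longrightarrow> W (scaleC c a) v = sc c (W a v)"
    using W by (auto simp: one_dim_module_def alg_module_def)
  interpret vector_space sc by (rule vs)
  obtain v0 where v0: "v0 \<noteq> 0" "\<And>v. \<exists>c. v = sc c v0"
    using one_dim_basis[OF vs dim] by blast
  have C: "subalgebra (C_alg \<theta>)"
    unfolding C_alg_def by (rule subalgebra_centralizer)
  have "\<forall>a. \<exists>c. W a v0 = sc c v0" using v0(2) by blast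
  then obtain ch where ch0: "\<And>a. W a v0 = sc (ch a) v0"
    by metis
  have ch: "W a v = sc (ch a) v" if a: "a \<in> C_alg \<theta>" for a v
  proof -
    obtain c where v: "v = sc c v0" using v0(2) by blast
    have "W a v = sc c (W a v0)" using lin[OF a] by (simp add: v Vector_Spaces.linear_iff)
    then show ?thesis by (simp add: ch0 v mult.commute)
  qed
  have inj: "c = d" if "sc c v0 = sc d v0" for c d
    using that v0(1) by (simp add: scale_right_imp_eq)
  have "sp_character \<theta> ch"
  proof unfold_locales
    show "ch 1 = 1"
      using inj[of "ch 1" 1] ch0[of 1] one[of v0] by simp
    fix a b assume a: "a \<in> C_alg \<theta>" and b: "b \<in> C_alg \<theta>"
    show "ch (a + b) = ch a + ch b"
      using add[OF a b, of v0] by (intro inj) (simp add: ch0 scale_left_distrib)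
    show "ch (a * b) = ch a * ch b"
      using mult[OF a b, of v0] ch[OF a] by (intro inj) (simp add: ch0)
  next
    fix z a assume a: "a \<in> C_alg \<theta>"
    show "ch (scaleC z a) = z * ch a"
      using scale[OF a, of z v0] by (intro inj) (simp add: ch0)
  qed
  then show ?thesis using v0 ch by blast
qed

theorem proposition3p9:
  fixes \<theta> :: "'n::{finite,linorder} usp \<Rightarrow> 'q::complex_algebra_1"
  assumes "CARD('n) \<ge> 2"
    and "is_localization ore_set \<theta>"
  shows "\<exists>V :: 'q \<Rightarrow> complex \<Rightarrow> complex.
      one_dim_module (C_alg \<theta>) (*) V
    \<and> (\<forall>k\<in>ixs. acts_by (C_alg \<theta>) (*) V (A_pos1 \<theta> k) (- 1/2))
    \<and> (\<forall>k\<in>ixs. \<forall>l\<in>ixs. acts_by (C_alg \<theta>) (*) V (A_pos \<theta> k l) (1/4 - (if l = k then 1 else 0)/2))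
    \<and> (\<forall>k\<in>ixs. \<forall>l\<in>ixs. acts_by (C_alg \<theta>) (*) V (A_neg \<theta> k l) (- 1))
    \<and> (\<forall>i\<in>ixs. \<forall>j\<in>ixs. i \<noteq> j \<longrightarrow> acts_by (C_alg \<theta>) (*) V (A_diff \<theta> i j) (- 1/2))
    \<and> (\<forall>k\<in>ixs. acts_by (C_alg \<theta>) (*) V (A_diff1 \<theta> k) (- 1/4))
    \<and> (\<forall>k\<in>ixs. acts_by (C_alg \<theta>) (*) V (A_neg1 \<theta> k) (- 1/2 - of_nat (CARD('n))))
    \<and> acts_by (C_alg \<theta>) (*) V (A_neg11 \<theta>) (- (of_nat (CARD('n)))\<^sup>2 + 1/4)
    \<and> (\<forall>(sc :: complex \<Rightarrow> 'w::ab_group_add \<Rightarrow> 'w) (W :: 'q \<Rightarrow> 'w \<Rightarrow> 'w).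
         one_dim_module (C_alg \<theta>) sc W \<longrightarrow> module_isomorphic (C_alg \<theta>) (*) V sc W)"
proof -
  interpret localized_sp \<theta> by unfold_locales (rule assms(2))
  have ixs: "ixs \<noteq> ({} :: 'n set)"
    using assms(1) CARD_ixs by auto
  obtain ch where ch: "sp_character \<theta> ch"
    using character_exists unfolding sp_character_def sp_character_axioms_def
    by (metis localized_sp_axioms)
  interpret sp_character \<theta> ch by (rule ch)
  define V where "V a z = ch a * z" for a z
  have acts: "acts_by (C_alg \<theta>) (*) V a c" if "a \<in> A_set" "ch a = c" for a c
    using that A_set_subset by (auto simp: acts_by_def V_def)
  have vs: "vector_space ((*) :: complex \<Rightarrow> complex \<Rightarrow> complex)"
    by (rule vector_space_over_itself.vector_space_axioms)
  have "one_dim_module (C_alg \<theta>) (*) V"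
    unfolding one_dim_module_def alg_module_def
    by (auto simp: vs V_def Vector_Spaces.linear_iff ch_one ch_add ch_mult ch_scale algebra_simps)
  moreover have "module_isomorphic (C_alg \<theta>) (*) V sc W"
    if W: "one_dim_module (C_alg \<theta>) sc W" for sc :: "complex \<Rightarrow> 'w \<Rightarrow> 'w" and W
  proof -
    have sc: "vector_space sc" using W by (simp add: one_dim_module_def alg_module_def)
    interpret sc: vector_space sc by (rule sc)
    obtain ch' v0 where ch': "sp_character \<theta> ch'" "v0 \<noteq> 0" "\<And>v. \<exists>c. v = sc c v0"
      "\<And>a v. a \<in> C_alg \<theta> \<Longrightarrow> W a v = sc (ch' a) v"
      using one_dim_module_character[OF W] by blast
    have "Vector_Spaces.linear (*) sc (\<lambda>c. sc c v0)"
      by (simp add: Vector_Spaces.linear_iff vs sc sc.scale_left_distrib)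
    moreover have "bij (\<lambda>c. sc c v0)"
      unfolding bij_def inj_def surj_def using ch'(2,3) by (auto simp: sc.scale_right_imp_eq)
    moreover have "sc (V a z) v0 = W a (sc z v0)" if "a \<in> C_alg \<theta>" for a z
      using character_unique[OF ixs ch ch'(1) that] that by (simp add: V_def ch'(4))
    ultimately show ?thesis unfolding module_isomorphic_def by blast
  qed
  ultimately show ?thesis
    by (intro exI[of _ V] conjI ballI allI impI acts A_setI ch_values[OF ixs])
qed

end
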